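(* Any $C^{(3)}$ non-degenerate planar curve $\mathcal{C}\subset\mathbb{R}^2$ is of Khintchine type for divergence; that is, for every approximating function $\psi$ with $\sum_{h=1}^\infty\psi(h)^2=\infty$, almost every point of $\mathcal{C}$ (with respect to the induced one-dimensional Lebesgue measure on $\mathcal{C}$) is simultaneously $\psi$-approximable.
   Context: An approximating function is a decreasing function $\psi:\mathbb{R}^+\to\mathbb{R}^+$. For $x\in\mathbb{R}$, $\|x\|=\min\{|x-m|:m\in\mathbb{Z}\}$. A point $(y_1,y_2)\in\mathbb{R}^2$ is simultaneously $\psi$-approximable if there are infinitely many $q\in\mathbb{N}$ with $\max(\|qy_1\|,\|qy_2\|)<\psi(q)$. A map $\mathbf{f}:U\to\mathbb{R}^2$, with $U\subset\mathbb{R}$ open, is non-degenerate at $u\in U$ if there is $l\in\mathbb{N}$ such that $\mathbf{f}$ is $l$ times continuously differentiable on some sufficiently small ball centred at $u$ and the derivatives of $\mathbf{f}$ at $u$ of orders $1,\dots,l$ span $\mathbb{R}^2$; $\mathbf{f}$ is non-degenerate if it is non-degenerate at Lebesgue-almost every $u\in U$. A planar curve is non-degenerate if it is the image $\mathbf{f}(U)$ of a non-degenerate map (equivalently, the set of points of the curve at which the curvature vanishes has one-dimensional Lebesgue measure zero on the curve), and it is a $C^{(3)}$ curve if $\mathbf{f}$ is 3-times continuously differentiable. *)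

theory Defs
  imports "HOL-Analysis.Analysis"
begin

definition approximating_function :: "(real \<Rightarrow> real) \<Rightarrow> bool" where
  "approximating_function \<psi> \<longleftrightarrow>
     (\<forall>x>0. 0 < \<psi> x) \<and> (\<forall>x y. 0 < x \<longrightarrow> x \<le> y \<longrightarrow> \<psi> y \<le> \<psi> x)"

(* The infimum is attained, at a nearest integer. *)
definition int_dist :: "real \<Rightarrow> real" where
  "int_dist x = (INF m::int. \<bar>x - of_int m\<bar>)"

definition simultaneously_approximable :: "(real \<Rightarrow> real) \<Rightarrow> real ^ 2 \<Rightarrow> bool" where
  "simultaneously_approximable \<psi> y \<longleftrightarrow>
     infinite {q::nat. 0 < q \<and>
       max (int_dist (real q * y $ 1)) (int_dist (real q * y $ 2)) < \<psi> (real q)}"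

definition higher_vector_derivative ::
    "nat \<Rightarrow> (real \<Rightarrow> 'a::real_normed_vector) \<Rightarrow> real \<Rightarrow> 'a" where
  "higher_vector_derivative k f = ((\<lambda>g t. vector_derivative g (at t)) ^^ k) f"

(* Intended for open S only: the derivatives are two-sided. *)
definition Ck_on :: "nat \<Rightarrow> (real \<Rightarrow> 'a::real_normed_vector) \<Rightarrow> real set \<Rightarrow> bool" where
  "Ck_on k f S \<longleftrightarrow>
     (\<forall>j<k. \<forall>t\<in>S. higher_vector_derivative j f differentiable (at t)) \<and>
     continuous_on S (higher_vector_derivative k f)"

(* U is an argument because f is total while only its restriction to U is meaningful. *)
definition nondegenerate_at :: "real set \<Rightarrow> (real \<Rightarrow> real ^ 2) \<Rightarrow> real \<Rightarrow> bool" where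
  "nondegenerate_at U f u \<longleftrightarrow>
     (\<exists>l. (\<exists>r>0. ball u r \<subseteq> U \<and> Ck_on l f (ball u r)) \<and>
          span ((\<lambda>j. higher_vector_derivative j f u) ` {1..l}) = UNIV)"

definition nondegenerate_on :: "real set \<Rightarrow> (real \<Rightarrow> real ^ 2) \<Rightarrow> bool" where
  "nondegenerate_on U f \<longleftrightarrow> (AE u in lebesgue_on U. nondegenerate_at U f u)"

(* One-dimensional Hausdorff outer measure.  Restricted to a curve it is the induced
   one-dimensional Lebesgue measure (length); it depends only on the point set and not on
   a parametrisation.  Boundedness of the covering sets is required because
   diameter is unspecified on unbounded sets. *)
definition hausdorff1 :: "'a::metric_space set \<Rightarrow> ennreal" where
  "hausdorff1 A =
     (SUP \<delta>\<in>{0<..}.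
        INF E\<in>{E::nat \<Rightarrow> 'a set. A \<subseteq> (\<Union>i. E i) \<and>
                 (\<forall>i. bounded (E i) \<and> diameter (E i) \<le> \<delta>)}.
          (\<Sum>i. ennreal (diameter (E i))))"

definition almost_every_point :: "(real ^ 2) set \<Rightarrow> (real ^ 2 \<Rightarrow> bool) \<Rightarrow> bool" where
  "almost_every_point C P \<longleftrightarrow> hausdorff1 {y \<in> C. \<not> P y} = 0"

definition khintchine_type_divergence :: "(real ^ 2) set \<Rightarrow> bool" where
  "khintchine_type_divergence C \<longleftrightarrow>
     (\<forall>\<psi>. approximating_function \<psi> \<longrightarrow>
          \<not> summable (\<lambda>h::nat. (\<psi> (real (Suc h)))\<^sup>2) \<longrightarrow>
          almost_every_point C (simultaneously_approximable \<psi>))"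

end

theory Submission
  imports Defs
begin

text \<open>
  Away from a countable set, a nondegenerate parameter has nonvanishing curvature, so the problem is
  local on an arc \<open>(X, Y)\<close> whose slope \<open>m = Y' / X'\<close> is strictly monotone. The key point is that for
  \<open>Q\<close> and \<open>Q \<Phi>\<close> large the inequalities \<open>\<bar>q\<bar> < \<eta> Q\<close>, \<open>\<bar>q X - p\<bar> < \<eta> / (Q \<Phi>)\<close> and
  \<open>\<bar>q Y - r - m (q X - p)\<bar> < \<eta> \<Phi>\<close> have a nonzero integer solution only on a small part of the arc. This
  is a three-dimensional instance of the Kleinbock--Margulis nondivergence estimate: integer vectors and their
  duals give functions of the parameter that are small only on small proportions of intervals, and a
  flag of a vector and an orthogonal dual vector of moderate size excludes shorter vectors.

  Off this part, the pigeonhole principle yields a denominator \<open>q\<close> comparable to \<open>Q\<close>. Hence the rational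
  points \<open>(p / q, r / q)\<close> within about \<open>\<Phi> / Q\<close> of the arc are \<open>1 / (Q\<^sup>2 \<Phi>)\<close>-dense in a
  positive proportion of every interval. Taking \<open>Q = S ^ (2 n)\<close> and \<open>\<Phi>\<close> of size \<open>\<psi>(S\<^sup>2 Q)\<close>, the balls of radius
  comparable to \<open>\<Phi> / Q\<close> around them consist of approximable points, and their relative measures sum to a multiple
  of the divergent series. A packing argument then shows that their limsup has positive proportion in every interval,
  so it has full measure.
\<close>

section \<open>Coverings by intervals\<close>

text \<open>The bounds \<open>Q\<close>, \<open>1 / (Q * \<Phi>)\<close> and \<open>\<Phi>\<close>
  multiply to 1, the covolume of the integer vectors, so typically no rescaled vector should be much
  shorter than 1. Uniformity over all integer vectors comes from Y' = m X': each coordinate of a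
  rescaled vector or dual vector is constant, or affine in \<open>X\<close> or \<open>m\<close>, or
  has such an affine function times a pinched factor (\<open>dX\<close> or \<open>dm\<close>) as its
  derivative. Balls of radius \<Phi> / Q at spacing 1 / (Q^2 \<Phi>) have relative measure Q
  \<Phi>^2; with \<Phi> about \<psi>(S^2 Q), its sum over the powers Q of S^2 is the Cauchy
  condensation of the given series. The obstacle is that \<psi> may be so small at some scales that
  Q \<Phi> stays bounded, where nondivergence says nothing, or that the spacings fail to decrease.
  Both are avoided by keeping only those n at which S^n y^2 is a record, where y = S^n \<Phi>; the
  discarded scales carry no more of the series than the kept ones.\<close>

lemma intervals_subcover_multiplicity_2:
  fixes l u :: "'i \<Rightarrow> real"
  assumes "finite A"
  shows "\<exists>B\<subseteq>A. (\<Union>i\<in>B. {l i<..<u i}) = (\<Union>i\<in>A. {l i<..<u i}) \<and>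
               (\<forall>x. card {i\<in>B. x \<in> {l i<..<u i}} \<le> 2)"
proof -
  define P where "P B \<longleftrightarrow> B \<subseteq> A \<and> (\<Union>i\<in>B. {l i<..<u i}) = (\<Union>i\<in>A. {l i<..<u i})" for B
  have "P A" by (simp add: P_def)
  \<comment> \<open>A subfamily of least cardinality with the same union; a redundant member would
    contradict this choice.\<close>
  then obtain B where B: "P B" "\<And>C. P C \<Longrightarrow> card B \<le> card C"
    by (metis exists_least_iff leI less_irrefl arg_min_natI arg_min_nat_le)
  have finB: "finite B" using B(1) assms finite_subset by (auto simp: P_def)
  have "card {i\<in>B. x \<in> {l i<..<u i}} \<le> 2" for x
  proof (rule ccontr)
    let ?S = "{i\<in>B. x \<in> {l i<..<u i}}"
    assume "\<not> card ?S \<le> 2"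
    hence c3: "card ?S \<ge> 3" by simp
    have finS: "finite ?S" using finB by simp
    have neS: "?S \<noteq> {}" using c3 by (metis card.empty not_numeral_le_zero)
    obtain i where i: "i \<in> ?S" "\<And>j. j \<in> ?S \<Longrightarrow> l i \<le> l j"
    proof -
      have "Min (l ` ?S) \<in> l ` ?S" using finS neS by (intro Min_in) auto
      then obtain i where "i \<in> ?S" "l i = Min (l ` ?S)" by (metis (no_types, lifting) imageE)
      moreover have "l i \<le> l j" if "j \<in> ?S" for j
        using that finS calculation(2) by simp
      ultimately show thesis using that by blast
    qed
    obtain j where j: "j \<in> ?S" "\<And>k. k \<in> ?S \<Longrightarrow> u k \<le> u j"
    proof -
      have "Max (u ` ?S) \<in> u ` ?S" using finS neS by (intro Max_in) auto
      then obtain j where "j \<in> ?S" "u j = Max (u ` ?S)" by (metis (no_types, lifting) imageE)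
      moreover have "u k \<le> u j" if "k \<in> ?S" for k
        using that finS calculation(2) by simp
      ultimately show thesis using that by blast
    qed
    have "\<not> ?S \<subseteq> {i, j}"
    proof
      assume "?S \<subseteq> {i,j}"
      hence "card ?S \<le> card {i,j}" by (intro card_mono) auto
      also have "\<dots> \<le> 2" by (simp add: card_insert_if)
      finally show False using c3 by simp
    qed
    then obtain k where k: "k \<in> ?S" "k \<noteq> i" "k \<noteq> j" by blast
    \<comment> \<open>All three intervals contain \<open>x\<close>, so the one reaching furthest
      left and the one reaching furthest right together cover the third.\<close>
    have sub: "{l k<..<u k} \<subseteq> {l i<..<u i} \<union> {l j<..<u j}"
    proof
      fix y assume y: "y \<in> {l k<..<u k}"
      show "y \<in> {l i<..<u i} \<union> {l j<..<u j}"
        using i(1) j(1) i(2)[OF k(1)] j(2)[OF k(1)] y by (cases "y \<le> x") auto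
    qed
    have "P (B - {k})"
    proof -
      have "(\<Union>i\<in>B. {l i<..<u i}) \<subseteq> (\<Union>i\<in>B - {k}. {l i<..<u i})"
      proof
        fix y assume "y \<in> (\<Union>i\<in>B. {l i<..<u i})"
        then obtain h where h: "h \<in> B" "y \<in> {l h<..<u h}" by blast
        show "y \<in> (\<Union>i\<in>B - {k}. {l i<..<u i})"
        proof (cases "h = k")
          case True
          then have "y \<in> {l i<..<u i} \<or> y \<in> {l j<..<u j}" using h sub by blast
          moreover have "i \<in> B - {k}" "j \<in> B - {k}" using i(1) j(1) k by auto
          ultimately show ?thesis by blast
        qed (use h in blast)
      qed
      then show ?thesis using B(1) unfolding P_def by blast
    qed
    from B(2)[OF this] k(1) finB show False
      by (metis (mono_tags, lifting) card_Diff1_less leD mem_Collect_eq)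
  qed
  then show ?thesis using B(1) unfolding P_def by blast
qed

text \<open>A point of \<open>B\<close> may be an endpoint of its interval, so every interval is
  enlarged to an open one before a finite subcover of a compact part of \<open>B\<close> is
  extracted. The constant 4 is 2 for the enlargement times 2 for the multiplicity of the
  subcover.\<close>

lemma measure_le_of_interval_density:
  fixes B :: "real set"
  assumes B: "B \<in> sets lebesgue" "B \<subseteq> {a..b}" and ab: "a \<le> b" and \<kappa>: "0 < \<kappa>"
    and dens: "\<And>x. x \<in> B \<Longrightarrow> \<exists>s t. s < t \<and> x \<in> {s..t} \<and> {s..t} \<subseteq> {a..b} \<and>
                 measure lebesgue (B \<inter> {s..t}) \<le> \<kappa> * (t - s)"
  shows "measure lebesgue B \<le> 4 * \<kappa> * (b - a)"
proof (rule field_le_epsilon)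
  fix e :: real assume "e > 0"
  have Blm: "B \<in> lmeasurable"
    using B by (meson bounded_closed_interval bounded_set_imp_lmeasurable bounded_subset)
  obtain K where K': "closed K" "K \<subseteq> B" "B - K \<in> lmeasurable" "emeasure lebesgue (B - K) < ennreal e"
    using sets_lebesgue_inner_closed[OF B(1) \<open>e > 0\<close>] by metis
  have "compact K"
    using K' B(2) by (meson bounded_closed_interval bounded_subset compact_eq_bounded_closed)
  moreover have "measure lebesgue B \<le> measure lebesgue K + e"
  proof -
    have "K \<in> lmeasurable" using \<open>compact K\<close> by (rule lmeasurable_compact)
    then have "measure lebesgue (B - K) = measure lebesgue B - measure lebesgue K"
      using K' Blm by (intro measurable_measure_Diff) auto
    moreover have "measure lebesgue (B - K) < e"
      using K'(3,4) \<open>e > 0\<close> by (simp add: emeasure_eq_measure2 ennreal_less_iff)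
    ultimately show ?thesis by simp
  qed
  ultimately have K: "compact K" "K \<subseteq> B" "measure lebesgue B \<le> measure lebesgue K + e"
    using K' by auto
  obtain s t where st: "\<And>x. x \<in> B \<Longrightarrow> s x < t x" "\<And>x. x \<in> B \<Longrightarrow> x \<in> {s x..t x}"
      "\<And>x. x \<in> B \<Longrightarrow> {s x..t x} \<subseteq> {a..b}"
      "\<And>x. x \<in> B \<Longrightarrow> measure lebesgue (B \<inter> {s x..t x}) \<le> \<kappa> * (t x - s x)"
    using dens by metis
  \<comment> \<open>The two margins together have length \<open>\<kappa> * (t x - s x)\<close>, so
    they add no more measure than the density bound already allows.\<close>
  define l where "l x = s x - \<kappa> * (t x - s x) / 2" for x
  define u where "u x = t x + \<kappa> * (t x - s x) / 2" for x
  have lu: "l x < s x" "t x < u x" "u x - l x = (t x - s x) + \<kappa> * (t x - s x)" if "x \<in> B" for x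
    using st(1)[OF that] \<kappa> by (auto simp: l_def u_def)
  have "K \<subseteq> (\<Union>x\<in>K. {l x<..<u x})"
    using st(2) lu K(2) by force
  then obtain A where A: "A \<subseteq> K" "finite A" "K \<subseteq> (\<Union>x\<in>A. {l x<..<u x})"
    using compactE_image[OF K(1), of K "\<lambda>x. {l x<..<u x}"] by (metis open_greaterThanLessThan)
  obtain C where C: "C \<subseteq> A" "(\<Union>i\<in>C. {l i<..<u i}) = (\<Union>i\<in>A. {l i<..<u i})"
      "\<And>x. card {i\<in>C. x \<in> {l i<..<u i}} \<le> 2"
    using intervals_subcover_multiplicity_2[OF A(2), of l u] by auto
  have finC: "finite C" and CB: "C \<subseteq> B" using C A K finite_subset by auto
  have piece: "measure lebesgue (B \<inter> {l x<..<u x}) \<le> 2 * \<kappa> * (t x - s x)" if x: "x \<in> B" for x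
  proof -
    have "B \<inter> {l x<..<u x} \<subseteq> (B \<inter> {s x..t x}) \<union> ({l x..s x} \<union> {t x..u x})" by auto
    then have "measure lebesgue (B \<inter> {l x<..<u x}) \<le> measure lebesgue ((B \<inter> {s x..t x}) \<union> ({l x..s x} \<union> {t x..u x}))"
      using Blm by (intro measure_mono_fmeasurable) (auto intro!: fmeasurable.Un fmeasurable_Int_fmeasurable)
    also have "\<dots> \<le> measure lebesgue (B \<inter> {s x..t x}) + measure lebesgue ({l x..s x} \<union> {t x..u x})"
      using Blm by (intro measure_Un_le) auto
    also have "measure lebesgue ({l x..s x} \<union> {t x..u x}) \<le> measure lebesgue {l x..s x} + measure lebesgue {t x..u x}"
      by (intro measure_Un_le) auto
    also have "\<dots> = \<kappa> * (t x - s x)" using lu[OF x] by (simp add: l_def u_def)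
    finally show ?thesis using st(4)[OF x] by simp
  qed
  have "measure lebesgue K \<le> measure lebesgue (\<Union>x\<in>C. B \<inter> {l x<..<u x})"
    using K A C Blm by (intro measure_mono_fmeasurable fmeasurable.finite_UN finC fmeasurable_Int_fmeasurable)
      (auto simp: compact_imp_closed)
  also have "\<dots> \<le> (\<Sum>x\<in>C. measure lebesgue (B \<inter> {l x<..<u x}))"
    using Blm by (intro measure_UNION_le finC) auto
  also have "\<dots> \<le> (\<Sum>x\<in>C. 2 * \<kappa> * (t x - s x))"
    using piece CB by (intro sum_mono) auto
  also have "\<dots> = 2 * \<kappa> * (\<Sum>x\<in>C. t x - s x)" by (simp add: sum_distrib_left)
  also have "(\<Sum>x\<in>C. t x - s x) \<le> 2 * (b - a)"
  proof -
    \<comment> \<open>The original lengths are summed, as the integral of a counting function: the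
      enlarged intervals may leave \<open>{a..b}\<close>, while their multiplicity bound passes to
      the smaller ones.\<close>
    have "(\<Sum>x\<in>C. t x - s x) = (\<Sum>x\<in>C. integral {a..b} (indicat_real {s x..t x}))"
    proof (intro sum.cong refl)
      fix x assume "x \<in> C"
      then have x: "x \<in> B" using CB by auto
      have "integral {a..b} (indicat_real {s x..t x}) = measure lebesgue ({s x..t x} \<inter> {a..b})"
        by (simp add: integral_indicator)
      also have "{s x..t x} \<inter> {a..b} = {s x..t x}" using st(3)[OF x] by auto
      finally show "t x - s x = integral {a..b} (indicat_real {s x..t x})" using st(1)[OF x] by simp
    qed
    also have "\<dots> = integral {a..b} (\<lambda>y. \<Sum>x\<in>C. indicat_real {s x..t x} y)"
      by (rule integral_sum[symmetric, OF finC]) (simp add: integrable_on_indicator)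
    also have "\<dots> \<le> integral {a..b} (\<lambda>y. 2)"
    proof (rule integral_le)
      show "(\<lambda>y. \<Sum>x\<in>C. indicat_real {s x..t x} y) integrable_on {a..b}"
        by (intro integrable_sum finC) (simp add: integrable_on_indicator)
      fix y assume "y \<in> {a..b}"
      have "(\<Sum>x\<in>C. indicat_real {s x..t x} y) = card {x\<in>C. y \<in> {s x..t x}}"
        using finC by (simp add: indicator_def sum.If_cases Int_def)
      also have "card {x\<in>C. y \<in> {s x..t x}} \<le> card {i\<in>C. y \<in> {l i<..<u i}}"
        using lu CB finC by (intro card_mono) force+
      also have "\<dots> \<le> 2" using C(3) .
      finally show "(\<Sum>x\<in>C. indicat_real {s x..t x} y) \<le> 2" by simp
    qed (auto simp: integrable_const_ivl)
    also have "\<dots> = 2 * (b - a)" using ab by simp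
    finally show ?thesis .
  qed
  finally have "measure lebesgue K \<le> 4 * \<kappa> * (b - a)" using \<kappa> by (simp add: algebra_simps)
  then show "measure lebesgue B \<le> 4 * \<kappa> * (b - a) + e" using K by linarith
qed

section \<open>Sublevel sets of quasi-quadratic functions\<close>

text \<open>\<open>M\<close> is the size of the leading coefficient. Keeping it apart from
  \<open>c1\<close> and \<open>c2\<close> makes the later bounds uniform over all integer vectors,
  and the sign \<sigma> covers coefficients of either sign.\<close>

definition quasi_linear_on :: "real \<Rightarrow> real \<Rightarrow> real \<Rightarrow> real set \<Rightarrow> (real \<Rightarrow> real) \<Rightarrow> bool" where
  "quasi_linear_on c1 c2 M I \<mu> \<longleftrightarrow>
     (\<exists>\<sigma>\<in>{1,-1}. \<forall>x\<in>I. \<forall>y\<in>I. x \<le> y \<longrightarrow>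
        c1 * M * (y - x) \<le> \<sigma> * (\<mu> y - \<mu> x) \<and> \<sigma> * (\<mu> y - \<mu> x) \<le> c2 * M * (y - x))"

lemma quasi_linear_on_subset:
  "quasi_linear_on c1 c2 M I \<mu> \<Longrightarrow> J \<subseteq> I \<Longrightarrow> quasi_linear_on c1 c2 M J \<mu>"
  unfolding quasi_linear_on_def by blast

lemma measure_le_of_diameter:
  fixes S :: "real set"
  assumes "\<And>x y. x \<in> S \<Longrightarrow> y \<in> S \<Longrightarrow> x \<le> y \<Longrightarrow> y - x \<le> d" "0 \<le> d"
  shows "\<exists>a. S \<subseteq> {a - d..a + d}"
proof (cases "S = {}")
  case False
  then obtain a where a: "a \<in> S" by blast
  have "S \<subseteq> {a - d..a + d}"
  proof
    fix x assume x: "x \<in> S"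
    show "x \<in> {a - d..a + d}"
      using assms(1)[OF a x] assms(1)[OF x a] assms(2) by (cases "a \<le> x") auto
  qed
  then show ?thesis by blast
qed auto

lemma measure_le_of_two_diameters:
  fixes S T :: "real set"
  assumes "\<And>x y. x \<in> S \<Longrightarrow> y \<in> S \<Longrightarrow> x \<le> y \<Longrightarrow> y - x \<le> d"
    and "\<And>x y. x \<in> T \<Longrightarrow> y \<in> T \<Longrightarrow> x \<le> y \<Longrightarrow> y - x \<le> d"
    and "0 \<le> d" "R \<subseteq> S \<union> T"
  shows "measure lebesgue R \<le> 4 * d"
proof -
  obtain a b where ab: "S \<subseteq> {a - d..a + d}" "T \<subseteq> {b - d..b + d}"
    using measure_le_of_diameter[of S d] measure_le_of_diameter[of T d] assms by metis
  show ?thesis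
  proof (cases "R \<in> sets lebesgue")
    case True
    have "measure lebesgue R \<le> measure lebesgue ({a - d..a + d} \<union> {b - d..b + d})"
      using ab assms True by (intro measure_mono_fmeasurable) (auto intro!: fmeasurable.Un)
    also have "\<dots> \<le> measure lebesgue {a - d..a + d} + measure lebesgue {b - d..b + d}"
      by (intro measure_Un_le) auto
    also have "\<dots> = 4 * d" using assms by simp
    finally show ?thesis .
  qed (use assms in \<open>simp add: measure_notin_sets\<close>)
qed

text \<open>After a change of variable with density \<open>w\<close>, the derivative of
  \<open>\<phi>\<close> is nearly linear with slope of order \<open>M\<close>, so
  \<open>\<phi>\<close> behaves like a quadratic polynomial with leading coefficient of order
  \<open>M\<close>. Only the bounds on \<open>w\<close> enter.\<close>

locale quasi_quadratic =
  fixes s t c1 c2 M :: real and \<phi> w \<mu> :: "real \<Rightarrow> real"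
  assumes st: "s \<le> t" and c: "0 < c1" "c1 \<le> c2" and M: "0 \<le> M"
    and deriv: "\<And>x. x \<in> {s..t} \<Longrightarrow> (\<phi> has_real_derivative w x * \<mu> x) (at x)"
    and w: "\<And>x. x \<in> {s..t} \<Longrightarrow> c1 \<le> w x \<and> w x \<le> c2"
    and incr: "\<And>x y. x \<in> {s..t} \<Longrightarrow> y \<in> {s..t} \<Longrightarrow> x \<le> y \<Longrightarrow>
        c1 * M * (y - x) \<le> \<mu> y - \<mu> x \<and> \<mu> y - \<mu> x \<le> c2 * M * (y - x)"
begin

lemma mvt:
  assumes "x \<in> {s..t}" "y \<in> {s..t}" "x < y"
  shows "\<exists>\<xi>. x < \<xi> \<and> \<xi> < y \<and> \<phi> y - \<phi> x = (y - x) * (w \<xi> * \<mu> \<xi>)"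
proof -
  have "(\<phi> has_real_derivative w z * \<mu> z) (at z)" if "x \<le> z" "z \<le> y" for z
    using assms that by (intro deriv) auto
  from MVT2[OF assms(3) this] show ?thesis by blast
qed

lemma mu_mono: "x \<in> {s..t} \<Longrightarrow> y \<in> {s..t} \<Longrightarrow> x \<le> y \<Longrightarrow> \<mu> x \<le> \<mu> y"
  using incr[of x y] c M by (smt (verit) mult_nonneg_nonneg)

text \<open>On the right half of the interval \<open>\<mu>\<close> is at least
  \<open>c1 * M * (y - x) / 2\<close>, so \<open>\<phi>\<close> gains at least half the length times
  \<open>c1\<close> times this; on the left half it does not decrease.\<close>

lemma growth_right:
  assumes "x \<in> {s..t}" "y \<in> {s..t}" "x < y" "0 \<le> \<mu> x"
  shows "c1\<^sup>2 * M * (y - x)\<^sup>2 / 4 \<le> \<phi> y - \<phi> x"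
proof -
  define z where "z = (x + y) / 2"
  have z: "z \<in> {s..t}" "x < z" "z < y" using assms by (auto simp: z_def)
  obtain \<xi> where \<xi>: "x < \<xi>" "\<xi> < z" "\<phi> z - \<phi> x = (z - x) * (w \<xi> * \<mu> \<xi>)"
    using mvt[OF assms(1) z(1,2)] by blast
  have "0 \<le> \<mu> \<xi>" "0 \<le> w \<xi>"
    using mu_mono[of x \<xi>] w[of \<xi>] \<xi> z assms c by auto
  then have 1: "\<phi> x \<le> \<phi> z" using \<xi> z by (smt (verit) mult_nonneg_nonneg)
  obtain \<zeta> where \<zeta>: "z < \<zeta>" "\<zeta> < y" "\<phi> y - \<phi> z = (y - z) * (w \<zeta> * \<mu> \<zeta>)"
    using mvt[OF z(1) assms(2) z(3)] by blast
  have "c1 * M * (z - x) \<le> \<mu> z - \<mu> x" using incr[of x z] assms z by auto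
  moreover have "\<mu> z \<le> \<mu> \<zeta>" using mu_mono[of z \<zeta>] \<zeta> z assms by auto
  ultimately have "c1 * M * (z - x) \<le> \<mu> \<zeta>" using assms by linarith
  moreover have "c1 \<le> w \<zeta>" using w[of \<zeta>] \<zeta> z assms by auto
  ultimately have "c1 * (c1 * M * (z - x)) \<le> w \<zeta> * \<mu> \<zeta>"
    using c M z by (intro mult_mono) auto
  then have "(y - z) * (c1 * (c1 * M * (z - x))) \<le> \<phi> y - \<phi> z"
    using \<zeta> z by (simp add: mult_left_mono)
  moreover have "(y - z) * (c1 * (c1 * M * (z - x))) = c1\<^sup>2 * M * (y - x)\<^sup>2 / 4"
    by (simp add: z_def power2_eq_square field_simps)
  ultimately show ?thesis using 1 by linarith
qed

lemma growth_left:
  assumes "x \<in> {s..t}" "y \<in> {s..t}" "x < y" "\<mu> y \<le> 0"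
  shows "c1\<^sup>2 * M * (y - x)\<^sup>2 / 4 \<le> \<phi> x - \<phi> y"
proof -
  interpret r: quasi_quadratic "- t" "- s" c1 c2 M "\<lambda>x. \<phi> (- x)" "\<lambda>x. w (- x)" "\<lambda>x. - \<mu> (- x)"
  proof
    fix x assume "x \<in> {- t..- s}"
    then have x: "- x \<in> {s..t}" by auto
    show "((\<lambda>x. \<phi> (- x)) has_real_derivative w (- x) * - \<mu> (- x)) (at x)"
      using deriv[OF x] by (simp add: DERIV_mirror)
    show "c1 \<le> w (- x) \<and> w (- x) \<le> c2" using w[OF x] .
  next
    fix x y assume "x \<in> {- t..- s}" "y \<in> {- t..- s}" "x \<le> y"
    then show "c1 * M * (y - x) \<le> - \<mu> (- y) - - \<mu> (- x) \<and> - \<mu> (- y) - - \<mu> (- x) \<le> c2 * M * (y - x)"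
      using incr[of "-y" "-x"] by auto
  qed (use st c M in auto)
  show ?thesis using r.growth_right[of "-y" "-x"] assms by (simp add: power2_commute)
qed

text \<open>Either the curvature term dominates the slope, and on each side of the sign change of
  \<open>\<mu>\<close> quadratic growth confines the sublevel set, which produces
  \<open>sqrt \<theta>\<close>; or \<open>\<mu>\<close> hardly varies relative to its size, and
  \<open>\<phi>\<close> is strictly monotone with comparable slopes. In both cases the set lies in
  two pieces of diameter at most \<open>d\<close>, and 32 is 4 times the 8 in
  \<open>d\<close>.\<close>

lemma sublevel_measure:
  assumes \<theta>: "0 < \<theta>" "\<theta> \<le> 1/2" and A: "0 < A" and y0: "y0 \<in> {s..t}" "A \<le> \<bar>\<phi> y0\<bar>"
  shows "measure lebesgue {x\<in>{s..t}. \<bar>\<phi> x\<bar> < \<theta> * A} \<le> 32 * (c2 / c1) * sqrt \<theta> * (t - s)"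
    (is "measure lebesgue ?S \<le> _")
proof (cases "?S = {}")
  case True
  then show ?thesis unfolding True using \<theta> c st by simp
next
  case False
  then obtain x0 where x0: "x0 \<in> {s..t}" "\<bar>\<phi> x0\<bar> < \<theta> * A" by blast
  have \<theta>A: "\<theta> * A \<le> A / 2" using \<theta> A by simp
  have sq: "\<theta> \<le> sqrt \<theta>" using \<theta> by (intro real_le_rsqrt) (simp add: power2_eq_square)
  have ratio: "1 \<le> c2 / c1" using c by simp
  define d where "d = 8 * (c2 / c1) * sqrt \<theta> * (t - s)"
  have d: "0 \<le> d" using \<theta> c st by (simp add: d_def)
  define \<Lambda> where "\<Lambda> = max \<bar>\<mu> s\<bar> \<bar>\<mu> t\<bar>"
  have Lam: "\<bar>\<mu> x\<bar> \<le> \<Lambda>" if "x \<in> {s..t}" for x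
    using mu_mono[of s x] mu_mono[of x t] that st by (auto simp: \<Lambda>_def)
  have lip: "\<bar>\<phi> y - \<phi> x\<bar> \<le> c2 * \<Lambda> * (t - s)" if xy: "x \<in> {s..t}" "y \<in> {s..t}" "x < y" for x y
  proof -
    obtain \<xi> where \<xi>: "x < \<xi>" "\<xi> < y" "\<phi> y - \<phi> x = (y - x) * (w \<xi> * \<mu> \<xi>)"
      using mvt[OF xy] by blast
    have xi: "\<xi> \<in> {s..t}" using \<xi> that by auto
    have "\<bar>\<phi> y - \<phi> x\<bar> = (y - x) * (w \<xi> * \<bar>\<mu> \<xi>\<bar>)"
      using \<xi> that w[OF xi] c by (simp add: abs_mult)
    also have "\<dots> \<le> (t - s) * (c2 * \<Lambda>)"
      using that w[OF xi] c Lam[OF xi] by (intro mult_mono) auto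
    finally show ?thesis by (simp add: mult_ac)
  qed
  have osc: "A / 2 \<le> c2 * \<Lambda> * (t - s)"
  proof -
    have "A / 2 \<le> \<bar>\<phi> y0 - \<phi> x0\<bar>" using x0 y0 \<theta>A by linarith
    moreover have "y0 \<noteq> x0"
    proof
      assume "y0 = x0"
      then have "A \<le> \<bar>\<phi> x0\<bar>" using y0 by simp
      then show False using x0(2) \<theta>A A by linarith
    qed
    ultimately show ?thesis using lip[of x0 y0] lip[of y0 x0] x0 y0
      by (cases "x0 < y0") (auto simp: abs_minus_commute)
  qed
  have diff: "\<bar>\<phi> y - \<phi> x\<bar> < 2 * \<theta> * A" if "x \<in> ?S" "y \<in> ?S" for x y
    using that by auto
  have "measure lebesgue ?S \<le> 4 * d"
  \<comment> \<open>The oscillation bound turns a bound for the largest slope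
    \<open>\<Lambda>\<close> into one for \<open>A\<close>: here \<open>A\<close> is at most of
    order \<open>M * (t - s)\<close> times \<open>t - s\<close>. In the other case
    \<open>\<mu>\<close> varies by less than \<open>\<Lambda> / 2\<close> and so stays at least
    \<open>\<Lambda> / 2\<close> in absolute value.\<close>
  proof (cases "\<Lambda> \<le> 2 * c2 * M * (t - s)")
    case True
    have "A / 2 \<le> c2 * (2 * c2 * M * (t - s)) * (t - s)"
      using osc True c st by (smt (verit) mult_left_mono mult_right_mono)
    then have A4: "A \<le> 4 * c2\<^sup>2 * M * (t - s)\<^sup>2" by (simp add: power2_eq_square algebra_simps)
    then have Mpos: "0 < M" using A M by (cases "M = 0") auto
    have key: "y - x \<le> d" if "c1\<^sup>2 * M * (y - x)\<^sup>2 / 4 \<le> \<bar>\<phi> y - \<phi> x\<bar>" "x \<in> ?S" "y \<in> ?S" for x y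
    proof -
      have "c1\<^sup>2 * M * (y - x)\<^sup>2 / 4 \<le> 2 * \<theta> * (4 * c2\<^sup>2 * M * (t - s)\<^sup>2)"
        using that(1) diff[OF that(2,3)] A4 \<theta> by (smt (verit) mult_left_mono)
      then have "M * (c1\<^sup>2 * (y - x)\<^sup>2) \<le> M * (32 * \<theta> * c2\<^sup>2 * (t - s)\<^sup>2)" by (simp add: mult_ac)
      then have "c1\<^sup>2 * (y - x)\<^sup>2 \<le> 32 * \<theta> * c2\<^sup>2 * (t - s)\<^sup>2" using Mpos by simp
      also have "\<dots> \<le> 64 * \<theta> * c2\<^sup>2 * (t - s)\<^sup>2" using \<theta> by (intro mult_right_mono) auto
      finally have "(y - x)\<^sup>2 \<le> 64 * \<theta> * c2\<^sup>2 * (t - s)\<^sup>2 / c1\<^sup>2"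
        using c by (simp add: pos_le_divide_eq mult.commute)
      also have "\<dots> = d\<^sup>2" using \<theta> by (simp add: d_def power_mult_distrib power_divide)
      finally show ?thesis using d power2_le_imp_le by blast
    qed
    show ?thesis
    proof (rule measure_le_of_two_diameters)
      show "?S \<subseteq> {x\<in>?S. 0 \<le> \<mu> x} \<union> {x\<in>?S. \<mu> x \<le> 0}" by auto
      show "y - x \<le> d" if "x \<in> {x\<in>?S. 0 \<le> \<mu> x}" "y \<in> {x\<in>?S. 0 \<le> \<mu> x}" "x \<le> y" for x y
      proof (cases "x = y")
        case False
        have "c1\<^sup>2 * M * (y - x)\<^sup>2 / 4 \<le> \<phi> y - \<phi> x"
          using that False by (intro growth_right) auto
        also have "\<dots> \<le> \<bar>\<phi> y - \<phi> x\<bar>" by simp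
        finally have "c1\<^sup>2 * M * (y - x)\<^sup>2 / 4 \<le> \<bar>\<phi> y - \<phi> x\<bar>" .
        then show ?thesis by (rule key) (use that in auto)
      qed (use d in simp)
      show "y - x \<le> d" if "x \<in> {x\<in>?S. \<mu> x \<le> 0}" "y \<in> {x\<in>?S. \<mu> x \<le> 0}" "x \<le> y" for x y
      proof (cases "x = y")
        case False
        have "c1\<^sup>2 * M * (y - x)\<^sup>2 / 4 \<le> \<phi> x - \<phi> y"
          using that False by (intro growth_left) auto
        also have "\<dots> \<le> \<bar>\<phi> y - \<phi> x\<bar>" by simp
        finally have "c1\<^sup>2 * M * (y - x)\<^sup>2 / 4 \<le> \<bar>\<phi> y - \<phi> x\<bar>" .
        then show ?thesis by (rule key) (use that in auto)
      qed (use d in simp)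
    qed (rule d)
  next
    case False
    have "\<Lambda> \<noteq> 0" using osc A by auto
    moreover have "0 \<le> \<Lambda>" by (simp add: \<Lambda>_def)
    ultimately have Lpos: "0 < \<Lambda>" by simp
    have big: "\<Lambda> / 2 \<le> \<bar>\<mu> x\<bar>" if "x \<in> {s..t}" for x
    proof -
      have "\<mu> t - \<mu> s \<le> \<Lambda> / 2" using incr[of s t] st False by auto
      moreover have "\<mu> s \<le> \<mu> x" "\<mu> x \<le> \<mu> t" using mu_mono that st by auto
      ultimately show ?thesis using Lpos by (auto simp: \<Lambda>_def max_def abs_if split: if_splits)
    qed
    have key: "y - x \<le> d" if "x \<in> ?S" "y \<in> ?S" "x \<le> y" for x y
    proof (cases "x = y")
      case False
      then have xy: "x < y" "x \<in> {s..t}" "y \<in> {s..t}" using that by auto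
      obtain \<xi> where \<xi>: "x < \<xi>" "\<xi> < y" "\<phi> y - \<phi> x = (y - x) * (w \<xi> * \<mu> \<xi>)"
        using mvt[OF xy(2,3,1)] by blast
      have xi: "\<xi> \<in> {s..t}" using \<xi> that by auto
      have "(y - x) * (c1 * (\<Lambda> / 2)) \<le> (y - x) * (w \<xi> * \<bar>\<mu> \<xi>\<bar>)"
        using xy w[OF xi] big[OF xi] Lpos c by (intro mult_left_mono mult_mono) auto
      also have "\<dots> = \<bar>\<phi> y - \<phi> x\<bar>"
        using \<xi> xy w[OF xi] c by (simp add: abs_mult)
      also have "\<dots> \<le> 2 * \<theta> * A" using diff[OF that(1,2)] by simp
      also have "\<dots> \<le> 2 * \<theta> * (2 * c2 * \<Lambda> * (t - s))" using osc \<theta> by (intro mult_left_mono) auto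
      finally have "(y - x) * (c1 * (\<Lambda> / 2)) \<le> 2 * \<theta> * (2 * c2 * \<Lambda> * (t - s))" .
      moreover have "(y - x) * (c1 * (\<Lambda> / 2)) = \<Lambda> * (c1 * (y - x)) / 2"
        "2 * \<theta> * (2 * c2 * \<Lambda> * (t - s)) = \<Lambda> * (8 * c2 * \<theta> * (t - s)) / 2" by simp_all
      ultimately have "\<Lambda> * (c1 * (y - x)) \<le> \<Lambda> * (8 * c2 * \<theta> * (t - s))" by linarith
      then have "c1 * (y - x) \<le> 8 * c2 * \<theta> * (t - s)" using Lpos by simp
      also have "\<dots> \<le> 8 * c2 * sqrt \<theta> * (t - s)"
        using sq c st by (intro mult_right_mono mult_left_mono) auto
      finally show ?thesis using c by (simp add: d_def field_simps)
    qed (use d in simp)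
    show ?thesis
      by (rule measure_le_of_two_diameters[where S="?S" and T="?S"]) (use key d in auto)
  qed
  then show ?thesis by (simp add: d_def)
qed

end

lemma quasi_quadratic_oriented:
  assumes st: "s \<le> t" and c: "0 < c1" "c1 \<le> c2" and M: "0 \<le> M"
    and deriv: "\<And>x. x \<in> {s..t} \<Longrightarrow> (\<phi> has_real_derivative w x * \<mu> x) (at x)"
    and w: "\<And>x. x \<in> {s..t} \<Longrightarrow> c1 \<le> w x \<and> w x \<le> c2"
    and ql: "quasi_linear_on c1 c2 M {s..t} \<mu>"
  shows "\<exists>\<sigma>\<in>{1,-1}. quasi_quadratic s t c1 c2 M (\<lambda>x. \<sigma> * \<phi> x) w (\<lambda>x. \<sigma> * \<mu> x)"
proof -
  obtain \<sigma> :: real where \<sigma>: "\<sigma> \<in> {1,-1}" and inc: "\<And>x y. x \<in> {s..t} \<Longrightarrow> y \<in> {s..t} \<Longrightarrow> x \<le> y \<Longrightarrow>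
        c1 * M * (y - x) \<le> \<sigma> * (\<mu> y - \<mu> x) \<and> \<sigma> * (\<mu> y - \<mu> x) \<le> c2 * M * (y - x)"
    using ql unfolding quasi_linear_on_def by blast
  have "quasi_quadratic s t c1 c2 M (\<lambda>x. \<sigma> * \<phi> x) w (\<lambda>x. \<sigma> * \<mu> x)"
  proof
    fix x assume "x \<in> {s..t}"
    from DERIV_cmult[OF deriv[OF this], of \<sigma>]
    show "((\<lambda>x. \<sigma> * \<phi> x) has_real_derivative w x * (\<sigma> * \<mu> x)) (at x)" by (simp add: mult_ac)
  next
    fix x y assume "x \<in> {s..t}" "y \<in> {s..t}" "x \<le> y"
    from inc[OF this]
    show "c1 * M * (y - x) \<le> \<sigma> * \<mu> y - \<sigma> * \<mu> x \<and> \<sigma> * \<mu> y - \<sigma> * \<mu> x \<le> c2 * M * (y - x)"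
      by (simp add: right_diff_distrib)
  qed (use st c M w in auto)
  then show ?thesis using \<sigma> by blast
qed

lemma quasi_quadratic_sublevel_measure:
  assumes st: "s \<le> t" and c: "0 < c1" "c1 \<le> c2" and M: "0 \<le> M"
    and deriv: "\<And>x. x \<in> {s..t} \<Longrightarrow> (\<phi> has_real_derivative w x * \<mu> x) (at x)"
    and w: "\<And>x. x \<in> {s..t} \<Longrightarrow> c1 \<le> w x \<and> w x \<le> c2"
    and ql: "quasi_linear_on c1 c2 M {s..t} \<mu>"
    and \<theta>: "0 < \<theta>" "\<theta> \<le> 1/2" and A: "0 < A" and y0: "y0 \<in> {s..t}" "A \<le> \<bar>\<phi> y0\<bar>"
  shows "measure lebesgue {x\<in>{s..t}. \<bar>\<phi> x\<bar> < \<theta> * A} \<le> 32 * (c2 / c1) * sqrt \<theta> * (t - s)"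
proof -
  obtain \<sigma> :: real where \<sigma>: "\<sigma> \<in> {1,-1}"
    and q: "quasi_quadratic s t c1 c2 M (\<lambda>x. \<sigma> * \<phi> x) w (\<lambda>x. \<sigma> * \<mu> x)"
    using quasi_quadratic_oriented[OF st c M deriv w ql] by blast
  have "\<bar>\<sigma> * \<phi> x\<bar> = \<bar>\<phi> x\<bar>" for x using \<sigma> by auto
  then show ?thesis using quasi_quadratic.sublevel_measure[OF q \<theta> A y0(1)] y0(2) by simp
qed

text \<open>The sign of \<open>\<mu>\<close> at the midpoint selects a half on which
  \<open>\<phi>\<close> is forced to grow; its oscillation there is at least \<open>1/16\<close> of
  the squared product, so one end of that half carries half of it. In the application
  \<open>1 \<le> M\<close> holds because \<open>M\<close> is a nonzero integer in absolute
  value.\<close>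

lemma quasi_quadratic_ex_large:
  assumes st: "s < t" and c: "0 < c1" "c1 \<le> c2" and M: "1 \<le> M"
    and deriv: "\<And>x. x \<in> {s..t} \<Longrightarrow> (\<phi> has_real_derivative w x * \<mu> x) (at x)"
    and w: "\<And>x. x \<in> {s..t} \<Longrightarrow> c1 \<le> w x \<and> w x \<le> c2"
    and ql: "quasi_linear_on c1 c2 M {s..t} \<mu>"
  shows "\<exists>y\<in>{s..t}. c1\<^sup>2 * (t - s)\<^sup>2 / 32 \<le> \<bar>\<phi> y\<bar>"
proof -
  have st': "s \<le> t" and M0: "0 \<le> M" using st M by auto
  obtain \<sigma> :: real where \<sigma>: "\<sigma> \<in> {1,-1}"
    and q: "quasi_quadratic s t c1 c2 M (\<lambda>x. \<sigma> * \<phi> x) w (\<lambda>x. \<sigma> * \<mu> x)"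
    using quasi_quadratic_oriented[OF st' c M0 deriv w ql] by blast
  have ab: "\<bar>\<sigma> * \<phi> x\<bar> = \<bar>\<phi> x\<bar>" for x using \<sigma> by auto
  define z where "z = (s + t) / 2"
  have z: "z \<in> {s..t}" "s < z" "z < t" "t - z = (t - s) / 2" "z - s = (t - s) / 2" using st by (auto simp: z_def field_simps)
  have M': "c1\<^sup>2 * (t - s)\<^sup>2 / 16 \<le> c1\<^sup>2 * M * ((t - s) / 2)\<^sup>2 / 4"
    using M mult_right_mono[OF M, of "c1\<^sup>2 * (t - s)\<^sup>2"] by (simp add: power_divide mult_ac)
  show ?thesis
  proof (cases "0 \<le> \<sigma> * \<mu> z")
    case True
    have "c1\<^sup>2 * (t - s)\<^sup>2 / 16 \<le> \<sigma> * \<phi> t - \<sigma> * \<phi> z"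
      using quasi_quadratic.growth_right[OF q z(1) _ z(3) True] M' z st by simp
    then have "c1\<^sup>2 * (t - s)\<^sup>2 / 32 \<le> \<bar>\<phi> t\<bar> \<or> c1\<^sup>2 * (t - s)\<^sup>2 / 32 \<le> \<bar>\<phi> z\<bar>"
      using ab[of t] ab[of z] by linarith
    then show ?thesis using z st by auto
  next
    case False
    then have F: "\<sigma> * \<mu> z \<le> 0" by simp
    have "c1\<^sup>2 * (t - s)\<^sup>2 / 16 \<le> \<sigma> * \<phi> s - \<sigma> * \<phi> z"
      using quasi_quadratic.growth_left[OF q _ z(1) z(2) F] M' z st by simp
    then have "c1\<^sup>2 * (t - s)\<^sup>2 / 32 \<le> \<bar>\<phi> s\<bar> \<or> c1\<^sup>2 * (t - s)\<^sup>2 / 32 \<le> \<bar>\<phi> z\<bar>"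
      using ab[of s] ab[of z] by linarith
    then show ?thesis using z st by auto
  qed
qed

lemma quasi_linear_on_affine:
  assumes "\<And>x y. x \<in> I \<Longrightarrow> y \<in> I \<Longrightarrow> x \<le> y \<Longrightarrow> c1 * (y - x) \<le> g y - g x \<and> g y - g x \<le> c2 * (y - x)"
  shows "quasi_linear_on c1 c2 \<bar>k\<bar> I (\<lambda>x. k * g x + d)"
  unfolding quasi_linear_on_def
proof (intro bexI[of _ "if 0 \<le> k then 1 else -1"] ballI impI)
  fix x y assume xy: "x \<in> I" "y \<in> I" "x \<le> y"
  have "\<bar>k\<bar> * (c1 * (y - x)) \<le> \<bar>k\<bar> * (g y - g x) \<and> \<bar>k\<bar> * (g y - g x) \<le> \<bar>k\<bar> * (c2 * (y - x))"
    using assms[OF xy] by (intro conjI mult_left_mono) auto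
  moreover have "(if 0 \<le> k then 1 else -1) * ((k * g y + d) - (k * g x + d)) = \<bar>k\<bar> * (g y - g x)"
    by (simp add: algebra_simps)
  ultimately show "c1 * \<bar>k\<bar> * (y - x) \<le> (if 0 \<le> k then 1 else - 1) * (k * g y + d - (k * g x + d)) \<and>
     (if 0 \<le> k then 1 else - 1) * (k * g y + d - (k * g x + d)) \<le> c2 * \<bar>k\<bar> * (y - x)"
    by (simp only: mult_ac)
qed auto

text \<open>The mean growth gives a bound linear in \<open>\<theta>\<close>; it is weakened to
  \<open>sqrt \<theta>\<close> so that all coordinates of the two norms obey one and the same
  estimate.\<close>

lemma quasi_linear_sublevel_measure:
  assumes c: "0 < c1" "c1 \<le> c2" and M: "0 \<le> M" and st: "s \<le> t"
    and ql: "quasi_linear_on c1 c2 M {s..t} \<mu>"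
    and \<theta>: "0 < \<theta>" "\<theta> \<le> 1/2" and A: "0 < A" and y0: "y0 \<in> {s..t}" "A \<le> \<bar>\<mu> y0\<bar>"
  shows "measure lebesgue {x\<in>{s..t}. \<bar>\<mu> x\<bar> < \<theta> * A} \<le> 32 * (c2 / c1) * sqrt \<theta> * (t - s)"
    (is "measure lebesgue ?S \<le> _")
proof (cases "?S = {}")
  case True
  then show ?thesis unfolding True using \<theta> c st by simp
next
  case False
  then obtain x0 where x0: "x0 \<in> {s..t}" "\<bar>\<mu> x0\<bar> < \<theta> * A" by blast
  have sq: "\<theta> \<le> sqrt \<theta>" using \<theta> by (intro real_le_rsqrt) (simp add: power2_eq_square)
  obtain \<sigma> :: real where \<sigma>: "\<sigma> \<in> {1,-1}" and inc: "\<And>x y. x \<in> {s..t} \<Longrightarrow> y \<in> {s..t} \<Longrightarrow> x \<le> y \<Longrightarrow>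
        c1 * M * (y - x) \<le> \<sigma> * (\<mu> y - \<mu> x) \<and> \<sigma> * (\<mu> y - \<mu> x) \<le> c2 * M * (y - x)"
    using ql unfolding quasi_linear_on_def by blast
  have inc': "c1 * M * (y - x) \<le> \<bar>\<mu> y - \<mu> x\<bar> \<and> \<bar>\<mu> y - \<mu> x\<bar> \<le> c2 * M * (t - s)"
    if "x \<in> {s..t}" "y \<in> {s..t}" "x \<le> y" for x y
  proof -
    have "c2 * M * (y - x) \<le> c2 * M * (t - s)" using that c M by (intro mult_left_mono) auto
    moreover have "0 \<le> c1 * M * (y - x)" using c M that by auto
    ultimately show ?thesis using inc[OF that] \<sigma> by auto
  qed
  have "A / 2 \<le> c2 * M * (t - s)"
  proof -
    have "\<theta> * A \<le> A / 2" using \<theta> A by simp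
    then have "A / 2 \<le> \<bar>\<mu> y0 - \<mu> x0\<bar>" using x0 y0 by linarith
    then show ?thesis using inc'[of x0 y0] inc'[of y0 x0] x0 y0
      by (cases "x0 \<le> y0") (auto simp: abs_minus_commute)
  qed
  then have Apos: "A \<le> 2 * c2 * M * (t - s)" by simp
  then have Mpos: "0 < M" using A M by (cases "M = 0") auto
  define d where "d = 8 * (c2 / c1) * sqrt \<theta> * (t - s)"
  have d: "0 \<le> d" using \<theta> c st by (simp add: d_def)
  have key: "y - x \<le> d" if "x \<in> ?S" "y \<in> ?S" "x \<le> y" for x y
  proof -
    have "c1 * M * (y - x) \<le> 2 * \<theta> * A" using inc'[of x y] that by auto
    also have "\<dots> \<le> 2 * \<theta> * (2 * c2 * M * (t - s))" using Apos \<theta> by (intro mult_left_mono) auto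
    finally have "M * (c1 * (y - x)) \<le> M * (4 * c2 * \<theta> * (t - s))" by (simp add: algebra_simps)
    then have "c1 * (y - x) \<le> 4 * c2 * \<theta> * (t - s)" using Mpos by simp
    also have "\<dots> \<le> 8 * c2 * sqrt \<theta> * (t - s)"
      using sq c st \<theta> by (intro mult_right_mono mult_mono) auto
    finally show ?thesis using c by (simp add: d_def field_simps)
  qed
  have "measure lebesgue ?S \<le> 4 * d"
    by (rule measure_le_of_two_diameters[where S="?S" and T="?S"]) (use key d in auto)
  then show ?thesis by (simp add: d_def)
qed

section \<open>Integer vectors and a dual pair of norms\<close>

type_synonym ivec = "int \<times> int \<times> int"

fun idot :: "ivec \<Rightarrow> ivec \<Rightarrow> int" where
  "idot (a, b, c) (q, p, r) = a * q + b * p + c * r"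

fun icross :: "ivec \<Rightarrow> ivec \<Rightarrow> ivec" where
  "icross (q, p, r) (q', p', r') = (p * r' - r * p', r * q' - q * r', q * p' - p * q')"

fun iscale :: "int \<Rightarrow> ivec \<Rightarrow> ivec" where
  "iscale k (q, p, r) = (k * q, k * p, k * r)"

text \<open>Coprimality of the three entries in its Bezout form: the vector \<open>s\<close>
  supplies multipliers directly in the divisibility arguments.\<close>

definition iprim :: "ivec \<Rightarrow> bool" where
  "iprim v \<longleftrightarrow> (\<exists>s. idot s v = 1)"

lemma idot_commute: "idot v w = idot w v"
  by (cases v; cases w) (simp add: mult.commute)

lemma iprim_nonzero: "iprim v \<Longrightarrow> v \<noteq> (0, 0, 0)"
  unfolding iprim_def by auto

text \<open>The multiplier is the pairing of \<open>b\<close> with a Bezout vector \<open>s\<close>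
  of \<open>v\<close>: parallelism allows each entry of \<open>b\<close>, multiplied by
  \<open>idot s v = 1\<close>, to be rewritten as \<open>idot s b\<close> times the entry of
  \<open>v\<close>.\<close>

lemma parallel_iprim:
  assumes "iprim v" "icross v b = (0, 0, 0)"
  shows "\<exists>k. b = iscale k v"
proof -
  obtain q p r where v: "v = (q, p, r)" by (cases v)
  obtain q' p' r' where b: "b = (q', p', r')" by (cases b)
  obtain s1 s2 s3 where s: "s1 * q + s2 * p + s3 * r = 1"
    using assms(1) unfolding iprim_def v by (metis idot.simps prod_cases3)
  have e: "p * r' = r * p'" "r * q' = q * r'" "q * p' = p * q'" using assms(2) v b by auto
  let ?k = "s1 * q' + s2 * p' + s3 * r'"
  have "q' = (s1 * q + s2 * p + s3 * r) * q'" "p' = (s1 * q + s2 * p + s3 * r) * p'"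
    "r' = (s1 * q + s2 * p + s3 * r) * r'" by (simp_all add: s)
  moreover have "(s1 * q + s2 * p + s3 * r) * q' = ?k * q" using e by algebra
  moreover have "(s1 * q + s2 * p + s3 * r) * p' = ?k * p" using e by algebra
  moreover have "(s1 * q + s2 * p + s3 * r) * r' = ?k * r" using e by algebra
  ultimately have "q' = ?k * q" "p' = ?k * p" "r' = ?k * r" by simp_all
  then show ?thesis using v b by auto
qed

lemma ex_iprim:
  assumes "v \<noteq> (0, 0, 0)"
  shows "\<exists>d v'. d \<noteq> 0 \<and> iprim v' \<and> v = iscale d v'"
proof -
  obtain q p r where v: "v = (q, p, r)" by (cases v)
  define g where "g = gcd p r"
  define d where "d = gcd q g"
  have d0: "d \<noteq> 0" using assms v by (auto simp: d_def g_def)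
  have "d dvd q" "d dvd p" "d dvd r"
    unfolding d_def g_def by (meson dvd_trans gcd_dvd1 gcd_dvd2)+
  then obtain q' p' r' where q': "q = d * q'" "p = d * p'" "r = d * r'" by (metis dvdE)
  obtain x y where xy: "x * p + y * r = g" using bezout_int[of p r] by (auto simp: g_def)
  obtain z u where "z * q + u * g = d" using bezout_int[of q g] by (auto simp: d_def)
  then have "z * q + (u * x) * p + (u * y) * r = d" unfolding xy[symmetric] by (simp add: algebra_simps)
  then have "d * (z * q' + (u * x) * p' + (u * y) * r') = d * 1" unfolding q' by (simp add: algebra_simps)
  then have "idot (z, u * x, u * y) (q', p', r') = 1" using d0 by (simp add: mult_cancel_left)
  then have "iprim (q', p', r')" unfolding iprim_def by blast
  then show ?thesis using d0 q' v by (intro exI[of _ d] exI[of _ "(q', p', r')"]) simp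
qed

text \<open>This is the triple product expansion: w x (v x b) equals (w . b) v - (w . v) b.\<close>

lemma icross_common_normal:
  assumes "idot w v = 0" "idot w b = 0"
  shows "icross w (icross v b) = (0, 0, 0)"
proof -
  obtain q p r where v: "v = (q, p, r)" by (cases v)
  obtain q' p' r' where b: "b = (q', p', r')" by (cases b)
  obtain x y z where w: "w = (x, y, z)" by (cases w)
  have "y * (q * p' - p * q') - z * (r * q' - q * r') = q * idot w b - q' * idot w v"
    "z * (p * r' - r * p') - x * (q * p' - p * q') = p * idot w b - p' * idot w v"
    "x * (r * q' - q * r') - y * (p * r' - r * p') = r * idot w b - r' * idot w v"
    unfolding v b w by (simp_all add: algebra_simps)
  then show ?thesis using assms unfolding v b w by simp
qed

lemma idot_icross: "idot (icross v b) v = 0" "idot (icross v b) b = 0"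
  by (cases v; cases b; simp add: algebra_simps)+

lemma idot_iscale: "idot (iscale k v) w = k * idot v w"
  by (cases v; cases w; simp add: algebra_simps)

text \<open>The two norms are the maximum norms of \<open>g v\<close> and \<open>(g\<inverse>)\<^sup>T w\<close>, where \<open>g\<close> has determinant \<open>\<plusminus>1\<close> and sends
  \<open>(q, p, r)\<close> to \<open>q / Q\<close>, \<open>(q x - p) Q \<Phi>\<close> and \<open>(q y - r - m (q x - p)) / \<Phi>\<close>; the last expression
  measures the distance of \<open>(p / q, r / q)\<close> from the tangent line of slope \<open>m\<close> at \<open>(x, y)\<close>.\<close>

definition pnorm :: "real \<Rightarrow> real \<Rightarrow> real \<Rightarrow> real \<Rightarrow> real \<Rightarrow> ivec \<Rightarrow> real" where
  "pnorm Q \<Phi> x y m = (\<lambda>(q, p, r).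
     max (\<bar>real_of_int q\<bar> / Q) (max (\<bar>real_of_int q * x - real_of_int p\<bar> * (Q * \<Phi>))
       (\<bar>real_of_int q * y - real_of_int r - m * (real_of_int q * x - real_of_int p)\<bar> / \<Phi>)))"

definition dnorm :: "real \<Rightarrow> real \<Rightarrow> real \<Rightarrow> real \<Rightarrow> real \<Rightarrow> ivec \<Rightarrow> real" where
  "dnorm Q \<Phi> x y m = (\<lambda>(a, b, c).
     max (\<bar>real_of_int a + real_of_int b * x + real_of_int c * y\<bar> * Q)
       (max (\<bar>real_of_int b + real_of_int c * m\<bar> / (Q * \<Phi>)) (\<bar>real_of_int c\<bar> * \<Phi>)))"

lemma pnorm_nonneg: "0 < Q \<Longrightarrow> 0 \<le> pnorm Q \<Phi> x y m v"
  by (cases v) (auto simp: pnorm_def le_max_iff_disj)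

lemma dnorm_nonneg: "0 < Q \<Longrightarrow> 0 \<le> dnorm Q \<Phi> x y m v"
  by (cases v) (auto simp: dnorm_def le_max_iff_disj)

lemma max_scale: "0 \<le> (k::real) \<Longrightarrow> max (k * a) (max (k * b) (k * c)) = k * max a (max b c)"
  by (simp add: max_mult_distrib_left)

lemma pnorm_iscale: "pnorm Q \<Phi> x y m (iscale k v) = \<bar>real_of_int k\<bar> * pnorm Q \<Phi> x y m v"
proof -
  obtain q p r where v: "v = (q, p, r)" by (cases v)
  let ?k = "real_of_int k"
  have 1: "\<bar>?k * real_of_int q\<bar> / Q = \<bar>?k\<bar> * (\<bar>real_of_int q\<bar> / Q)" by (simp add: abs_mult)
  have "?k * real_of_int q * x - ?k * real_of_int p = ?k * (real_of_int q * x - real_of_int p)"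
    by (simp add: algebra_simps)
  then have 2: "\<bar>?k * real_of_int q * x - ?k * real_of_int p\<bar> * (Q * \<Phi>)
      = \<bar>?k\<bar> * (\<bar>real_of_int q * x - real_of_int p\<bar> * (Q * \<Phi>))" by (simp add: abs_mult)
  have "?k * real_of_int q * y - ?k * real_of_int r - m * (?k * real_of_int q * x - ?k * real_of_int p)
      = ?k * (real_of_int q * y - real_of_int r - m * (real_of_int q * x - real_of_int p))"
    by (simp add: algebra_simps)
  then have 3: "\<bar>?k * real_of_int q * y - ?k * real_of_int r - m * (?k * real_of_int q * x - ?k * real_of_int p)\<bar> / \<Phi>
      = \<bar>?k\<bar> * (\<bar>real_of_int q * y - real_of_int r - m * (real_of_int q * x - real_of_int p)\<bar> / \<Phi>)"
    by (simp add: abs_mult)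
  show ?thesis unfolding v pnorm_def iscale.simps prod.case of_int_mult 1 2 3 by (rule max_scale) simp
qed

lemma dnorm_iscale: "dnorm Q \<Phi> x y m (iscale k v) = \<bar>real_of_int k\<bar> * dnorm Q \<Phi> x y m v"
proof -
  obtain a b c where v: "v = (a, b, c)" by (cases v)
  let ?k = "real_of_int k"
  have "?k * real_of_int a + ?k * real_of_int b * x + ?k * real_of_int c * y
      = ?k * (real_of_int a + real_of_int b * x + real_of_int c * y)" by (simp add: algebra_simps)
  then have 1: "\<bar>?k * real_of_int a + ?k * real_of_int b * x + ?k * real_of_int c * y\<bar> * Q
      = \<bar>?k\<bar> * (\<bar>real_of_int a + real_of_int b * x + real_of_int c * y\<bar> * Q)" by (simp add: abs_mult)
  have "?k * real_of_int b + ?k * real_of_int c * m = ?k * (real_of_int b + real_of_int c * m)"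
    by (simp add: algebra_simps)
  then have 2: "\<bar>?k * real_of_int b + ?k * real_of_int c * m\<bar> / (Q * \<Phi>)
      = \<bar>?k\<bar> * (\<bar>real_of_int b + real_of_int c * m\<bar> / (Q * \<Phi>))" by (simp add: abs_mult)
  have 3: "\<bar>?k * real_of_int c\<bar> * \<Phi> = \<bar>?k\<bar> * (\<bar>real_of_int c\<bar> * \<Phi>)" by (simp add: abs_mult)
  show ?thesis unfolding v dnorm_def iscale.simps prod.case of_int_mult 1 2 3 by (rule max_scale) simp
qed

lemma norm_iscale_ge:
  "0 < Q \<Longrightarrow> k \<noteq> 0 \<Longrightarrow> pnorm Q \<Phi> x y m v \<le> pnorm Q \<Phi> x y m (iscale k v)"
  "0 < Q \<Longrightarrow> k \<noteq> 0 \<Longrightarrow> dnorm Q \<Phi> x y m v \<le> dnorm Q \<Phi> x y m (iscale k v)"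
proof -
  have "1 \<le> \<bar>real_of_int k\<bar>" if "k \<noteq> 0" using that by linarith
  then show "0 < Q \<Longrightarrow> k \<noteq> 0 \<Longrightarrow> pnorm Q \<Phi> x y m v \<le> pnorm Q \<Phi> x y m (iscale k v)"
    "0 < Q \<Longrightarrow> k \<noteq> 0 \<Longrightarrow> dnorm Q \<Phi> x y m v \<le> dnorm Q \<Phi> x y m (iscale k v)"
    using pnorm_nonneg[of Q \<Phi> x y m v] dnorm_nonneg[of Q \<Phi> x y m v]
    by (auto simp: pnorm_iscale dnorm_iscale mult_le_cancel_right1)
qed

text \<open>In the adapted coordinates the pairing becomes \<open>q * f1 - e1 * f2 - e2 * c\<close>,
  and the weights of the two norms are reciprocal in each of the three products. Hence the factor
  3.\<close>

lemma idot_le_norms: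
  assumes Q: "0 < Q" "0 < \<Phi>"
  shows "\<bar>real_of_int (idot w v)\<bar> \<le> 3 * (pnorm Q \<Phi> x y m v * dnorm Q \<Phi> x y m w)"
proof -
  obtain q p r where v: "v = (q, p, r)" by (cases v)
  obtain a b c where w: "w = (a, b, c)" by (cases w)
  let ?N = "pnorm Q \<Phi> x y m v" and ?D = "dnorm Q \<Phi> x y m w"
  define e1 e2 where "e1 = real_of_int q * x - real_of_int p"
    and "e2 = real_of_int q * y - real_of_int r - m * (real_of_int q * x - real_of_int p)"
  define f1 f2 where "f1 = real_of_int a + real_of_int b * x + real_of_int c * y"
    and "f2 = real_of_int b + real_of_int c * m"
  have N0: "0 \<le> ?N" "0 \<le> ?D" using pnorm_nonneg dnorm_nonneg Q by auto
  have N: "\<bar>real_of_int q\<bar> / Q \<le> ?N" "\<bar>e1\<bar> * (Q * \<Phi>) \<le> ?N" "\<bar>e2\<bar> / \<Phi> \<le> ?N"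
    by (auto simp: v pnorm_def e1_def e2_def)
  have D: "\<bar>f1\<bar> * Q \<le> ?D" "\<bar>f2\<bar> / (Q * \<Phi>) \<le> ?D" "\<bar>real_of_int c\<bar> * \<Phi> \<le> ?D"
    by (auto simp: w dnorm_def f1_def f2_def)
  have "real_of_int (idot w v) = real_of_int q * f1 - e1 * f2 - e2 * real_of_int c"
    unfolding v w e1_def e2_def f1_def f2_def by (simp add: algebra_simps)
  then have "\<bar>real_of_int (idot w v)\<bar> \<le> \<bar>real_of_int q * f1\<bar> + \<bar>e1 * f2\<bar> + \<bar>e2 * real_of_int c\<bar>" by linarith
  moreover have "\<bar>real_of_int q * f1\<bar> \<le> ?N * ?D"
    using mult_mono[OF N(1) D(1) N0(1)] Q by (simp add: abs_mult)
  moreover have "\<bar>e1 * f2\<bar> \<le> ?N * ?D"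
    using mult_mono[OF N(2) D(2) N0(1)] Q by (simp add: abs_mult)
  moreover have "\<bar>e2 * real_of_int c\<bar> \<le> ?N * ?D"
    using mult_mono[OF N(3) D(3) N0(1)] Q by (simp add: abs_mult)
  ultimately show ?thesis by linarith
qed

text \<open>The cross product transforms by the cofactor matrix, which is the inverse transpose up
  to sign since the determinant is 1 or -1. So every dual coordinate is a 2 by 2 minor of adapted
  coordinates, a difference of two products.\<close>

lemma dnorm_icross_le:
  assumes Q: "0 < Q" "0 < \<Phi>"
  shows "dnorm Q \<Phi> x y m (icross v v') \<le> 2 * (pnorm Q \<Phi> x y m v * pnorm Q \<Phi> x y m v')"
proof -
  obtain q p r where v: "v = (q, p, r)" by (cases v)
  obtain q' p' r' where v': "v' = (q', p', r')" by (cases v')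
  let ?N = "pnorm Q \<Phi> x y m v" and ?N' = "pnorm Q \<Phi> x y m v'"
  define e1 e2 where "e1 = real_of_int q * x - real_of_int p"
    and "e2 = real_of_int q * y - real_of_int r - m * (real_of_int q * x - real_of_int p)"
  define f1 f2 where "f1 = real_of_int q' * x - real_of_int p'"
    and "f2 = real_of_int q' * y - real_of_int r' - m * (real_of_int q' * x - real_of_int p')"
  have N0: "0 \<le> ?N" "0 \<le> ?N'" using pnorm_nonneg Q by auto
  have N: "\<bar>real_of_int q\<bar> / Q \<le> ?N" "\<bar>e1\<bar> * (Q * \<Phi>) \<le> ?N" "\<bar>e2\<bar> / \<Phi> \<le> ?N"
    by (auto simp: v pnorm_def e1_def e2_def)
  have N': "\<bar>real_of_int q'\<bar> / Q \<le> ?N'" "\<bar>f1\<bar> * (Q * \<Phi>) \<le> ?N'" "\<bar>f2\<bar> / \<Phi> \<le> ?N'"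
    by (auto simp: v' pnorm_def f1_def f2_def)
  have c: "real_of_int (q * p' - p * q') = real_of_int q' * e1 - real_of_int q * f1"
    unfolding e1_def f1_def by (simp add: algebra_simps)
  have b: "real_of_int (r * q' - q * r') + real_of_int (q * p' - p * q') * m
      = real_of_int q * f2 - real_of_int q' * e2"
    unfolding e2_def f2_def by (simp add: algebra_simps)
  have a: "real_of_int (p * r' - r * p') + real_of_int (r * q' - q * r') * x + real_of_int (q * p' - p * q') * y
      = e1 * f2 - e2 * f1"
    unfolding e1_def f1_def e2_def f2_def by (simp add: algebra_simps)
  have tri: "\<bar>s * t - s' * t'\<bar> * k \<le> \<bar>s\<bar> * \<bar>t\<bar> * k + \<bar>s'\<bar> * \<bar>t'\<bar> * k" if "0 \<le> k" for s t s' t' k :: real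
    using mult_right_mono[OF abs_triangle_ineq4[of "s * t" "s' * t'"] that] by (simp add: abs_mult distrib_right)
  have A: "\<bar>e1 * f2 - e2 * f1\<bar> * Q \<le> 2 * (?N * ?N')"
    using tri[of Q e1 f2 e2 f1] mult_mono[OF N(2) N'(3)] mult_mono[OF N(3) N'(2)] Q N0 by (simp add: mult_ac)
  have B: "\<bar>real_of_int q * f2 - real_of_int q' * e2\<bar> / (Q * \<Phi>) \<le> 2 * (?N * ?N')"
    using tri[of "1 / (Q * \<Phi>)" "real_of_int q" f2 "real_of_int q'" e2]
      mult_mono[OF N(1) N'(3)] mult_mono[OF N(3) N'(1)] Q N0 by (simp add: mult_ac)
  have C: "\<bar>real_of_int q' * e1 - real_of_int q * f1\<bar> * \<Phi> \<le> 2 * (?N * ?N')"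
    using tri[of \<Phi> "real_of_int q'" e1 "real_of_int q" f1]
      mult_mono[OF N(1) N'(2)] mult_mono[OF N(2) N'(1)] Q N0 by (simp add: mult_ac)
  show ?thesis
    using A B C unfolding v v' dnorm_def icross.simps prod.case a b
    unfolding c by (simp only: max.bounded_iff simp_thms)
qed

text \<open>The threshold \<open>1 / 3\<close> makes two vectors below it that pair non-trivially contradict
  the integrality of their pairing.\<close>

lemma pnorm_ge_of_flag:
  assumes Q: "0 < Q" "0 < \<Phi>" and \<eta>: "0 < \<eta>" "\<eta> \<le> 1/3"
    and v: "iprim v" "\<eta> \<le> pnorm Q \<Phi> x y m v" "pnorm Q \<Phi> x y m v \<le> 1/3"
    and w: "iprim w" "\<eta> \<le> dnorm Q \<Phi> x y m w" "dnorm Q \<Phi> x y m w \<le> 1/3"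
    and vw: "idot w v = 0" and b: "b \<noteq> (0, 0, 0)"
  shows "\<eta> \<le> pnorm Q \<Phi> x y m b"
proof -
  let ?N = "pnorm Q \<Phi> x y m" and ?D = "dnorm Q \<Phi> x y m"
  have nn: "0 \<le> ?N b" "0 \<le> ?N v" "0 \<le> ?D w" using pnorm_nonneg dnorm_nonneg Q by auto
  consider "idot w b \<noteq> 0" | "icross v b = (0,0,0)" | "idot w b = 0" "icross v b \<noteq> (0,0,0)" by blast
  then show ?thesis
  proof cases
    case 1
    then have "1 \<le> \<bar>real_of_int (idot w b)\<bar>" by linarith
    also have "\<dots> \<le> 3 * (?N b * ?D w)" by (rule idot_le_norms[OF Q])
    also have "\<dots> \<le> 3 * (?N b * (1/3))" using w nn by (intro mult_left_mono) auto
    finally show ?thesis using \<eta> by simp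
  next
    case 2
    then obtain k where k: "b = iscale k v" using parallel_iprim v by blast
    have "k \<noteq> 0" using b k by (cases v) auto
    then show ?thesis using norm_iscale_ge(1)[OF Q(1), of k \<Phi> x y m v] k v by simp
  next
    case 3
    obtain k where k: "icross v b = iscale k w"
      using parallel_iprim[OF w(1) icross_common_normal[OF vw 3(1)]] by blast
    have "k \<noteq> 0" using 3 k by (cases w) auto
    then have "\<eta> \<le> ?D (icross v b)" using norm_iscale_ge(2)[OF Q(1), of k \<Phi> x y m w] k w by simp
    also have "\<dots> \<le> 2 * (?N v * ?N b)" by (rule dnorm_icross_le[OF Q])
    also have "\<dots> \<le> 2 * ((1/3) * ?N b)" using v nn by (intro mult_left_mono mult_right_mono) auto
    finally show ?thesis using nn by simp
  qed
qed

text \<open>A vector shorter than \<eta> cannot be a multiple of \<open>v\<close>, so it spans a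
  plane with \<open>v\<close>. The primitive normal of this plane is no larger than the cross
  product, which is below \<open>2 * (1/3) * \<eta>\<close>.\<close>

lemma ex_normal_small:
  assumes Q: "0 < Q" "0 < \<Phi>" and \<eta>: "0 < \<eta>" "\<eta> \<le> 1/3"
    and v: "iprim v" "\<eta> \<le> pnorm Q \<Phi> x y m v" "pnorm Q \<Phi> x y m v \<le> 1/3"
    and b: "b \<noteq> (0, 0, 0)" "pnorm Q \<Phi> x y m b < \<eta>"
  shows "\<exists>w. iprim w \<and> idot w v = 0 \<and> dnorm Q \<Phi> x y m w < 1/3"
proof -
  let ?N = "pnorm Q \<Phi> x y m" and ?D = "dnorm Q \<Phi> x y m"
  have nn: "0 \<le> ?N b" "0 \<le> ?N v" using pnorm_nonneg Q by auto
  have "icross v b \<noteq> (0,0,0)"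
  proof
    assume "icross v b = (0,0,0)"
    then obtain k where k: "b = iscale k v" using parallel_iprim v by blast
    have "k \<noteq> 0" using b k by (cases v) auto
    then show False using norm_iscale_ge(1)[OF Q(1), of k \<Phi> x y m v] k v b by simp
  qed
  then obtain d w where w: "d \<noteq> 0" "iprim w" "icross v b = iscale d w" using ex_iprim by metis
  have "?D w \<le> ?D (icross v b)" using norm_iscale_ge(2)[OF Q(1), of d \<Phi> x y m w] w by simp
  also have "\<dots> \<le> 2 * (?N v * ?N b)" by (rule dnorm_icross_le[OF Q])
  also have "\<dots> \<le> 2 * ((1/3) * ?N b)" using v nn by (intro mult_left_mono mult_right_mono) auto
  also have "\<dots> < 1/3" using b \<eta> by simp
  finally have "?D w < 1/3" .
  moreover have "idot w v = 0" using idot_icross(1)[of v b] w by (simp add: idot_iscale)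
  ultimately show ?thesis using w by blast
qed

text \<open>The pairing of \<open>w\<close> with a vector shorter than \<eta> is an integer of
  absolute value below 1, hence zero; the primitive part of that vector is the required one.\<close>

lemma ex_orthogonal_small:
  assumes Q: "0 < Q" "0 < \<Phi>" and \<eta>: "0 < \<eta>" "\<eta> \<le> 1/3"
    and w: "dnorm Q \<Phi> x y m w \<le> 1/3"
    and b: "b \<noteq> (0, 0, 0)" "pnorm Q \<Phi> x y m b < \<eta>"
  shows "\<exists>v. iprim v \<and> idot w v = 0 \<and> pnorm Q \<Phi> x y m v < 1/3"
proof -
  let ?N = "pnorm Q \<Phi> x y m" and ?D = "dnorm Q \<Phi> x y m"
  have nn: "0 \<le> ?N b" "0 \<le> ?D w" using pnorm_nonneg dnorm_nonneg Q by auto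
  have wb: "idot w b = 0"
  proof (rule ccontr)
    assume "idot w b \<noteq> 0"
    then have "1 \<le> \<bar>real_of_int (idot w b)\<bar>" by linarith
    also have "\<dots> \<le> 3 * (?N b * ?D w)" by (rule idot_le_norms[OF Q])
    also have "\<dots> \<le> 3 * (?N b * (1/3))" using w nn by (intro mult_left_mono) auto
    finally show False using b \<eta> by simp
  qed
  obtain d v where v: "d \<noteq> 0" "iprim v" "b = iscale d v" using ex_iprim b by metis
  have "?N v < 1/3" using norm_iscale_ge(1)[OF Q(1), of d \<Phi> x y m v] v b \<eta> by simp
  moreover have "idot w v = 0" using wb v idot_iscale[of d v w] idot_commute by simp
  ultimately show ?thesis using v by blast
qed

section \<open>Quantitative nondivergence along a curved arc\<close>

lemma sublevel_lmeasurable: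
  fixes f :: "real \<Rightarrow> real"
  assumes "continuous_on {s..t} f"
  shows "{x\<in>{s..t}. f x < c} \<in> lmeasurable"
proof -
  have "closed {x\<in>{s..t}. c \<le> f x}"
    using assms by (intro continuous_on_closed_Collect_le) auto
  then have "{s..t} - {x\<in>{s..t}. c \<le> f x} \<in> lmeasurable"
    by (intro fmeasurable_Diff) auto
  moreover have "{s..t} - {x\<in>{s..t}. c \<le> f x} = {x\<in>{s..t}. f x < c}" by auto
  ultimately show ?thesis by simp
qed

lemma first_hit_right:
  fixes f :: "real \<Rightarrow> real"
  assumes f: "continuous_on {a..b} f" "f a < c" and y: "y \<in> {a..b}" "c \<le> f y"
  shows "\<exists>z. a < z \<and> z \<le> y \<and> f z = c \<and> (\<forall>x\<in>{a..z}. f x \<le> c)"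
proof -
  have ab: "a \<le> b" "a \<le> y" using y by auto
  have fy: "continuous_on {a..y} f" using f(1) y continuous_on_subset by fastforce
  have "closed {x\<in>{a..y}. c \<le> f x}" using fy by (intro continuous_on_closed_Collect_le) auto
  then have "compact {x\<in>{a..y}. c \<le> f x}"
    by (metis (no_types, lifting) bounded_closed_interval bounded_subset compact_eq_bounded_closed mem_Collect_eq subsetI)
  moreover have "{x\<in>{a..y}. c \<le> f x} \<noteq> {}" using y by auto
  ultimately have "\<exists>z\<in>{x\<in>{a..y}. c \<le> f x}. \<forall>x\<in>{x\<in>{a..y}. c \<le> f x}. z \<le> x"
    by (rule compact_attains_inf)
  then obtain z where z: "z \<in> {x\<in>{a..y}. c \<le> f x}" "\<And>x. x \<in> {x\<in>{a..y}. c \<le> f x} \<Longrightarrow> z \<le> x"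
    by blast
  have az: "a < z" using z(1) f(2) by (cases "a = z") auto
  have less: "f x < c" if "x \<in> {a..<z}" for x using z(1) z(2)[of x] that by fastforce
  have "\<exists>x\<ge>a. x \<le> z \<and> f x = c"
    using z f(2) az y by (intro IVT') (auto intro: continuous_on_subset[OF fy])
  then obtain x where x: "a \<le> x" "x \<le> z" "f x = c" by blast
  then have "f z = c" using less[of x] by (cases "x = z") auto
  then show ?thesis using az z(1) less by (intro exI[of _ z]) (auto simp: less_eq_real_def)
qed

lemma first_hit_left:
  fixes f :: "real \<Rightarrow> real"
  assumes f: "continuous_on {a..b} f" "f b < c" and y: "y \<in> {a..b}" "c \<le> f y"
  shows "\<exists>z. z < b \<and> y \<le> z \<and> f z = c \<and> (\<forall>x\<in>{z..b}. f x \<le> c)"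
proof -
  have "continuous_on {-b..-a} (\<lambda>x. f (- x))"
    by (rule continuous_on_compose2[OF f(1)]) (auto intro!: continuous_intros)
  from first_hit_right[OF this, of c "-y"] f y
  obtain z where z: "- b < z" "z \<le> - y" "f (- z) = c" "\<forall>x\<in>{- b..z}. f (- x) \<le> c" by auto
  have "f x \<le> c" if "x \<in> {-z..b}" for x using z(4)[rule_format, of "-x"] that by auto
  then show ?thesis using z by (intro exI[of _ "-z"]) auto
qed

lemma maximal_interval:
  fixes A :: "real set"
  assumes "compact A" "x \<in> A"
  shows "\<exists>s t. s \<le> x \<and> x \<le> t \<and> {s..t} \<subseteq> A \<and>
    (\<forall>s' t'. s' \<le> x \<and> x \<le> t' \<and> {s'..t'} \<subseteq> A \<longrightarrow> s \<le> s' \<and> t' \<le> t)"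
proof -
  let ?C = "connected_component_set A x"
  have sub: "?C \<subseteq> A" by (rule connected_component_subset)
  have "compact ?C"
    using assms(1) sub by (meson bounded_subset closed_connected_component compact_eq_bounded_closed)
  then obtain s t where C: "?C = {s..t}"
    using connected_compact_interval_1[of ?C] connected_connected_component by auto
  have x: "x \<in> ?C" using assms(2) by (simp add: connected_component_refl_eq)
  have "s \<le> s' \<and> t' \<le> t" if "s' \<le> x" "x \<le> t'" "{s'..t'} \<subseteq> A" for s' t'
  proof -
    have "{s'..t'} \<subseteq> ?C" using that by (intro connected_component_maximal) auto
    then show ?thesis unfolding C using that by auto
  qed
  then show ?thesis using x sub unfolding C by (intro exI[of _ s] exI[of _ t]) auto
qed

section \<open>Finiteness of the sets of short vectors and short dual vectors\<close>

lemma finite_int_box: "finite {v::ivec. case v of (q, p, r) \<Rightarrow>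
    \<bar>real_of_int q\<bar> \<le> R \<and> \<bar>real_of_int p\<bar> \<le> R \<and> \<bar>real_of_int r\<bar> \<le> R}"
proof (rule finite_subset)
  show "{v::ivec. case v of (q, p, r) \<Rightarrow>
    \<bar>real_of_int q\<bar> \<le> R \<and> \<bar>real_of_int p\<bar> \<le> R \<and> \<bar>real_of_int r\<bar> \<le> R}
    \<subseteq> {- \<lceil>R\<rceil>..\<lceil>R\<rceil>} \<times> {- \<lceil>R\<rceil>..\<lceil>R\<rceil>} \<times> {- \<lceil>R\<rceil>..\<lceil>R\<rceil>}"
  proof -
    have "- \<lceil>R\<rceil> \<le> k \<and> k \<le> \<lceil>R\<rceil>" if "\<bar>real_of_int k\<bar> \<le> R" for k using that by linarith
    then show ?thesis by auto
  qed
qed auto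

lemma finite_pnorm_le:
  assumes Q: "0 < Q" "0 < \<Phi>"
  shows "finite {v. pnorm Q \<Phi> x y m v \<le> C}"
proof -
  define R1 where "R1 = C * Q"
  define R2 where "R2 = R1 * \<bar>x\<bar> + C / (Q * \<Phi>)"
  define R3 where "R3 = R1 * \<bar>y\<bar> + \<bar>m\<bar> * (C / (Q * \<Phi>)) + C * \<Phi>"
  define R where "R = max R1 (max R2 R3)"
  have "{v. pnorm Q \<Phi> x y m v \<le> C} \<subseteq> {v::ivec. case v of (q, p, r) \<Rightarrow>
    \<bar>real_of_int q\<bar> \<le> R \<and> \<bar>real_of_int p\<bar> \<le> R \<and> \<bar>real_of_int r\<bar> \<le> R}"
  proof clarify
    fix q p r assume "pnorm Q \<Phi> x y m (q, p, r) \<le> C"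
    then have h: "\<bar>real_of_int q\<bar> / Q \<le> C" "\<bar>real_of_int q * x - real_of_int p\<bar> * (Q * \<Phi>) \<le> C"
      "\<bar>real_of_int q * y - real_of_int r - m * (real_of_int q * x - real_of_int p)\<bar> / \<Phi> \<le> C"
      by (auto simp: pnorm_def)
    have q: "\<bar>real_of_int q\<bar> \<le> R1" using h(1) Q by (simp add: R1_def field_simps)
    have e: "\<bar>real_of_int q * x - real_of_int p\<bar> \<le> C / (Q * \<Phi>)" using h(2) Q by (simp add: field_simps)
    have f: "\<bar>real_of_int q * y - real_of_int r - m * (real_of_int q * x - real_of_int p)\<bar> \<le> C * \<Phi>"
      using h(3) Q by (simp add: field_simps)
    have qx: "\<bar>real_of_int q * x\<bar> \<le> R1 * \<bar>x\<bar>" "\<bar>real_of_int q * y\<bar> \<le> R1 * \<bar>y\<bar>"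
      using q by (auto simp: abs_mult intro: mult_right_mono)
    have p: "\<bar>real_of_int p\<bar> \<le> R2" using e qx unfolding R2_def by linarith
    have "\<bar>m * (real_of_int q * x - real_of_int p)\<bar> \<le> \<bar>m\<bar> * (C / (Q * \<Phi>))"
      using e unfolding abs_mult by (intro mult_left_mono) auto
    then have "\<bar>real_of_int r\<bar> \<le> R3" using f qx unfolding R3_def by linarith
    then show "\<bar>real_of_int q\<bar> \<le> R \<and> \<bar>real_of_int p\<bar> \<le> R \<and> \<bar>real_of_int r\<bar> \<le> R"
      using p q by (auto simp: R_def)
  qed
  then show ?thesis using finite_int_box finite_subset by blast
qed

lemma finite_dnorm_le:
  assumes Q: "0 < Q" "0 < \<Phi>"
  shows "finite {v. dnorm Q \<Phi> x y m v \<le> C}"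
proof -
  define R3 where "R3 = C / \<Phi>"
  define R2 where "R2 = C * (Q * \<Phi>) + R3 * \<bar>m\<bar>"
  define R1 where "R1 = C / Q + R2 * \<bar>x\<bar> + R3 * \<bar>y\<bar>"
  define R where "R = max R1 (max R2 R3)"
  have "{v. dnorm Q \<Phi> x y m v \<le> C} \<subseteq> {v::ivec. case v of (q, p, r) \<Rightarrow>
    \<bar>real_of_int q\<bar> \<le> R \<and> \<bar>real_of_int p\<bar> \<le> R \<and> \<bar>real_of_int r\<bar> \<le> R}"
  proof clarify
    fix a b c assume "dnorm Q \<Phi> x y m (a, b, c) \<le> C"
    then have h: "\<bar>real_of_int a + real_of_int b * x + real_of_int c * y\<bar> * Q \<le> C"
       "\<bar>real_of_int b + real_of_int c * m\<bar> / (Q * \<Phi>) \<le> C" "\<bar>real_of_int c\<bar> * \<Phi> \<le> C"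
      by (auto simp: dnorm_def)
    have c: "\<bar>real_of_int c\<bar> \<le> R3" using h(3) Q by (simp add: R3_def field_simps)
    have e: "\<bar>real_of_int b + real_of_int c * m\<bar> \<le> C * (Q * \<Phi>)" using h(2) Q by (simp add: field_simps)
    have f: "\<bar>real_of_int a + real_of_int b * x + real_of_int c * y\<bar> \<le> C / Q"
      using h(1) Q by (simp add: field_simps)
    have cm: "\<bar>real_of_int c * m\<bar> \<le> R3 * \<bar>m\<bar>" "\<bar>real_of_int c * y\<bar> \<le> R3 * \<bar>y\<bar>"
      using c by (auto simp: abs_mult intro: mult_right_mono)
    have b: "\<bar>real_of_int b\<bar> \<le> R2" using e cm unfolding R2_def by linarith
    then have "\<bar>real_of_int b * x\<bar> \<le> R2 * \<bar>x\<bar>"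
      by (auto simp: abs_mult intro: mult_right_mono)
    then have "\<bar>real_of_int a\<bar> \<le> R1" using f cm unfolding R1_def by linarith
    then show "\<bar>real_of_int a\<bar> \<le> R \<and> \<bar>real_of_int b\<bar> \<le> R \<and> \<bar>real_of_int c\<bar> \<le> R"
      using b c by (auto simp: R_def)
  qed
  then show ?thesis using finite_int_box finite_subset by blast
qed

text \<open>Here \<open>m\<close> is the slope \<open>dY / dX\<close>, so the lower bound on \<open>dm\<close> says that the curvature does not
  vanish. Working with the given parameter avoids inverting \<open>X\<close>.\<close>

locale planar_curve =
  fixes \<alpha> \<beta> c1 c2 L :: real and X Y m dX dm :: "real \<Rightarrow> real"
  assumes \<alpha>\<beta>: "\<alpha> < \<beta>" and c: "0 < c1" "c1 \<le> c2"
    and derivX: "\<And>t. t \<in> {\<alpha>..\<beta>} \<Longrightarrow> (X has_real_derivative dX t) (at t)"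
    and derivY: "\<And>t. t \<in> {\<alpha>..\<beta>} \<Longrightarrow> (Y has_real_derivative dX t * m t) (at t)"
    and derivm: "\<And>t. t \<in> {\<alpha>..\<beta>} \<Longrightarrow> (m has_real_derivative dm t) (at t)"
    and dX: "\<And>t. t \<in> {\<alpha>..\<beta>} \<Longrightarrow> c1 \<le> dX t \<and> dX t \<le> c2"
    and dm: "\<And>t. t \<in> {\<alpha>..\<beta>} \<Longrightarrow> c1 \<le> dm t \<and> dm t \<le> c2"
    and m_le: "\<And>t. t \<in> {\<alpha>..\<beta>} \<Longrightarrow> \<bar>m t\<bar> \<le> L"
begin

lemma bilipschitz:
  assumes "\<And>t. t \<in> {\<alpha>..\<beta>} \<Longrightarrow> (g has_real_derivative dg t) (at t)"
    and "\<And>t. t \<in> {\<alpha>..\<beta>} \<Longrightarrow> c1 \<le> dg t \<and> dg t \<le> c2"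
    and "x \<in> {\<alpha>..\<beta>}" "y \<in> {\<alpha>..\<beta>}" "x \<le> y"
  shows "c1 * (y - x) \<le> g y - g x \<and> g y - g x \<le> c2 * (y - x)"
proof (cases "x = y")
  case False
  then have "x < y" using assms by simp
  moreover have "(g has_real_derivative dg t) (at t)" if "x \<le> t" "t \<le> y" for t
    using assms that by (intro assms(1)) auto
  ultimately obtain z where z: "z > x" "z < y" "g y - g x = (y - x) * dg z"
    using MVT2[of x y g dg] by blast
  have "c1 \<le> dg z \<and> dg z \<le> c2" using assms z by (intro assms(2)) auto
  then show ?thesis unfolding z(3) using assms(5)
    by (simp add: mult.commute[of _ "y - x"] mult_left_mono)
qed simp

lemma X_bilipschitz:
  assumes "x \<in> {\<alpha>..\<beta>}" "y \<in> {\<alpha>..\<beta>}" "x \<le> y"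
  shows "c1 * (y - x) \<le> X y - X x \<and> X y - X x \<le> c2 * (y - x)"
  by (rule bilipschitz[OF derivX dX assms])

lemma m_bilipschitz:
  assumes "x \<in> {\<alpha>..\<beta>}" "y \<in> {\<alpha>..\<beta>}" "x \<le> y"
  shows "c1 * (y - x) \<le> m y - m x \<and> m y - m x \<le> c2 * (y - x)"
  by (rule bilipschitz[OF derivm dm assms])

lemma continuous: "continuous_on {\<alpha>..\<beta>} X" "continuous_on {\<alpha>..\<beta>} Y" "continuous_on {\<alpha>..\<beta>} m"
  by (rule continuous_at_imp_continuous_on, use derivX derivY derivm DERIV_isCont in blast)+

text \<open>The flag selects between integer vectors (\<^term>\<open>True\<close>) and dual ones.\<close>

definition cnorm :: "real \<Rightarrow> real \<Rightarrow> bool \<Rightarrow> ivec \<Rightarrow> real \<Rightarrow> real" where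
  "cnorm Q \<Phi> b v t = (if b then pnorm Q \<Phi> (X t) (Y t) (m t) v else dnorm Q \<Phi> (X t) (Y t) (m t) v)"

abbreviation bad_points :: "real \<Rightarrow> real \<Rightarrow> real \<Rightarrow> real \<Rightarrow> real \<Rightarrow> real set" where
  "bad_points j0 j1 Q \<Phi> \<eta> \<equiv>
     {t\<in>{j0..j1}. \<exists>v. v \<noteq> (0, 0, 0) \<and> pnorm Q \<Phi> (X t) (Y t) (m t) v < \<eta>}"

lemma cnorm_continuous:
  assumes "0 < Q" "0 < \<Phi>"
  shows "continuous_on {\<alpha>..\<beta>} (cnorm Q \<Phi> b v)"
proof -
  obtain q p r where v: "v = (q, p, r)" by (cases v)
  show ?thesis
  proof (cases b)
    case True
    then have "cnorm Q \<Phi> b v = (\<lambda>t. pnorm Q \<Phi> (X t) (Y t) (m t) v)" by (auto simp: cnorm_def)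
    then show ?thesis unfolding v pnorm_def prod.case
      using assms continuous by (auto intro!: continuous_intros)
  next
    case False
    then have "cnorm Q \<Phi> b v = (\<lambda>t. dnorm Q \<Phi> (X t) (Y t) (m t) v)" by (auto simp: cnorm_def)
    then show ?thesis unfolding v dnorm_def prod.case
      using assms continuous by (auto intro!: continuous_intros)
  qed
qed

lemma X_quasi_linear: "quasi_linear_on c1 c2 \<bar>k\<bar> {\<alpha>..\<beta>} (\<lambda>t. k * X t + d)"
  by (rule quasi_linear_on_affine) (rule X_bilipschitz)

lemma m_quasi_linear: "quasi_linear_on c1 c2 \<bar>k\<bar> {\<alpha>..\<beta>} (\<lambda>t. k * m t + d)"
  by (rule quasi_linear_on_affine) (rule m_bilipschitz)

text \<open>The norm is a maximum of three coordinates, so smallness of the norm forces smallness of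
  the coordinate that reaches 1/3 at \<open>y0\<close>, and that coordinate alone is estimated. A
  constant coordinate leaves nothing; the other two are quasi-linear and quasi-quadratic with
  constants not depending on the vector.\<close>

lemma cnorm_sublevel_measure:
  assumes Q: "0 < Q" "0 < \<Phi>" and \<eta>: "0 < \<eta>" "\<eta> \<le> 1/6" and st: "s \<le> t" "{s..t} \<subseteq> {\<alpha>..\<beta>}"
    and y0: "y0 \<in> {s..t}" "1/3 \<le> cnorm Q \<Phi> b v y0"
  shows "measure lebesgue {x\<in>{s..t}. cnorm Q \<Phi> b v x < \<eta>} \<le> 32 * (c2 / c1) * sqrt (3 * \<eta>) * (t - s)"
    (is "measure lebesgue ?S \<le> ?R")
proof -
  \<comment> \<open>The level 1/3 is reached, so the relative threshold is
    \<open>3 * \<eta>\<close>; the bound \<open>\<eta> \<le> 1/6\<close> keeps it at most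
    1/2.\<close>
  have \<theta>: "0 < 3 * \<eta>" "3 * \<eta> \<le> 1/2" "3 * \<eta> * (1/3) = \<eta>" using \<eta> by auto
  have cont: "continuous_on {s..t} X" "continuous_on {s..t} Y" "continuous_on {s..t} m"
    using continuous continuous_on_subset st(2) by blast+
  have Sm: "?S \<in> sets lebesgue"
    using sublevel_lmeasurable[OF continuous_on_subset[OF cnorm_continuous[OF Q] st(2)]] by blast
  have sub: "measure lebesgue ?S \<le> ?R"
    if "continuous_on {s..t} g" "\<And>x. cnorm Q \<Phi> b v x < \<eta> \<Longrightarrow> \<bar>g x\<bar> < \<eta>"
      "measure lebesgue {x\<in>{s..t}. \<bar>g x\<bar> < (3 * \<eta>) * (1/3)} \<le> ?R" for g
  proof -
    have "measure lebesgue ?S \<le> measure lebesgue {x\<in>{s..t}. \<bar>g x\<bar> < (3 * \<eta>) * (1/3)}"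
      using that(1,2) Sm unfolding \<theta>(3)
      by (intro measure_mono_fmeasurable sublevel_lmeasurable) (auto intro: continuous_intros)
    then show ?thesis using that(3) by simp
  qed
  have third: "(0::real) < 1/3" by simp
  have R0: "0 \<le> ?R" using \<eta> c st by simp
  have inI: "x \<in> {\<alpha>..\<beta>}" if "x \<in> {s..t}" for x using st that by auto
  obtain q p r where v: "v = (q, p, r)" by (cases v)
  show ?thesis
  proof (cases b)
    case True
    define e where "e = (\<lambda>x. real_of_int q * (Q * \<Phi>) * X x + - (real_of_int p * (Q * \<Phi>)))"
    define h where "h = (\<lambda>x. (real_of_int q * Y x - real_of_int r - m x * (real_of_int q * X x - real_of_int p)) / \<Phi>)"
    have cn: "cnorm Q \<Phi> b v x = max (\<bar>real_of_int q\<bar> / Q) (max \<bar>e x\<bar> \<bar>h x\<bar>)" for x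
    proof -
      have "\<bar>e x\<bar> = \<bar>real_of_int q * X x - real_of_int p\<bar> * (Q * \<Phi>)"
      proof -
        have "e x = (real_of_int q * X x - real_of_int p) * (Q * \<Phi>)" by (simp add: e_def algebra_simps)
        then show ?thesis using Q by (simp add: abs_mult)
      qed
      moreover have "\<bar>h x\<bar> = \<bar>real_of_int q * Y x - real_of_int r - m x * (real_of_int q * X x - real_of_int p)\<bar> / \<Phi>"
        using Q by (simp add: h_def)
      ultimately show ?thesis using True by (simp add: cnorm_def pnorm_def v)
    qed
    consider "1/3 \<le> \<bar>real_of_int q\<bar> / Q" | "1/3 \<le> \<bar>e y0\<bar>" | "1/3 \<le> \<bar>h y0\<bar>"
      using y0(2) unfolding cn by (auto simp: le_max_iff_disj)
    then show ?thesis
    proof cases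
      case 1
      then have "\<not> cnorm Q \<Phi> b v x < \<eta>" for x unfolding cn using \<eta> by auto
      then have "?S = {}" by auto
      then show ?thesis using R0 by (simp only: measure_empty)
    next
      case 2
      have "quasi_linear_on c1 c2 \<bar>real_of_int q * (Q * \<Phi>)\<bar> {s..t} e"
        unfolding e_def by (rule quasi_linear_on_subset[OF X_quasi_linear st(2)])
      from quasi_linear_sublevel_measure[OF c _ st(1) this \<theta>(1,2) third y0(1) 2]
      have "measure lebesgue {x\<in>{s..t}. \<bar>e x\<bar> < (3 * \<eta>) * (1/3)} \<le> ?R" by simp
      note 1 = this
      have 2: "continuous_on {s..t} e" unfolding e_def by (intro continuous_intros cont)
      have 3: "\<bar>e x\<bar> < \<eta>" if "cnorm Q \<Phi> b v x < \<eta>" for x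
        using that unfolding cn by simp
      show ?thesis by (rule sub[OF 2 3 1])
    next
      case 3
      \<comment> \<open>Because Y' = m X', the terms q Y' and m q X' cancel in h' and only the
        derivative of the slope survives, multiplied by an affine function of
        \<open>X\<close>.\<close>
      let ?\<mu> = "\<lambda>x. - (real_of_int q / \<Phi>) * X x + real_of_int p / \<Phi>"
      have "quasi_linear_on c1 c2 \<bar>- (real_of_int q / \<Phi>)\<bar> {s..t} ?\<mu>"
        by (rule quasi_linear_on_subset[OF X_quasi_linear st(2)])
      moreover have "(h has_real_derivative dm x * ?\<mu> x) (at x)" if "x \<in> {s..t}" for x
        unfolding h_def using derivX[OF inI[OF that]] derivY[OF inI[OF that]] derivm[OF inI[OF that]] Q
        by (auto intro!: derivative_eq_intros simp: field_simps)
      moreover have "c1 \<le> dm x \<and> dm x \<le> c2" if "x \<in> {s..t}" for x using dm inI that by blast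
      ultimately have "measure lebesgue {x\<in>{s..t}. \<bar>h x\<bar> < (3 * \<eta>) * (1/3)} \<le> ?R"
        using st(1) c \<theta> y0(1) 3
        by (intro quasi_quadratic_sublevel_measure[where w = dm and \<mu> = ?\<mu> and M = "\<bar>- (real_of_int q / \<Phi>)\<bar>"]) auto
      note 1 = this
      have 2: "continuous_on {s..t} h" unfolding h_def using Q by (intro continuous_intros cont) auto
      have 3: "\<bar>h x\<bar> < \<eta>" if "cnorm Q \<Phi> b v x < \<eta>" for x
        using that unfolding cn by simp
      show ?thesis by (rule sub[OF 2 3 1])
    qed
  next
    case False
    define h where "h = (\<lambda>x. (real_of_int q + real_of_int p * X x + real_of_int r * Y x) * Q)"
    define e where "e = (\<lambda>x. real_of_int r / (Q * \<Phi>) * m x + real_of_int p / (Q * \<Phi>))"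
    have cn: "cnorm Q \<Phi> b v x = max \<bar>h x\<bar> (max \<bar>e x\<bar> (\<bar>real_of_int r\<bar> * \<Phi>))" for x
    proof -
      have "\<bar>e x\<bar> = \<bar>real_of_int p + real_of_int r * m x\<bar> / (Q * \<Phi>)"
      proof -
        have "e x = (real_of_int p + real_of_int r * m x) / (Q * \<Phi>)" by (simp add: e_def add_divide_distrib)
        then show ?thesis using Q by simp
      qed
      moreover have "\<bar>h x\<bar> = \<bar>real_of_int q + real_of_int p * X x + real_of_int r * Y x\<bar> * Q"
        using Q by (simp add: h_def abs_mult)
      ultimately show ?thesis unfolding cnorm_def if_not_P[OF False] dnorm_def v prod.case by (simp only:)
    qed
    consider "1/3 \<le> \<bar>real_of_int r\<bar> * \<Phi>" | "1/3 \<le> \<bar>e y0\<bar>" | "1/3 \<le> \<bar>h y0\<bar>"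
      using y0(2) unfolding cn by (auto simp: le_max_iff_disj)
    then show ?thesis
    proof cases
      case 1
      then have "\<not> cnorm Q \<Phi> b v x < \<eta>" for x unfolding cn using \<eta> by auto
      then have "?S = {}" by auto
      then show ?thesis using R0 by (simp only: measure_empty)
    next
      case 2
      have "quasi_linear_on c1 c2 \<bar>real_of_int r / (Q * \<Phi>)\<bar> {s..t} e"
        unfolding e_def by (rule quasi_linear_on_subset[OF m_quasi_linear st(2)])
      from quasi_linear_sublevel_measure[OF c _ st(1) this \<theta>(1,2) third y0(1) 2]
      have "measure lebesgue {x\<in>{s..t}. \<bar>e x\<bar> < (3 * \<eta>) * (1/3)} \<le> ?R" by simp
      note 1 = this
      have 2: "continuous_on {s..t} e" unfolding e_def by (intro continuous_intros cont)
      have 3: "\<bar>e x\<bar> < \<eta>" if "cnorm Q \<Phi> b v x < \<eta>" for x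
        using that unfolding cn by simp
      show ?thesis by (rule sub[OF 2 3 1])
    next
      case 3
      \<comment> \<open>For dual vectors the common factor of h' is \<open>dX\<close>, and what
        remains is affine in the slope \<open>m\<close>.\<close>
      let ?\<mu> = "\<lambda>x. (real_of_int r * Q) * m x + real_of_int p * Q"
      have "quasi_linear_on c1 c2 \<bar>real_of_int r * Q\<bar> {s..t} ?\<mu>"
        by (rule quasi_linear_on_subset[OF m_quasi_linear st(2)])
      moreover have "(h has_real_derivative dX x * ?\<mu> x) (at x)" if "x \<in> {s..t}" for x
        unfolding h_def using derivX[OF inI[OF that]] derivY[OF inI[OF that]]
        by (auto intro!: derivative_eq_intros simp: algebra_simps)
      moreover have "c1 \<le> dX x \<and> dX x \<le> c2" if "x \<in> {s..t}" for x using dX inI that by blast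
      ultimately have "measure lebesgue {x\<in>{s..t}. \<bar>h x\<bar> < (3 * \<eta>) * (1/3)} \<le> ?R"
        using st(1) c \<theta> y0(1) 3
        by (intro quasi_quadratic_sublevel_measure[where w = dX and \<mu> = ?\<mu> and M = "\<bar>real_of_int r * Q\<bar>"]) auto
      note 1 = this
      have 2: "continuous_on {s..t} h" unfolding h_def by (intro continuous_intros cont)
      have 3: "\<bar>h x\<bar> < \<eta>" if "cnorm Q \<Phi> b v x < \<eta>" for x
        using that unfolding cn by simp
      show ?thesis by (rule sub[OF 2 3 1])
    qed
  qed
qed

end

context planar_curve
begin

text \<open>Some nonzero entry has absolute value at least 1. Depending on which one it is, a
  coordinate is a nonzero constant, or an affine or quadratic expression whose oscillation over the
  interval exceeds a fixed \<delta>. Taking \<open>K = 1 / \<delta>\<close> lets the weights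
  \<open>Q\<close> and \<open>Q * \<Phi>\<close> lift \<delta> to at least 1.\<close>

lemma cnorm_large_eventually:
  assumes j: "j0 < j1" "{j0..j1} \<subseteq> {\<alpha>..\<beta>}"
  shows "\<exists>K>0. \<forall>Q \<Phi> b v. K \<le> Q \<longrightarrow> 0 < \<Phi> \<longrightarrow> \<Phi> \<le> 1 \<longrightarrow> K \<le> Q * \<Phi> \<longrightarrow> v \<noteq> (0, 0, 0) \<longrightarrow>
           (\<exists>t\<in>{j0..j1}. 1/3 \<le> cnorm Q \<Phi> b v t)"
proof -
  define \<delta> where "\<delta> = min 1 (min (c1 * (j1 - j0) / 2) (c1\<^sup>2 * (j1 - j0)\<^sup>2 / 32))"
  have \<delta>: "0 < \<delta>" "\<delta> \<le> 1" "\<delta> \<le> c1 * (j1 - j0) / 2" "\<delta> \<le> c1\<^sup>2 * (j1 - j0)\<^sup>2 / 32"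
    using j c by (auto simp: \<delta>_def)
  have jj: "j0 \<in> {j0..j1}" "j1 \<in> {j0..j1}" "j0 \<in> {\<alpha>..\<beta>}" "j1 \<in> {\<alpha>..\<beta>}" "j0 \<le> j1" using j by auto
  have one: "1 \<le> \<bar>real_of_int k\<bar>" if "k \<noteq> 0" for k using that by linarith
  have lin: "\<exists>t\<in>{j0..j1}. \<delta> \<le> \<bar>real_of_int k * X t + d\<bar>" if k: "k \<noteq> 0" for k d
  proof -
    have "c1 * (j1 - j0) \<le> X j1 - X j0" using X_bilipschitz jj by blast
    also have "\<dots> \<le> \<bar>X j1 - X j0\<bar>" by simp
    also have "\<dots> \<le> \<bar>real_of_int k\<bar> * \<bar>X j1 - X j0\<bar>" using one[OF k] by (simp add: mult_le_cancel_right1)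
    also have "\<dots> = \<bar>(real_of_int k * X j1 + d) - (real_of_int k * X j0 + d)\<bar>"
      unfolding abs_mult[symmetric] by (simp add: right_diff_distrib)
    finally have "c1 * (j1 - j0) / 2 \<le> \<bar>real_of_int k * X j1 + d\<bar> \<or> c1 * (j1 - j0) / 2 \<le> \<bar>real_of_int k * X j0 + d\<bar>"
      by linarith
    then show ?thesis using jj(1,2) \<delta>(3) by (meson order_trans)
  qed
  have quad: "\<exists>t\<in>{j0..j1}. \<delta> \<le> \<bar>real_of_int a + real_of_int k * X t + real_of_int l * Y t\<bar>" if l: "l \<noteq> 0" for a k l
  proof -
    let ?\<mu> = "\<lambda>x. real_of_int l * m x + real_of_int k"
    let ?\<phi> = "\<lambda>t. real_of_int a + real_of_int k * X t + real_of_int l * Y t"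
    have "\<exists>y\<in>{j0..j1}. c1\<^sup>2 * (j1 - j0)\<^sup>2 / 32 \<le> \<bar>?\<phi> y\<bar>"
    proof (rule quasi_quadratic_ex_large[where w = dX and \<mu> = ?\<mu> and M = "\<bar>real_of_int l\<bar>"])
      show "quasi_linear_on c1 c2 \<bar>real_of_int l\<bar> {j0..j1} ?\<mu>"
        by (rule quasi_linear_on_subset[OF m_quasi_linear j(2)])
      show "(?\<phi> has_real_derivative dX x * ?\<mu> x) (at x)" if "x \<in> {j0..j1}" for x
        using derivX[of x] derivY[of x] that j
        by (auto intro!: derivative_eq_intros simp: algebra_simps)
      show "c1 \<le> dX x \<and> dX x \<le> c2" if "x \<in> {j0..j1}" for x using dX that j by blast
    qed (use j c one[OF l] in auto)
    then show ?thesis using \<delta>(4) by (meson order_trans)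
  qed
  show ?thesis
  proof (intro exI[of _ "1 / \<delta>"] conjI allI impI)
    show "0 < 1 / \<delta>" using \<delta> by simp
    fix Q \<Phi> :: real and b and v :: ivec
    assume h: "1 / \<delta> \<le> Q" "0 < \<Phi>" "\<Phi> \<le> 1" "1 / \<delta> \<le> Q * \<Phi>" and v0: "v \<noteq> (0, 0, 0)"
    obtain q p r where v: "v = (q, p, r)" by (cases v)
    have Q1: "1 \<le> \<delta> * Q" "1 \<le> \<delta> * (Q * \<Phi>)" using h \<delta> by (simp_all add: field_simps)
    have "1 \<le> 1 / \<delta>" using \<delta> by simp
    then have Q: "1 \<le> Q" "1 \<le> Q * \<Phi>" using h by auto
    have big: "1/3 \<le> z * Q" "1/3 \<le> z * (Q * \<Phi>)" if "\<delta> \<le> z" for z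
    proof -
      have "\<delta> * Q \<le> z * Q" "\<delta> * (Q * \<Phi>) \<le> z * (Q * \<Phi>)" using that Q by (intro mult_right_mono; simp)+
      then show "1/3 \<le> z * Q" "1/3 \<le> z * (Q * \<Phi>)" using Q1 by linarith+
    qed
    have big1: "1/3 \<le> z * Q" "1/3 \<le> z * (Q * \<Phi>)" "1/3 \<le> z / \<Phi>" if "1 \<le> z" for z
      using big[of z] that \<delta> h by (auto simp: field_simps)
    show "\<exists>t\<in>{j0..j1}. 1/3 \<le> cnorm Q \<Phi> b v t"
    proof (cases b)
      case True
      then have cn: "cnorm Q \<Phi> b v t = pnorm Q \<Phi> (X t) (Y t) (m t) (q, p, r)" for t
        by (simp add: cnorm_def v)
      consider "q \<noteq> 0" | "q = 0" "p \<noteq> 0" | "q = 0" "p = 0" "r \<noteq> 0" using v v0 by auto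
      then show ?thesis
      proof cases
        case 1
        then obtain t where t: "t \<in> {j0..j1}" "\<delta> \<le> \<bar>real_of_int q * X t + - real_of_int p\<bar>" using lin by blast
        from big(2)[OF t(2)] show ?thesis
          using t(1) by (intro bexI[of _ t]) (auto simp: cn pnorm_def le_max_iff_disj)
      next
        case 2
        show ?thesis using big1(2)[OF one[OF 2(2)]] jj 2
          by (intro bexI[of _ j0]) (auto simp: cn pnorm_def le_max_iff_disj)
      next
        case 3
        show ?thesis using big1(3)[OF one[OF 3(3)]] jj 3
          by (intro bexI[of _ j0]) (auto simp: cn pnorm_def le_max_iff_disj)
      qed
    next
      case False
      then have cn: "cnorm Q \<Phi> b v t = dnorm Q \<Phi> (X t) (Y t) (m t) (q, p, r)" for t
        by (simp add: cnorm_def v)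
      consider "r \<noteq> 0" | "r = 0" "p \<noteq> 0" | "r = 0" "p = 0" "q \<noteq> 0" using v v0 by auto
      then show ?thesis
      proof cases
        case 1
        then obtain t where t: "t \<in> {j0..j1}" "\<delta> \<le> \<bar>real_of_int q + real_of_int p * X t + real_of_int r * Y t\<bar>"
          using quad by blast
        from big(1)[OF t(2)] show ?thesis
          using t(1) by (intro bexI[of _ t]) (auto simp: cn dnorm_def le_max_iff_disj)
      next
        case 2
        then obtain t where t: "t \<in> {j0..j1}" "\<delta> \<le> \<bar>real_of_int p * X t + real_of_int q\<bar>" using lin by blast
        from big(1)[OF t(2)] 2 show ?thesis
          using t(1) by (intro bexI[of _ t]) (auto simp: cn dnorm_def le_max_iff_disj add.commute)
      next
        case 3
        show ?thesis using big1(1)[OF one[OF 3(3)]] jj 3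
          by (intro bexI[of _ j0]) (auto simp: cn dnorm_def le_max_iff_disj)
      qed
    qed
  qed
qed

lemma finite_cnorm_le:
  assumes "0 < Q" "0 < \<Phi>"
  shows "finite {(b, v). cnorm Q \<Phi> b v t \<le> C}"
proof (rule finite_subset)
  show "{(b, v). cnorm Q \<Phi> b v t \<le> C} \<subseteq> UNIV \<times> ({v. pnorm Q \<Phi> (X t) (Y t) (m t) v \<le> C} \<union> {v. dnorm Q \<Phi> (X t) (Y t) (m t) v \<le> C})"
    by (auto simp: cnorm_def split: if_splits)
qed (use assms in \<open>simp add: finite_pnorm_le finite_dnorm_le\<close>)

text \<open>Among the finitely many primitive vectors that are small at \<open>x\<close>, choose the one that stays small
  on the longest interval around \<open>x\<close>; a vector small on all of that interval would stay small on a
  longer one.\<close>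

lemma maximal_cnorm_interval:
  assumes Q: "0 < Q" "0 < \<Phi>" and J: "{j0..j1} \<subseteq> {\<alpha>..\<beta>}" "x \<in> {j0..j1}"
    and large: "\<And>b v. v \<noteq> (0, 0, 0) \<Longrightarrow> \<exists>t\<in>{j0..j1}. 1/3 \<le> cnorm Q \<Phi> b v t"
    and small: "iprim v1" "cnorm Q \<Phi> b1 v1 x < 1/3"
  shows "\<exists>s t b v. s < t \<and> x \<in> {s..t} \<and> {s..t} \<subseteq> {j0..j1} \<and> iprim v \<and>
            (\<forall>y\<in>{s..t}. cnorm Q \<Phi> b v y \<le> 1/3) \<and>
            (\<forall>b v. iprim v \<longrightarrow> (\<exists>y\<in>{s..t}. 1/3 \<le> cnorm Q \<Phi> b v y))"
proof -
  define D where "D = {(b, v). iprim v \<and> cnorm Q \<Phi> b v x \<le> 1/3}"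
  have "D \<subseteq> {(b, v). cnorm Q \<Phi> b v x \<le> 1/3}" by (auto simp: D_def)
  then have finD: "finite D" using finite_cnorm_le[OF Q] finite_subset by blast
  have Dne: "(b1, v1) \<in> D" using small by (simp add: D_def)
  define A where "A bv = {y\<in>{j0..j1}. cnorm Q \<Phi> (fst bv) (snd bv) y \<le> 1/3}" for bv
  have contJ: "continuous_on {j0..j1} (cnorm Q \<Phi> b v)" for b v
    using continuous_on_subset[OF cnorm_continuous[OF Q] J(1)] .
  have "compact (A bv)" for bv
  proof -
    have "closed (A bv)" unfolding A_def using contJ by (intro continuous_on_closed_Collect_le) auto
    moreover have "bounded (A bv)" by (rule bounded_subset[of "{j0..j1}"]) (auto simp: A_def)
    ultimately show ?thesis by (simp add: compact_eq_bounded_closed)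
  qed
  moreover have "x \<in> A bv" if "bv \<in> D" for bv using that J by (auto simp: A_def D_def)
  ultimately have "\<exists>s t. s \<le> x \<and> x \<le> t \<and> {s..t} \<subseteq> A bv \<and>
    (\<forall>s' t'. s' \<le> x \<and> x \<le> t' \<and> {s'..t'} \<subseteq> A bv \<longrightarrow> s \<le> s' \<and> t' \<le> t)" if "bv \<in> D" for bv
    using maximal_interval that by blast
  then obtain S T where ST: "\<And>bv. bv \<in> D \<Longrightarrow> S bv \<le> x" "\<And>bv. bv \<in> D \<Longrightarrow> x \<le> T bv"
      "\<And>bv. bv \<in> D \<Longrightarrow> {S bv..T bv} \<subseteq> A bv"
      "\<And>bv s' t'. bv \<in> D \<Longrightarrow> s' \<le> x \<Longrightarrow> x \<le> t' \<Longrightarrow> {s'..t'} \<subseteq> A bv \<Longrightarrow> S bv \<le> s' \<and> t' \<le> T bv"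
    by metis
  have "Max ((\<lambda>bv. T bv - S bv) ` D) \<in> (\<lambda>bv. T bv - S bv) ` D"
    using finD Dne by (intro Max_in) auto
  then obtain bv0 where bv0: "bv0 \<in> D" "T bv0 - S bv0 = Max ((\<lambda>bv. T bv - S bv) ` D)" by force
  have mx: "T bv - S bv \<le> T bv0 - S bv0" if "bv \<in> D" for bv
    unfolding bv0(2) using finD that by (intro Max_ge) auto
  define s t where "s = S bv0" and "t = T bv0"
  have xst: "x \<in> {s..t}" using ST(1,2)[OF bv0(1)] by (simp add: s_def t_def)
  have stJ: "{s..t} \<subseteq> {j0..j1}" using ST(3)[OF bv0(1)] by (auto simp: s_def t_def A_def)
  have large': "\<exists>y\<in>{s..t}. 1/3 \<le> cnorm Q \<Phi> b v y" if v: "iprim v" for b v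
  proof (rule ccontr)
    assume "\<not> ?thesis"
    then have lt: "cnorm Q \<Phi> b v y < 1/3" if "y \<in> {s..t}" for y using that by force
    let ?bv = "(b, v)"
    have inD: "?bv \<in> D" using v lt[OF xst] by (simp add: D_def)
    have "{s..t} \<subseteq> A ?bv" using lt stJ by (auto simp: A_def less_imp_le)
    then have "S ?bv \<le> s" "t \<le> T ?bv" using ST(4)[OF inD, of s t] xst by auto
    \<comment> \<open>By maximality of the length, \<open>v\<close> has exactly the same interval
      although it is strictly below 1/3 on it. By continuity the interval of \<open>v\<close> would
      extend past any end interior to \<open>{j0..j1}\<close>, so both ends must agree with
      \<open>j0\<close> and \<open>j1\<close>.\<close>
    then have eq: "S ?bv = s" "T ?bv = t" using mx[OF inD] by (auto simp: s_def t_def)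
    have tj: "t = j1"
    proof (rule ccontr)
      assume "t \<noteq> j1"
      then have "t < j1" using stJ xst by auto
      have ct: "continuous_on {t..j1} (cnorm Q \<Phi> b v)"
        using continuous_on_subset[OF contJ] stJ xst by auto
      obtain z where z: "t < z" "z \<le> j1" "\<forall>y\<in>{t..z}. cnorm Q \<Phi> b v y \<le> 1/3"
      proof (cases "\<exists>y\<in>{t..j1}. 1/3 \<le> cnorm Q \<Phi> b v y")
        case True
        then obtain y where "y \<in> {t..j1}" "1/3 \<le> cnorm Q \<Phi> b v y" by blast
        from first_hit_right[OF ct _ this] lt[of t] xst that show thesis
          using \<open>y \<in> {t..j1}\<close> by force
      next
        case False
        then show thesis using that[of j1] \<open>t < j1\<close> by force
      qed
      have "{s..z} \<subseteq> A ?bv"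
        using z stJ lt xst by (auto simp: A_def) (metis atLeastAtMost_iff linear less_imp_le)
      then have "z \<le> T ?bv" using ST(4)[OF inD, of s z] xst z by auto
      then show False using eq z by simp
    qed
    have sj: "s = j0"
    proof (rule ccontr)
      assume "s \<noteq> j0"
      then have "j0 < s" using stJ xst by auto
      have ct: "continuous_on {j0..s} (cnorm Q \<Phi> b v)"
        using continuous_on_subset[OF contJ] stJ xst by auto
      obtain z where z: "z < s" "j0 \<le> z" "\<forall>y\<in>{z..s}. cnorm Q \<Phi> b v y \<le> 1/3"
      proof (cases "\<exists>y\<in>{j0..s}. 1/3 \<le> cnorm Q \<Phi> b v y")
        case True
        then obtain y where "y \<in> {j0..s}" "1/3 \<le> cnorm Q \<Phi> b v y" by blast
        from first_hit_left[OF ct _ this] lt[of s] xst that show thesis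
          using \<open>y \<in> {j0..s}\<close> by force
      next
        case False
        then show thesis using that[of j0] \<open>j0 < s\<close> by force
      qed
      have "{z..t} \<subseteq> A ?bv"
        using z stJ lt xst by (auto simp: A_def) (metis atLeastAtMost_iff linear less_imp_le)
      then have "S ?bv \<le> z" using ST(4)[OF inD, of z t] xst z by auto
      then show False using eq z by simp
    qed
    \<comment> \<open>What remains is a vector small on the whole of \<open>{j0..j1}\<close>, which
      the hypothesis on large values rules out.\<close>
    from large[OF iprim_nonzero[OF v], of b] lt show False using tj sj by force
  qed
  \<comment> \<open>On a one-point interval the given vector \<open>v1\<close> would have to reach
    1/3 at \<open>x\<close>, where it is strictly smaller.\<close>
  have "s \<noteq> t"
  proof
    assume "s = t"
    then have "{s..t} = {x}" using xst by auto
    then show False using large'[OF small(1), of b1] small(2) by auto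
  qed
  then have "s < t" using xst by simp
  moreover have "iprim (snd bv0)" "\<forall>y\<in>{s..t}. cnorm Q \<Phi> (fst bv0) (snd bv0) y \<le> 1/3"
    using bv0(1) ST(3)[OF bv0(1)] by (auto simp: D_def A_def s_def t_def split: prod.splits)
  ultimately show ?thesis using xst stJ large' by blast
qed

text \<open>On the interval chosen above, remove the points where its vector \<open>v0\<close> is below \<open>\<eta>\<close>. Near a remaining
  bad point some orthogonal vector \<open>w\<close> of the other kind is small, and off the set where \<open>w\<close> is
  below \<open>\<eta>\<close> the flag formed by \<open>v0\<close> and \<open>w\<close> excludes bad points.\<close>

lemma bad_set_measure:
  assumes Q: "0 < Q" "0 < \<Phi>" and J: "j0 < j1" "{j0..j1} \<subseteq> {\<alpha>..\<beta>}" and \<eta>: "0 < \<eta>" "\<eta> \<le> 1/6"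
    and large: "\<And>b v. v \<noteq> (0, 0, 0) \<Longrightarrow> \<exists>t\<in>{j0..j1}. 1/3 \<le> cnorm Q \<Phi> b v t"
  defines "B \<equiv> {t\<in>{j0..j1}. \<exists>v. v \<noteq> (0, 0, 0) \<and> cnorm Q \<Phi> True v t < \<eta>}"
  shows "B \<in> lmeasurable" "measure lebesgue B \<le> 640 * (c2 / c1) * sqrt (3 * \<eta>) * (j1 - j0)"
proof -
  have contJ: "continuous_on {s..t} (cnorm Q \<Phi> b v)" if "{s..t} \<subseteq> {j0..j1}" for s t b v
    using continuous_on_subset[OF cnorm_continuous[OF Q]] J(2) that by blast
  have subm: "{t\<in>{j0..j1}. cnorm Q \<Phi> b v t < e} \<in> lmeasurable" for b v e
    by (intro sublevel_lmeasurable contJ) auto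
  have B_eq: "B = (\<Union>v\<in>-{(0,0,0)}. {t\<in>{j0..j1}. cnorm Q \<Phi> True v t < \<eta>})"
    by (auto simp: B_def)
  have "B \<in> sets lebesgue"
    unfolding B_eq using subm by (intro sets.countable_UN') auto
  moreover have "B \<subseteq> {j0..j1}" by (auto simp: B_def)
  ultimately show Blm: "B \<in> lmeasurable"
    by (meson bounded_closed_interval bounded_set_imp_lmeasurable bounded_subset)
  \<comment> \<open>One sublevel set costs \<kappa>. On each chosen interval \<open>B0\<close> costs
    \<kappa> and \<open>B1\<close> costs 4 \<kappa> by a first covering argument; a second one over
    \<open>{j0..j1}\<close> multiplies the sum 5 \<kappa> by 4, so that 640 = 20 * 32.\<close>
  define \<kappa> where "\<kappa> = 32 * (c2 / c1) * sqrt (3 * \<eta>)"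
  have \<kappa>: "0 < \<kappa>" using c \<eta> by (simp add: \<kappa>_def)
  have Bprim: "\<exists>b. b \<noteq> (0, 0, 0) \<and> pnorm Q \<Phi> (X x) (Y x) (m x) b < \<eta>" if "x \<in> B" for x
    using that by (auto simp: B_def cnorm_def)
  have "\<exists>s t. s < t \<and> x \<in> {s..t} \<and> {s..t} \<subseteq> {j0..j1} \<and> measure lebesgue (B \<inter> {s..t}) \<le> (5 * \<kappa>) * (t - s)"
    if x: "x \<in> B" for x
  proof -
    obtain v where v: "v \<noteq> (0, 0, 0)" "cnorm Q \<Phi> True v x < \<eta>" using x by (auto simp: B_def)
    obtain d v1 where v1: "d \<noteq> 0" "iprim v1" "v = iscale d v1" using ex_iprim v by metis
    have "cnorm Q \<Phi> True v1 x < 1/3"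
      using norm_iscale_ge(1)[OF Q(1) v1(1), of \<Phi> "X x" "Y x" "m x" v1] v v1 \<eta> by (simp add: cnorm_def)
    from maximal_cnorm_interval[OF Q J(2) _ large v1(2) this] x
    obtain s t b0 v0 where st: "s < t" "x \<in> {s..t}" "{s..t} \<subseteq> {j0..j1}" and v0: "iprim v0"
        "\<And>y. y \<in> {s..t} \<Longrightarrow> cnorm Q \<Phi> b0 v0 y \<le> 1/3"
      and lg: "\<And>b v. iprim v \<Longrightarrow> \<exists>y\<in>{s..t}. 1/3 \<le> cnorm Q \<Phi> b v y"
      unfolding B_def by blast
    define B0 where "B0 = {y\<in>{s..t}. cnorm Q \<Phi> b0 v0 y < \<eta>}"
    define B1 where "B1 = (B \<inter> {s..t}) - B0"
    have st\<alpha>: "{s..t} \<subseteq> {\<alpha>..\<beta>}" using st J by auto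
    have B0m: "B0 \<in> lmeasurable" unfolding B0_def by (intro sublevel_lmeasurable contJ st)
    have B1m: "B1 \<in> lmeasurable" unfolding B1_def using Blm B0m
      by (intro fmeasurable_Diff fmeasurable_Int_fmeasurable) auto
    obtain y0 where "y0 \<in> {s..t}" "1/3 \<le> cnorm Q \<Phi> b0 v0 y0" using lg v0 by blast
    then have m0: "measure lebesgue B0 \<le> \<kappa> * (t - s)"
      unfolding B0_def \<kappa>_def using cnorm_sublevel_measure[OF Q \<eta> _ st\<alpha>] st by simp
    have m1: "measure lebesgue B1 \<le> 4 * \<kappa> * (t - s)"
    proof (rule measure_le_of_interval_density)
      fix y assume y: "y \<in> B1"
      have yB: "y \<in> B" "y \<in> {s..t}" "\<eta> \<le> cnorm Q \<Phi> b0 v0 y" using y by (auto simp: B1_def B0_def)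
      obtain u where u: "u \<noteq> (0,0,0)" "pnorm Q \<Phi> (X y) (Y y) (m y) u < \<eta>" using Bprim[OF yB(1)] by blast
      have e3: "\<eta> \<le> 1/3" using \<eta> by simp
      obtain w where w: "iprim w" "idot w v0 = 0" "cnorm Q \<Phi> (\<not> b0) w y < 1/3"
      proof (cases b0)
        case True
        then have "\<eta> \<le> pnorm Q \<Phi> (X y) (Y y) (m y) v0" "pnorm Q \<Phi> (X y) (Y y) (m y) v0 \<le> 1/3"
          using yB v0(2)[OF yB(2)] by (simp_all add: cnorm_def)
        from ex_normal_small[OF Q \<eta>(1) e3 v0(1) this u]
        obtain w where "iprim w" "idot w v0 = 0" "dnorm Q \<Phi> (X y) (Y y) (m y) w < 1/3" by blast
        then show thesis using that[of w] True by (simp add: cnorm_def)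
      next
        case False
        then have "dnorm Q \<Phi> (X y) (Y y) (m y) v0 \<le> 1/3"
          using v0(2)[OF yB(2)] by (simp add: cnorm_def)
        from ex_orthogonal_small[OF Q \<eta>(1) e3 this u]
        obtain w where "iprim w" "idot w v0 = 0" "pnorm Q \<Phi> (X y) (Y y) (m y) w < 1/3"
          by (metis idot_commute)
        then show thesis using that[of w] False by (simp add: cnorm_def)
      qed
      obtain y1 where y1: "y1 \<in> {s..t}" "1/3 \<le> cnorm Q \<Phi> (\<not> b0) w y1" using lg w by blast
      \<comment> \<open>Stopping where \<open>w\<close> first reaches 1/3 serves two purposes: the
        value 1/3 is attained, as the sublevel estimate requires, and it is nowhere exceeded, as the
        flag criterion requires.\<close>
      have "\<exists>s' t' y2. s' < t' \<and> y \<in> {s'..t'} \<and> {s'..t'} \<subseteq> {s..t} \<and> y2 \<in> {s'..t'} \<and>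
          cnorm Q \<Phi> (\<not> b0) w y2 = 1/3 \<and> (\<forall>z\<in>{s'..t'}. cnorm Q \<Phi> (\<not> b0) w z \<le> 1/3)"
      proof (cases "y \<le> y1")
        case True
        have "continuous_on {y..t} (cnorm Q \<Phi> (\<not> b0) w)" using yB st by (intro contJ) auto
        from first_hit_right[OF this w(3) _ y1(2)] True y1
        obtain z where "y < z" "z \<le> y1" "cnorm Q \<Phi> (\<not> b0) w z = 1/3" "\<forall>x\<in>{y..z}. cnorm Q \<Phi> (\<not> b0) w x \<le> 1/3"
          by auto
        then show ?thesis using yB y1 by (intro exI[of _ y] exI[of _ z]) auto
      next
        case False
        have "continuous_on {s..y} (cnorm Q \<Phi> (\<not> b0) w)" using yB st by (intro contJ) auto
        from first_hit_left[OF this w(3) _ y1(2)] False y1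
        obtain z where "z < y" "y1 \<le> z" "cnorm Q \<Phi> (\<not> b0) w z = 1/3" "\<forall>x\<in>{z..y}. cnorm Q \<Phi> (\<not> b0) w x \<le> 1/3"
          by auto
        then show ?thesis using yB y1 by (intro exI[of _ z] exI[of _ y]) auto
      qed
      then obtain s' t' y2 where I': "s' < t'" "y \<in> {s'..t'}" "{s'..t'} \<subseteq> {s..t}" "y2 \<in> {s'..t'}"
          "1/3 \<le> cnorm Q \<Phi> (\<not> b0) w y2" "\<And>z. z \<in> {s'..t'} \<Longrightarrow> cnorm Q \<Phi> (\<not> b0) w z \<le> 1/3" by force
      have sub: "B1 \<inter> {s'..t'} \<subseteq> {z\<in>{s'..t'}. cnorm Q \<Phi> (\<not> b0) w z < \<eta>}"
      proof (rule subsetI, rule ccontr)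
        fix z assume z: "z \<in> B1 \<inter> {s'..t'}" "z \<notin> {z\<in>{s'..t'}. cnorm Q \<Phi> (\<not> b0) w z < \<eta>}"
        then have zz: "\<eta> \<le> cnorm Q \<Phi> (\<not> b0) w z" "cnorm Q \<Phi> (\<not> b0) w z \<le> 1/3"
          "\<eta> \<le> cnorm Q \<Phi> b0 v0 z" "cnorm Q \<Phi> b0 v0 z \<le> 1/3" "z \<in> B"
          using I'(3,6) v0 by (auto simp: B1_def B0_def)
        obtain u where u: "u \<noteq> (0,0,0)" "pnorm Q \<Phi> (X z) (Y z) (m z) u < \<eta>" using Bprim[OF zz(5)] by blast
        have "\<eta> \<le> pnorm Q \<Phi> (X z) (Y z) (m z) u"
        proof (cases b0)
          case True
          show ?thesis by (rule pnorm_ge_of_flag[OF Q \<eta>(1) e3 v0(1) _ _ w(1)])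
              (use zz True w u in \<open>auto simp: cnorm_def\<close>)
        next
          case False
          show ?thesis by (rule pnorm_ge_of_flag[OF Q \<eta>(1) e3 w(1) _ _ v0(1)])
              (use zz False w u in \<open>auto simp: cnorm_def idot_commute\<close>)
        qed
        then show False using u by simp
      qed
      have "measure lebesgue (B1 \<inter> {s'..t'}) \<le> measure lebesgue {z\<in>{s'..t'}. cnorm Q \<Phi> (\<not> b0) w z < \<eta>}"
        using B1m I'(3) st(3)
        by (intro measure_mono_fmeasurable[OF sub] sublevel_lmeasurable contJ) auto
      also have "\<dots> \<le> \<kappa> * (t' - s')"
        unfolding \<kappa>_def using I' st\<alpha> by (intro cnorm_sublevel_measure[OF Q \<eta> _ _ I'(4,5)]) auto
      finally show "\<exists>s' t'. s' < t' \<and> y \<in> {s'..t'} \<and> {s'..t'} \<subseteq> {s..t} \<and>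
          measure lebesgue (B1 \<inter> {s'..t'}) \<le> \<kappa> * (t' - s')" using I' by blast
    qed (use B1m st \<kappa> in \<open>auto simp: B1_def\<close>)
    have "measure lebesgue (B \<inter> {s..t}) \<le> measure lebesgue (B0 \<union> B1)"
      using B0m B1m Blm by (intro measure_mono_fmeasurable fmeasurable.Un) (auto simp: B1_def)
    also have "\<dots> \<le> measure lebesgue B0 + measure lebesgue B1"
      using B0m B1m by (intro measure_Un_le) auto
    also have "\<dots> \<le> (5 * \<kappa>) * (t - s)" using m0 m1 by (simp add: algebra_simps)
    finally show ?thesis using st by blast
  qed
  note dens = this
  have "B \<subseteq> {j0..j1}" "j0 \<le> j1" "0 < 5 * \<kappa>" using J \<kappa> by (auto simp: B_def)
  from measure_le_of_interval_density[OF fmeasurableD[OF Blm] this dens]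
  have "measure lebesgue B \<le> 4 * (5 * \<kappa>) * (j1 - j0)" .
  then show "measure lebesgue B \<le> 640 * (c2 / c1) * sqrt (3 * \<eta>) * (j1 - j0)"
    by (simp add: \<kappa>_def)
qed

text \<open>The order of quantifiers is the point: \<eta> depends only on the constants of the arc,
  whereas the threshold \<open>K\<close> may depend on the subinterval. A proportion 1/2 valid in
  every subinterval is what a full measure conclusion needs.\<close>

theorem nondivergence:
  "\<exists>\<eta>>0. \<eta> \<le> 1/6 \<and> (\<forall>j0 j1. j0 < j1 \<and> {j0..j1} \<subseteq> {\<alpha>..\<beta>} \<longrightarrow>
     (\<exists>K>0. \<forall>Q \<Phi>. K \<le> Q \<longrightarrow> 0 < \<Phi> \<longrightarrow> \<Phi> \<le> 1 \<longrightarrow> K \<le> Q * \<Phi> \<longrightarrow>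
        (let B = bad_points j0 j1 Q \<Phi> \<eta>
         in B \<in> lmeasurable \<and> measure lebesgue B \<le> (j1 - j0) / 2)))"
proof -
  \<comment> \<open>\<open>k\<close> is the value of \<open>sqrt (3 * \<eta>)\<close> at which the
    general bound equals one half of the length.\<close>
  define k where "k = 1 / (1280 * (c2 / c1))"
  have k: "0 < k" "640 * (c2 / c1) * k = 1 / 2" using c by (auto simp: k_def)
  define \<eta> where "\<eta> = min (1/6) (k\<^sup>2 / 3)"
  have \<eta>: "0 < \<eta>" "\<eta> \<le> 1/6" using k by (auto simp: \<eta>_def)
  have "sqrt (3 * \<eta>) \<le> k" using k by (intro real_le_lsqrt) (auto simp: \<eta>_def min_def)
  then have s: "640 * (c2 / c1) * sqrt (3 * \<eta>) \<le> 1/2"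
    unfolding k(2)[symmetric] using c by (intro mult_left_mono) auto
  have "\<exists>K>0. \<forall>Q \<Phi>. K \<le> Q \<longrightarrow> 0 < \<Phi> \<longrightarrow> \<Phi> \<le> 1 \<longrightarrow> K \<le> Q * \<Phi> \<longrightarrow>
        (let B = bad_points j0 j1 Q \<Phi> \<eta>
         in B \<in> lmeasurable \<and> measure lebesgue B \<le> (j1 - j0) / 2)"
    if j: "j0 < j1" "{j0..j1} \<subseteq> {\<alpha>..\<beta>}" for j0 j1
  proof -
    obtain K where K: "K > 0" "\<And>Q \<Phi> b v. K \<le> Q \<Longrightarrow> 0 < \<Phi> \<Longrightarrow> \<Phi> \<le> 1 \<Longrightarrow> K \<le> Q * \<Phi> \<Longrightarrow> v \<noteq> (0, 0, 0) \<Longrightarrow>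
           (\<exists>t\<in>{j0..j1}. 1/3 \<le> cnorm Q \<Phi> b v t)" using cnorm_large_eventually[OF j] by blast
    show ?thesis
    proof (intro exI[of _ K] conjI K(1) allI impI)
      fix Q \<Phi> assume h: "K \<le> Q" "0 < \<Phi>" "\<Phi> \<le> 1" "K \<le> Q * \<Phi>"
      then have Q: "0 < Q" using K by simp
      have eq: "{t\<in>{j0..j1}. \<exists>v. v \<noteq> (0, 0, 0) \<and> cnorm Q \<Phi> True v t < \<eta>}
          = bad_points j0 j1 Q \<Phi> \<eta>"
        by (simp only: cnorm_def if_True)
      note bs = bad_set_measure[OF Q h(2) j \<eta> K(2)[OF h], unfolded eq]
      have "640 * (c2 / c1) * sqrt (3 * \<eta>) * (j1 - j0) \<le> 1/2 * (j1 - j0)"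
        using s j by (intro mult_right_mono) auto
      also have "\<dots> = (j1 - j0) / 2" by simp
      finally have half: "640 * (c2 / c1) * sqrt (3 * \<eta>) * (j1 - j0) \<le> (j1 - j0) / 2" .
      show "let B = bad_points j0 j1 Q \<Phi> \<eta>
         in B \<in> lmeasurable \<and> measure lebesgue B \<le> (j1 - j0) / 2"
        unfolding Let_def by (rule conjI[OF bs(1) order_trans[OF bs(2) half]]; assumption)
    qed
  qed
  then show ?thesis using \<eta> by blast
qed

end

section \<open>Rational points near the arc\<close>

text \<open>Dirichlet's argument with boxes aligned to the tangent line: the \<open>n + 1\<close>
  multiples 0, ..., n fall into at most (1/A + 1)(1/B + 1) boxes, and the difference of two in the
  same box is the required vector.\<close>

lemma simultaneous_pigeonhole:
  fixes x y m A B :: real and n :: nat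
  assumes AB: "0 < A" "0 < B" and n: "(1 / A + 1) * (1 / B + 1) \<le> real n"
  shows "\<exists>q p r :: int. 0 < q \<and> q \<le> int n \<and> \<bar>real_of_int q * x - real_of_int p\<bar> < A \<and>
     \<bar>real_of_int q * y - real_of_int r - m * (real_of_int q * x - real_of_int p)\<bar> < B"
proof -
  define p where "p q = \<lfloor>real q * x\<rfloor>" for q :: nat
  define e where "e q = real q * x - real_of_int (p q)" for q :: nat
  \<comment> \<open>The second coordinate is sheared by the fractional part \<open>e q\<close>
    before its integer part is taken, so that differences reproduce the tangent-line error
    exactly.\<close>
  define r where "r q = \<lfloor>real q * y - m * e q\<rfloor>" for q :: nat
  define h where "h q = real q * y - m * e q - real_of_int (r q)" for q :: nat
  have e: "0 \<le> e q" "e q < 1" for q by (simp_all add: e_def p_def) linarith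
  have h: "0 \<le> h q" "h q < 1" for q by (simp_all add: h_def r_def) linarith
  define F where "F q = (\<lfloor>e q / A\<rfloor>, \<lfloor>h q / B\<rfloor>)" for q
  have "F ` {0..n} \<subseteq> {0..\<lfloor>1 / A\<rfloor>} \<times> {0..\<lfloor>1 / B\<rfloor>}"
  proof
    fix z assume "z \<in> F ` {0..n}"
    then obtain q where z: "z = F q" by blast
    have "e q / A \<le> 1 / A" "h q / B \<le> 1 / B" "0 \<le> e q / A" "0 \<le> h q / B"
      using e[of q] h[of q] AB by (simp_all add: divide_right_mono)
    then show "z \<in> {0..\<lfloor>1 / A\<rfloor>} \<times> {0..\<lfloor>1 / B\<rfloor>}"
      unfolding z F_def by (simp add: floor_mono)
  qed
  then have "card (F ` {0..n}) \<le> card ({0..\<lfloor>1 / A\<rfloor>} \<times> {0..\<lfloor>1 / B\<rfloor>})"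
    by (intro card_mono) auto
  also have "\<dots> = nat (\<lfloor>1 / A\<rfloor> + 1) * nat (\<lfloor>1 / B\<rfloor> + 1)" by (simp add: card_cartesian_product)
  finally have "real (card (F ` {0..n})) \<le> real (nat (\<lfloor>1 / A\<rfloor> + 1)) * real (nat (\<lfloor>1 / B\<rfloor> + 1))"
    by (metis of_nat_le_iff of_nat_mult)
  also have "\<dots> \<le> (1 / A + 1) * (1 / B + 1)"
  proof (rule mult_mono)
    have "0 \<le> \<lfloor>1 / A\<rfloor>" "0 \<le> \<lfloor>1 / B\<rfloor>" using AB by simp_all
    then show "real (nat (\<lfloor>1 / A\<rfloor> + 1)) \<le> 1 / A + 1" "real (nat (\<lfloor>1 / B\<rfloor> + 1)) \<le> 1 / B + 1"
      by (simp_all)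
  qed (use AB in auto)
  finally have "card (F ` {0..n}) < card {0..n}" using n by simp
  then have "\<not> inj_on F {0..n}" by (rule pigeonhole)
  then obtain i j where ij: "i \<in> {0..n}" "j \<in> {0..n}" "i < j" "F i = F j"
    unfolding inj_on_def by (metis nat_neq_iff)
  have close: "\<bar>u - v\<bar> < c" if "\<lfloor>u / c\<rfloor> = \<lfloor>v / c\<rfloor>" "0 < c" for u v c :: real
  proof -
    have "\<bar>u / c - v / c\<bar> < 1" using that(1) by linarith
    then have "\<bar>u - v\<bar> / c < 1" using that(2) by (simp add: diff_divide_distrib[symmetric])
    then show ?thesis using that(2) by simp
  qed
  have ce: "\<bar>e j - e i\<bar> < A" and ch: "\<bar>h j - h i\<bar> < B"
    using close AB ij(4) by (auto simp: F_def)
  show ?thesis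
  proof (rule exI[of _ "int j - int i"], rule exI[of _ "p j - p i"], rule exI[of _ "r j - r i"], intro conjI)
    show "0 < int j - int i" "int j - int i \<le> int n" using ij by auto
    have 1: "real_of_int (int j - int i) * x - real_of_int (p j - p i) = e j - e i"
      by (simp add: e_def algebra_simps)
    show "\<bar>real_of_int (int j - int i) * x - real_of_int (p j - p i)\<bar> < A" unfolding 1 by (rule ce)
    have "real_of_int (int j - int i) * y - real_of_int (r j - r i) - m * (e j - e i) = h j - h i"
      by (simp add: h_def algebra_simps)
    then show "\<bar>real_of_int (int j - int i) * y - real_of_int (r j - r i) -
        m * (real_of_int (int j - int i) * x - real_of_int (p j - p i))\<bar> < B"
      unfolding 1 using ch by simp
  qed
qed

context planar_curve
begin

text \<open>The factor \<open>5 / \<eta>\<^sup>2\<close> bounds the number \<open>4 Q / \<eta>\<^sup>2 + 1\<close> of boxes in the pigeonhole argument.\<close>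

definition resonant :: "real \<Rightarrow> real \<Rightarrow> real \<Rightarrow> real set" where
  "resonant \<eta> Q \<Phi> = {\<tau>\<in>{\<alpha>..\<beta>}. \<exists>q p r :: int. 0 < q \<and> \<eta> * Q \<le> real_of_int q \<and>
      real_of_int q \<le> 5 / \<eta>\<^sup>2 * Q \<and> real_of_int q * X \<tau> = real_of_int p \<and>
      \<bar>real_of_int q * Y \<tau> - real_of_int r\<bar> < 2 * \<eta> * \<Phi>}"

text \<open>The pigeonhole vector has its last two coordinates below \<eta>, so goodness of
  \<open>t\<close> can only come from its denominator, which gives
  \<open>\<eta> * Q \<le> q\<close>. Dividing by \<open>q\<close> puts p / q within
  \<open>c1 * \<rho>\<close> of \<open>X t\<close>, and since \<open>X\<close> grows at rate at
  least \<open>c1\<close> this value is taken within \<rho> of \<open>t\<close>.\<close>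

lemma ex_resonant_near:
  assumes \<eta>: "0 < \<eta>" "\<eta> \<le> 1" and Q: "1 \<le> Q" "0 < \<Phi>" "\<Phi> \<le> 1" "1 \<le> Q * \<Phi>" "c2 / c1 \<le> Q * \<Phi>"
    and t: "t - 1 / (c1 * Q\<^sup>2 * \<Phi>) \<in> {\<alpha>..\<beta>}" "t + 1 / (c1 * Q\<^sup>2 * \<Phi>) \<in> {\<alpha>..\<beta>}"
    and good: "\<And>v. v \<noteq> (0, 0, 0) \<Longrightarrow> \<eta> \<le> pnorm Q \<Phi> (X t) (Y t) (m t) v"
  shows "\<exists>\<tau>\<in>resonant \<eta> Q \<Phi>. \<bar>t - \<tau>\<bar> < 1 / (c1 * Q\<^sup>2 * \<Phi>)"
proof -
  define \<rho> where "\<rho> = 1 / (c1 * Q\<^sup>2 * \<Phi>)"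
  have \<rho>: "0 < \<rho>" "c1 * \<rho> = 1 / (Q\<^sup>2 * \<Phi>)" using Q c by (auto simp: \<rho>_def)
  have t\<rho>: "t - \<rho> \<in> {\<alpha>..\<beta>}" "t + \<rho> \<in> {\<alpha>..\<beta>}" "t \<in> {\<alpha>..\<beta>}" using t \<rho>(1) by (auto simp: \<rho>_def)
  define A B where "A = \<eta> / (Q * \<Phi>)" and "B = \<eta> * \<Phi>"
  have AB: "0 < A" "0 < B" using \<eta> Q by (auto simp: A_def B_def)
  define n where "n = nat \<lceil>4 * Q / \<eta>\<^sup>2\<rceil>"
  have "1 \<le> 1 / A" using \<eta> Q by (simp add: A_def)
  moreover have "1 \<le> 1 / B"
    using mult_mono[of \<eta> 1 \<Phi> 1] \<eta> Q AB by (simp add: B_def)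
  ultimately have "1 / A + 1 \<le> 2 / A" "1 / B + 1 \<le> 2 / B" by linarith+
  then have "(1 / A + 1) * (1 / B + 1) \<le> (2 / A) * (2 / B)"
    using AB by (intro mult_mono) auto
  also have "\<dots> = 4 * Q / \<eta>\<^sup>2" using \<eta> Q by (simp add: A_def B_def power2_eq_square)
  also have "\<dots> \<le> real n" unfolding n_def by linarith
  finally obtain q p r :: int where q: "0 < q" "q \<le> int n"
     and e: "\<bar>real_of_int q * X t - real_of_int p\<bar> < A"
     and h: "\<bar>real_of_int q * Y t - real_of_int r - m t * (real_of_int q * X t - real_of_int p)\<bar> < B"
    using simultaneous_pigeonhole[OF AB] by blast
  have q0: "0 < real_of_int q" using q by simp
  have "real_of_int q \<le> 4 * Q / \<eta>\<^sup>2 + 1"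
  proof -
    have "0 \<le> 4 * Q / \<eta>\<^sup>2" using Q by simp
    then have "real n \<le> 4 * Q / \<eta>\<^sup>2 + 1" unfolding n_def by linarith
    then show ?thesis using q by linarith
  qed
  also have "1 \<le> Q / \<eta>\<^sup>2"
  proof -
    have "\<eta>\<^sup>2 \<le> 1" using \<eta> by (simp add: power_le_one)
    then show ?thesis using \<eta> Q by (simp add: le_divide_eq)
  qed
  finally have qM: "real_of_int q \<le> 5 / \<eta>\<^sup>2 * Q" by simp
  have q\<eta>: "\<eta> * Q \<le> real_of_int q"
  proof -
    have "\<eta> \<le> pnorm Q \<Phi> (X t) (Y t) (m t) (q, p, r)" using q by (intro good) auto
    moreover have "\<bar>real_of_int q * X t - real_of_int p\<bar> * (Q * \<Phi>) < \<eta>"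
      using e Q by (simp add: A_def pos_less_divide_eq)
    moreover have "\<bar>real_of_int q * Y t - real_of_int r - m t * (real_of_int q * X t - real_of_int p)\<bar> / \<Phi> < \<eta>"
      using h Q by (simp add: B_def pos_divide_less_eq)
    ultimately have "\<eta> \<le> \<bar>real_of_int q\<bar> / Q"
      unfolding pnorm_def prod.case by (simp only: le_max_iff_disj) linarith
    then show ?thesis using Q q0 by (simp add: pos_le_divide_eq)
  qed
  have near: "\<bar>X t - real_of_int p / real_of_int q\<bar> < c1 * \<rho>"
  proof -
    have "\<bar>X t - real_of_int p / real_of_int q\<bar> = \<bar>real_of_int q * X t - real_of_int p\<bar> / real_of_int q"
    proof -
      have "X t - real_of_int p / real_of_int q = (real_of_int q * X t - real_of_int p) / real_of_int q"
        using q0 by (simp add: diff_divide_distrib)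
      then show ?thesis using q0 by simp
    qed
    also have "\<dots> < A / real_of_int q" using e q0 by (simp add: divide_strict_right_mono)
    also have "\<dots> \<le> A / (\<eta> * Q)" using q\<eta> AB \<eta> Q q0 by (intro divide_left_mono mult_pos_pos) auto
    also have "\<dots> = c1 * \<rho>" unfolding \<rho>(2) using \<eta> Q by (simp add: A_def power2_eq_square)
    finally show ?thesis .
  qed
  have "X (t - \<rho>) \<le> real_of_int p / real_of_int q" "real_of_int p / real_of_int q \<le> X (t + \<rho>)"
    using X_bilipschitz[OF t\<rho>(1,3)] X_bilipschitz[OF t\<rho>(3,2)] \<rho>(1) near by auto
  moreover have "continuous_on {t - \<rho>..t + \<rho>} X"
    using continuous(1) by (rule continuous_on_subset) (use t\<rho> in auto)
  ultimately obtain \<tau> where \<tau>: "t - \<rho> \<le> \<tau>" "\<tau> \<le> t + \<rho>" "X \<tau> = real_of_int p / real_of_int q"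
    using IVT'[of X "t - \<rho>" "real_of_int p / real_of_int q" "t + \<rho>"] \<rho>(1) by auto
  have \<tau>\<alpha>: "\<tau> \<in> {\<alpha>..\<beta>}" using \<tau> t\<rho> by auto
  have close: "\<bar>t - \<tau>\<bar> < \<rho>"
  proof -
    have "c1 * \<bar>t - \<tau>\<bar> \<le> \<bar>X t - X \<tau>\<bar>"
      using X_bilipschitz[OF t\<rho>(3) \<tau>\<alpha>] X_bilipschitz[OF \<tau>\<alpha> t\<rho>(3)]
      by (cases "t \<le> \<tau>") auto
    then have "c1 * \<bar>t - \<tau>\<bar> < c1 * \<rho>" using near \<tau>(3) by simp
    then show ?thesis using c by simp
  qed
  have qX: "real_of_int q * X \<tau> = real_of_int p" using \<tau>(3) q0 by simp
  \<comment> \<open>The derivative of the tangent-line error is proportional to the small quantity q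
    X - p, so moving from \<open>t\<close> to \<tau> changes it by at most
    \<open>\<eta> * \<Phi>\<close>; the condition \<open>c2 / c1 \<le> Q * \<Phi>\<close> absorbs
    the constants. At \<tau> the slope term vanishes and \<open>g\<close> is the plain error in
    \<open>Y\<close>.\<close>
  define g where "g z = real_of_int q * Y z - real_of_int r - m z * (real_of_int q * X z - real_of_int p)" for z
  have dg: "(g has_real_derivative - (dm z * (real_of_int q * X z - real_of_int p))) (at z)" if "z \<in> {\<alpha>..\<beta>}" for z
    unfolding g_def using derivX[OF that] derivY[OF that] derivm[OF that]
    by (auto intro!: derivative_eq_intros simp: algebra_simps)
  have "\<bar>g \<tau> - g t\<bar> \<le> c2 * A * \<bar>\<tau> - t\<bar>"
  proof -
    let ?S = "closed_segment t \<tau>"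
    have S: "?S \<subseteq> {\<alpha>..\<beta>}" using t\<rho>(3) \<tau>\<alpha> by (simp add: closed_segment_subset)
    have bd: "\<bar>- (dm z * (real_of_int q * X z - real_of_int p))\<bar> \<le> c2 * A" if z: "z \<in> ?S" for z
    proof -
      have z\<alpha>: "z \<in> {\<alpha>..\<beta>}" using z S by blast
      have "t \<le> z \<and> z \<le> \<tau> \<or> \<tau> \<le> z \<and> z \<le> t"
        using z by (auto simp: closed_segment_eq_real_ivl split: if_splits)
      then have "X t \<le> X z \<and> X z \<le> X \<tau> \<or> X \<tau> \<le> X z \<and> X z \<le> X t"
        using X_bilipschitz[OF t\<rho>(3) z\<alpha>] X_bilipschitz[OF z\<alpha> \<tau>\<alpha>] X_bilipschitz[OF \<tau>\<alpha> z\<alpha>] X_bilipschitz[OF z\<alpha> t\<rho>(3)] c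
        by (smt (verit) mult_nonneg_nonneg)
      then have "\<bar>X z - X \<tau>\<bar> \<le> \<bar>X t - X \<tau>\<bar>" by auto
      then have "real_of_int q * \<bar>X z - X \<tau>\<bar> \<le> real_of_int q * \<bar>X t - X \<tau>\<bar>" using q0 by simp
      then have "\<bar>real_of_int q * (X z - X \<tau>)\<bar> \<le> \<bar>real_of_int q * (X t - X \<tau>)\<bar>"
        unfolding abs_mult using q0 by simp
      then have "\<bar>real_of_int q * X z - real_of_int p\<bar> \<le> \<bar>real_of_int q * X t - real_of_int p\<bar>"
        unfolding right_diff_distrib qX .
      then have "\<bar>real_of_int q * X z - real_of_int p\<bar> \<le> A" using e by simp
      moreover have "\<bar>dm z\<bar> \<le> c2" using dm[OF z\<alpha>] c by auto
      ultimately show ?thesis unfolding abs_minus_cancel abs_mult using c by (intro mult_mono) auto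
    qed
    have "norm (g \<tau> - g t) \<le> c2 * A * norm (\<tau> - t)"
    proof (rule field_differentiable_bound[where S = ?S and f' = "\<lambda>z. - (dm z * (real_of_int q * X z - real_of_int p))"])
      show "(g has_field_derivative - (dm z * (real_of_int q * X z - real_of_int p))) (at z within ?S)" if "z \<in> ?S" for z
        using dg S that by (blast intro: has_field_derivative_at_within)
    qed (use bd in auto)
    then show ?thesis by simp
  qed
  also have "\<dots> \<le> c2 * A * \<rho>" using close c AB by (intro mult_left_mono) (auto simp: abs_minus_commute)
  also have "\<dots> = \<eta> * \<Phi> * ((c2 / c1) / (Q * \<Phi>) ^ 3)"
    using Q c by (simp add: A_def \<rho>_def field_simps power2_eq_square power3_eq_cube)
  also have "\<dots> \<le> \<eta> * \<Phi> * 1"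
  proof (rule mult_left_mono)
    have "c2 / c1 \<le> Q * \<Phi>" by (rule Q)
    also have "\<dots> \<le> (Q * \<Phi>) ^ 3" using Q(4) power_increasing[of 1 3 "Q * \<Phi>"] by simp
    finally have "c2 / c1 \<le> (Q * \<Phi>) ^ 3" .
    moreover have "0 < (Q * \<Phi>) ^ 3" using Q by simp
    ultimately show "(c2 / c1) / (Q * \<Phi>) ^ 3 \<le> 1" by (simp only: pos_divide_le_eq mult_1)
  qed (use \<eta> Q in auto)
  finally have "\<bar>g \<tau> - g t\<bar> \<le> \<eta> * \<Phi>" by simp
  moreover have "g \<tau> = real_of_int q * Y \<tau> - real_of_int r" using qX by (simp add: g_def)
  moreover have "\<bar>g t\<bar> < \<eta> * \<Phi>" using h by (simp add: g_def B_def)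
  ultimately have "\<bar>real_of_int q * Y \<tau> - real_of_int r\<bar> < 2 * \<eta> * \<Phi>" by linarith
  then have "\<tau> \<in> resonant \<eta> Q \<Phi>" unfolding resonant_def using \<tau>\<alpha> q(1) q\<eta> qM qX by blast
  then show ?thesis using close unfolding \<rho>_def by blast
qed

text \<open>The middle half of \<open>{s..t}\<close> is used so that nearby resonant points stay in
  the interval once \<open>\<rho> \<le> (t - s) / 4\<close>. At least half of it is good, which
  leaves a quarter of the whole length.\<close>

theorem resonant_ubiquitous:
  "\<exists>\<eta>>0. \<eta> \<le> 1/6 \<and> (\<forall>s t. s < t \<and> {s..t} \<subseteq> {\<alpha>..\<beta>} \<longrightarrow>
     (\<exists>K>0. \<forall>Q \<Phi>. K \<le> Q \<longrightarrow> 0 < \<Phi> \<longrightarrow> \<Phi> \<le> 1 \<longrightarrow> K \<le> Q * \<Phi> \<longrightarrow>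
        1/4 * (t - s) \<le> measure lebesgue ({s..t} \<inter>
           (\<Union>\<tau>\<in>resonant \<eta> Q \<Phi> \<inter> {s..t}. ball \<tau> (1 / (c1 * Q\<^sup>2 * \<Phi>))))))"
proof -
  obtain \<eta> where \<eta>: "0 < \<eta>" "\<eta> \<le> 1/6" and nd: "\<And>j0 j1. j0 < j1 \<Longrightarrow> {j0..j1} \<subseteq> {\<alpha>..\<beta>} \<Longrightarrow>
     (\<exists>K>0. \<forall>Q \<Phi>. K \<le> Q \<longrightarrow> 0 < \<Phi> \<longrightarrow> \<Phi> \<le> 1 \<longrightarrow> K \<le> Q * \<Phi> \<longrightarrow>
        (let B = bad_points j0 j1 Q \<Phi> \<eta>
         in B \<in> lmeasurable \<and> measure lebesgue B \<le> (j1 - j0) / 2))"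
    using nondivergence by blast
  have "\<exists>K>0. \<forall>Q \<Phi>. K \<le> Q \<longrightarrow> 0 < \<Phi> \<longrightarrow> \<Phi> \<le> 1 \<longrightarrow> K \<le> Q * \<Phi> \<longrightarrow>
        1/4 * (t - s) \<le> measure lebesgue ({s..t} \<inter>
           (\<Union>\<tau>\<in>resonant \<eta> Q \<Phi> \<inter> {s..t}. ball \<tau> (1 / (c1 * Q\<^sup>2 * \<Phi>))))"
    if st: "s < t" "{s..t} \<subseteq> {\<alpha>..\<beta>}" for s t
  proof -
    define j0 j1 where "j0 = s + (t - s) / 4" and "j1 = t - (t - s) / 4"
    have j: "j0 < j1" "{j0..j1} \<subseteq> {s..t}" "j1 - j0 = (t - s) / 2"
      using st by (auto simp: j0_def j1_def field_simps)
    have j\<alpha>: "{j0..j1} \<subseteq> {\<alpha>..\<beta>}" using j st by blast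
    obtain K where K: "0 < K" "\<And>Q \<Phi>. K \<le> Q \<Longrightarrow> 0 < \<Phi> \<Longrightarrow> \<Phi> \<le> 1 \<Longrightarrow> K \<le> Q * \<Phi> \<Longrightarrow>
        (let B = bad_points j0 j1 Q \<Phi> \<eta>
         in B \<in> lmeasurable \<and> measure lebesgue B \<le> (j1 - j0) / 2)"
      using nd[OF j(1) j\<alpha>] by blast
    define K' where "K' = max K (max 1 (max (c2 / c1) (4 / (c1 * (t - s)))))"
    show ?thesis
    proof (intro exI[of _ K'] conjI allI impI)
      show "0 < K'" using K by (simp add: K'_def)
      fix Q \<Phi> :: real
      assume h: "K' \<le> Q" "0 < \<Phi>" "\<Phi> \<le> 1" "K' \<le> Q * \<Phi>"
      then have Q: "K \<le> Q" "K \<le> Q * \<Phi>" "1 \<le> Q" "1 \<le> Q * \<Phi>" "c2 / c1 \<le> Q * \<Phi>" "4 / (c1 * (t - s)) \<le> Q"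
        by (auto simp: K'_def)
      define \<rho> where "\<rho> = 1 / (c1 * Q\<^sup>2 * \<Phi>)"
      have \<rho>: "0 < \<rho>" using c Q h by (simp add: \<rho>_def)
      have \<rho>_le: "\<rho> \<le> (t - s) / 4"
      proof -
        have "4 \<le> Q * (c1 * (t - s)) * 1" using Q(6) c st by (simp add: pos_divide_le_eq)
        also have "Q * (c1 * (t - s)) * 1 \<le> Q * (c1 * (t - s)) * (Q * \<Phi>)"
          using Q c st by (intro mult_left_mono) auto
        finally have "4 \<le> (c1 * Q\<^sup>2 * \<Phi>) * (t - s)" by (simp add: power2_eq_square mult_ac)
        then show ?thesis using c Q h by (simp add: \<rho>_def divide_simps mult_ac)
      qed
      define B where "B = bad_points j0 j1 Q \<Phi> \<eta>"
      have B: "B \<in> lmeasurable" "measure lebesgue B \<le> (j1 - j0) / 2"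
        using K(2)[OF Q(1) h(2,3) Q(2), unfolded Let_def, folded B_def] by (rule conjunct1, rule conjunct2)
      have Bsub: "B \<subseteq> {j0..j1}" by (auto simp: B_def)
      have "1/4 * (t - s) \<le> measure lebesgue {j0..j1} - measure lebesgue B"
        using B(2) j by simp
      also have "\<dots> = measure lebesgue ({j0..j1} - B)"
        by (rule measurable_measure_Diff[symmetric]) (use B(1) Bsub in \<open>auto simp: fmeasurableD\<close>)
      also have "\<dots> \<le> measure lebesgue ({s..t} \<inter> (\<Union>\<tau>\<in>resonant \<eta> Q \<Phi> \<inter> {s..t}. ball \<tau> \<rho>))"
      proof (rule measure_mono_fmeasurable)
        show "{j0..j1} - B \<subseteq> {s..t} \<inter> (\<Union>\<tau>\<in>resonant \<eta> Q \<Phi> \<inter> {s..t}. ball \<tau> \<rho>)"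
        proof
          fix x assume x: "x \<in> {j0..j1} - B"
          have x1: "x - \<rho> \<in> {s..t}" "x + \<rho> \<in> {s..t}"
          proof -
            have "s + (t - s) / 4 \<le> x" "x \<le> t - (t - s) / 4" using x by (simp_all add: j0_def j1_def)
            then have "s \<le> x - \<rho>" "x + \<rho> \<le> t" using \<rho>_le by linarith+
            then show "x - \<rho> \<in> {s..t}" "x + \<rho> \<in> {s..t}" using \<rho> by simp_all
          qed
          have good: "\<eta> \<le> pnorm Q \<Phi> (X x) (Y x) (m x) v" if "v \<noteq> (0, 0, 0)" for v
          proof (rule ccontr)
            assume "\<not> \<eta> \<le> pnorm Q \<Phi> (X x) (Y x) (m x) v"
            then have "x \<in> B" using x that unfolding B_def by (intro CollectI conjI exI[of _ v]) auto
            then show False using x by blast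
          qed
          have ends: "x - 1 / (c1 * Q\<^sup>2 * \<Phi>) \<in> {\<alpha>..\<beta>}" "x + 1 / (c1 * Q\<^sup>2 * \<Phi>) \<in> {\<alpha>..\<beta>}"
            using x1 st(2) unfolding \<rho>_def by blast+
          have "\<eta> \<le> 1" using \<eta> by simp
          from ex_resonant_near[OF \<eta>(1) this Q(3) h(2,3) Q(4,5) ends good]
          obtain \<tau> where \<tau>: "\<tau> \<in> resonant \<eta> Q \<Phi>" "\<bar>x - \<tau>\<bar> < \<rho>"
            unfolding \<rho>_def by blast
          then have "\<tau> \<in> {s..t}" using x1 by auto
          then show "x \<in> {s..t} \<inter> (\<Union>\<tau>\<in>resonant \<eta> Q \<Phi> \<inter> {s..t}. ball \<tau> \<rho>)"
            using \<tau> x j(2) by (auto simp: dist_real_def abs_minus_commute intro!: bexI[of _ \<tau>])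
        qed
        show "{s..t} \<inter> (\<Union>\<tau>\<in>resonant \<eta> Q \<Phi> \<inter> {s..t}. ball \<tau> \<rho>) \<in> lmeasurable"
        proof (rule fmeasurable_Int_fmeasurable)
          have "open (\<Union>\<tau>\<in>resonant \<eta> Q \<Phi> \<inter> {s..t}. ball \<tau> \<rho>)" by auto
          then show "(\<Union>\<tau>\<in>resonant \<eta> Q \<Phi> \<inter> {s..t}. ball \<tau> \<rho>) \<in> sets lebesgue" by (simp add: borel_open)
        qed auto
      qed (use B in auto)
      finally show "1/4 * (t - s) \<le> measure lebesgue ({s..t} \<inter>
           (\<Union>\<tau>\<in>resonant \<eta> Q \<Phi> \<inter> {s..t}. ball \<tau> (1 / (c1 * Q\<^sup>2 * \<Phi>))))" unfolding \<rho>_def .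
    qed
  qed
  then show ?thesis using \<eta> by blast
qed

end

section \<open>Measure of limsup sets\<close>

lemma measure_ball_real:
  fixes y :: real
  assumes "0 \<le> e"
  shows "measure lebesgue (ball y e) = 2 * e"
  using assms by (simp add: ball_eq_greaterThanLessThan)

lemma separated_card_le:
  fixes C :: "real set"
  assumes fin: "finite C" and \<rho>: "0 < \<rho>"
    and sep: "\<And>x y. x \<in> C \<Longrightarrow> y \<in> C \<Longrightarrow> x \<noteq> y \<Longrightarrow> 2 * \<rho> \<le> \<bar>x - y\<bar>"
    and T: "T \<in> lmeasurable" "\<And>x. x \<in> C \<Longrightarrow> ball x \<rho> \<subseteq> T"
  shows "real (card C) * (2 * \<rho>) \<le> measure lebesgue T"
    and "measure lebesgue (\<Union>x\<in>C. ball x \<rho>) = real (card C) * (2 * \<rho>)"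
proof -
  have disj: "disjoint_family_on (\<lambda>x. ball x \<rho>) C"
    unfolding disjoint_family_on_def
  proof (intro ballI impI)
    fix x y assume xy: "x \<in> C" "y \<in> C" "x \<noteq> y"
    show "ball x \<rho> \<inter> ball y \<rho> = {}"
      using sep[OF xy] by (auto simp: dist_real_def)
  qed
  have nt: "emeasure lborel (ball x \<rho>) \<noteq> top" for x :: real
    using emeasure_lborel_ball_finite[of x \<rho>] by auto
  have "measure lebesgue (\<Union>x\<in>C. ball x \<rho>) = (\<Sum>x\<in>C. measure lebesgue (ball x \<rho>))"
    using fin disj nt by (intro measure_finite_Union) auto
  also have "\<dots> = (\<Sum>x\<in>C. 2 * \<rho>)"
    using \<rho> by (intro sum.cong) (auto simp: ball_eq_greaterThanLessThan)
  finally show eq: "measure lebesgue (\<Union>x\<in>C. ball x \<rho>) = real (card C) * (2 * \<rho>)" by simp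
  have "measure lebesgue (\<Union>x\<in>C. ball x \<rho>) \<le> measure lebesgue T"
    using T fin by (intro measure_mono_fmeasurable) auto
  then show "real (card C) * (2 * \<rho>) \<le> measure lebesgue T" using eq by simp
qed

text \<open>Disjointness of the balls bounds the cardinality of separated subsets, so one of
  greatest cardinality exists; a point far from it could be added.\<close>

lemma maximal_separated:
  fixes R :: "real set"
  assumes ab: "a \<le> b" and \<rho>: "0 < \<rho>" and R: "R \<subseteq> {a..b}"
  shows "\<exists>C\<subseteq>R. finite C \<and> (\<forall>x\<in>C. \<forall>y\<in>C. x \<noteq> y \<longrightarrow> 2 * \<rho> \<le> \<bar>x - y\<bar>) \<and>
     (\<forall>y\<in>R. \<exists>x\<in>C. \<bar>x - y\<bar> < 2 * \<rho>)"
proof -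
  define P where "P C \<longleftrightarrow> C \<subseteq> R \<and> finite C \<and> (\<forall>x\<in>C. \<forall>y\<in>C. x \<noteq> y \<longrightarrow> 2 * \<rho> \<le> \<bar>x - y\<bar>)" for C
  have bd: "card C \<le> nat \<lceil>(b - a + 2 * \<rho>) / (2 * \<rho>)\<rceil>" if "P C" for C
  proof -
    have C: "C \<subseteq> R" "finite C" "\<And>x y. x \<in> C \<Longrightarrow> y \<in> C \<Longrightarrow> x \<noteq> y \<Longrightarrow> 2 * \<rho> \<le> \<bar>x - y\<bar>"
      using that by (auto simp: P_def)
    have "real (card C) * (2 * \<rho>) \<le> measure lebesgue {a - \<rho>..b + \<rho>}"
      using C R by (intro separated_card_le(1)[OF C(2) \<rho>]) (auto simp: dist_real_def subset_iff; force)+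
    also have "\<dots> = b - a + 2 * \<rho>" using ab \<rho> by simp
    finally have "real (card C) \<le> (b - a + 2 * \<rho>) / (2 * \<rho>)" using \<rho> by (simp add: field_simps)
    then show ?thesis by linarith
  qed
  have "P {}" by (simp add: P_def)
  then obtain C where C: "P C" "\<And>D. P D \<Longrightarrow> card D \<le> card C"
    using ex_has_greatest_nat[of P "{}" card] bd by (metis le_imp_less_Suc)
  have "\<exists>x\<in>C. \<bar>x - y\<bar> < 2 * \<rho>" if y: "y \<in> R" for y
  proof (rule ccontr)
    assume "\<not> ?thesis"
    then have far: "2 * \<rho> \<le> \<bar>x - y\<bar>" if "x \<in> C" for x using that by force
    then have "y \<notin> C" using \<rho> by force
    have "P (insert y C)" using C(1) y far by (auto simp: P_def abs_minus_commute)
    from C(2)[OF this] \<open>y \<notin> C\<close> C(1) show False by (simp add: P_def)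
  qed
  then show ?thesis using C(1) unfolding P_def by blast
qed

text \<open>A ball of generation \<open>n\<close> can be added whenever it misses the union \<open>U n\<close> of the earlier ones. The
  centres that fail lie in the \<open>2 \<rho> n\<close>-neighbourhood of \<open>U n\<close>, whose measure exceeds that of \<open>U n\<close>
  by at most \<open>4 \<rho> n\<close> per earlier ball, and lacunarity makes the earlier balls few. So as long as
  \<open>U n\<close> is small, its measure grows by a fixed multiple of \<open>r n / \<rho> n\<close>.\<close>

lemma ubiquity_limsup_measure:
  fixes \<rho> r :: "nat \<Rightarrow> real" and R :: "nat \<Rightarrow> real set" and N :: "nat set"
  assumes st: "s < t" and \<kappa>: "0 < \<kappa>"
    and pos: "\<And>n. n \<in> N \<Longrightarrow> 0 < r n \<and> r n \<le> \<rho> n"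
    and ubiq: "\<exists>n1. \<forall>n\<in>N. n1 \<le> n \<longrightarrow>
        \<kappa> * (t' - s') \<le> measure lebesgue ({s'..t'} \<inter> (\<Union>\<tau>\<in>R n \<inter> {s'..t'}. ball \<tau> (\<rho> n)))"
    and s't': "s' = s + (t - s) / 4" "t' = t - (t - s) / 4"
    and lac: "\<And>n. n \<in> N \<Longrightarrow> (\<Sum>k | k \<in> N \<and> k < n. 1 / \<rho> k) \<le> \<kappa> / 48 / \<rho> n"
    and div: "\<And>B. \<exists>K. B < (\<Sum>n | n \<in> N \<and> n < K. r n / \<rho> n)"
    and lim: "\<And>e. 0 < e \<Longrightarrow> \<exists>n1. \<forall>n\<in>N. n1 \<le> n \<longrightarrow> \<rho> n \<le> e"
  shows "\<kappa> / 24 * (t - s) \<le> measure lebesgue ({s..t} \<inter> (\<Union>n\<in>N \<inter> {n0..}. \<Union>\<tau>\<in>R n. ball \<tau> (r n)))"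
proof -
  define l where "l = t - s"
  have l: "0 < l" "t' - s' = l / 2" "s' \<le> t'" using st by (auto simp: l_def s't' field_simps)
  \<comment> \<open>Centres are taken only in the middle half, so balls of radius at most
    \<open>l / 4\<close> remain inside \<open>{s..t}\<close>.\<close>
  have mid: "z \<in> {s..t}" if "x \<in> {s'..t'}" "\<bar>x - z\<bar> < l / 4" for x z
  proof -
    have "s \<le> z" "z \<le> t" using that unfolding s't' l_def atLeastAtMost_iff by linarith+
    then show ?thesis by simp
  qed
  obtain n1 where n1: "\<And>n. n \<in> N \<Longrightarrow> n1 \<le> n \<Longrightarrow>
        \<kappa> * (t' - s') \<le> measure lebesgue ({s'..t'} \<inter> (\<Union>\<tau>\<in>R n \<inter> {s'..t'}. ball \<tau> (\<rho> n)))"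
    using ubiq by blast
  obtain n2 where n2: "\<And>n. n \<in> N \<Longrightarrow> n2 \<le> n \<Longrightarrow> \<rho> n \<le> l / 4" using lim[of "l / 4"] l by auto
  define m0 where "m0 = max n0 (max n1 n2)"
  define N' where "N' = N \<inter> {m0..}"
  have N': "n \<in> N" "n0 \<le> n" "n1 \<le> n" "n2 \<le> n" if "n \<in> N'" for n using that by (auto simp: N'_def m0_def)
  have \<rho>: "0 < \<rho> n" "0 < r n" "r n \<le> \<rho> n" "\<rho> n \<le> l / 4" if "n \<in> N'" for n
    using pos[OF N'(1)[OF that]] n2[OF N'(1)[OF that] N'(4)[OF that]] by auto
  have "\<exists>C\<subseteq>R n \<inter> {s'..t'}. finite C \<and> (\<forall>x\<in>C. \<forall>y\<in>C. x \<noteq> y \<longrightarrow> 2 * \<rho> n \<le> \<bar>x - y\<bar>) \<and>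
     (\<forall>y\<in>R n \<inter> {s'..t'}. \<exists>x\<in>C. \<bar>x - y\<bar> < 2 * \<rho> n)" if "n \<in> N'" for n
    by (rule maximal_separated[OF l(3) \<rho>(1)[OF that]]) blast
  then obtain C where C0: "\<And>n. n \<in> N' \<Longrightarrow> C n \<subseteq> R n \<inter> {s'..t'} \<and> finite (C n) \<and>
     (\<forall>x\<in>C n. \<forall>y\<in>C n. x \<noteq> y \<longrightarrow> 2 * \<rho> n \<le> \<bar>x - y\<bar>) \<and>
     (\<forall>y\<in>R n \<inter> {s'..t'}. \<exists>x\<in>C n. \<bar>x - y\<bar> < 2 * \<rho> n)"
    by metis
  have C: "C n \<subseteq> R n \<inter> {s'..t'}" "finite (C n)"
      "\<And>x y. x \<in> C n \<Longrightarrow> y \<in> C n \<Longrightarrow> x \<noteq> y \<Longrightarrow> 2 * \<rho> n \<le> \<bar>x - y\<bar>"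
      "\<And>y. y \<in> R n \<inter> {s'..t'} \<Longrightarrow> \<exists>x\<in>C n. \<bar>x - y\<bar> < 2 * \<rho> n" if "n \<in> N'" for n
    using C0[OF that] by blast+
  \<comment> \<open>The balls of radius \<open>3 * \<rho> n\<close> around the separated centres
    cover the ubiquity set, of measure at least \<open>\<kappa> * l / 2\<close>, and each has
    measure \<open>6 * \<rho> n\<close>.\<close>
  have card_ge: "\<kappa> * l / 12 \<le> real (card (C n)) * \<rho> n" if n: "n \<in> N'" for n
  proof -
    have "\<kappa> * (t' - s') \<le> measure lebesgue ({s'..t'} \<inter> (\<Union>\<tau>\<in>R n \<inter> {s'..t'}. ball \<tau> (\<rho> n)))"
      using n1 N' n by blast
    also have "\<dots> \<le> measure lebesgue (\<Union>x\<in>C n. ball x (3 * \<rho> n))"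
    proof (rule measure_mono_fmeasurable)
      show "{s'..t'} \<inter> (\<Union>\<tau>\<in>R n \<inter> {s'..t'}. ball \<tau> (\<rho> n)) \<subseteq> (\<Union>x\<in>C n. ball x (3 * \<rho> n))"
      proof clarify
        fix x \<tau> assume h: "\<tau> \<in> R n" "\<tau> \<in> {s'..t'}" "x \<in> ball \<tau> (\<rho> n)"
        obtain y where y: "y \<in> C n" "\<bar>y - \<tau>\<bar> < 2 * \<rho> n" using C(4)[OF n, of \<tau>] h by blast
        then have "x \<in> ball y (3 * \<rho> n)" using h(3) by (auto simp: dist_real_def)
        then show "x \<in> (\<Union>x\<in>C n. ball x (3 * \<rho> n))" using y by blast
      qed
      have "open (\<Union>\<tau>\<in>R n \<inter> {s'..t'}. ball \<tau> (\<rho> n))" by auto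
      then show "{s'..t'} \<inter> (\<Union>\<tau>\<in>R n \<inter> {s'..t'}. ball \<tau> (\<rho> n)) \<in> sets lebesgue"
        by (intro sets.Int) (auto intro: borel_open)
    qed (use C(2)[OF n] in auto)
    also have "\<dots> \<le> (\<Sum>x\<in>C n. measure lebesgue (ball x (3 * \<rho> n)))"
      using C(2)[OF n] by (intro measure_UNION_le) auto
    also have "\<dots> = (\<Sum>x\<in>C n. 6 * \<rho> n)"
      using \<rho>(1)[OF n] by (intro sum.cong) (auto simp: ball_eq_greaterThanLessThan)
    finally show ?thesis unfolding l(2) by simp
  qed
  have card_le: "real (card (C n)) * (2 * \<rho> n) \<le> l" if n: "n \<in> N'" for n
  proof -
    have "real (card (C n)) * (2 * \<rho> n) \<le> measure lebesgue {s..t}"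
    proof (rule separated_card_le(1)[OF C(2)[OF n] \<rho>(1)[OF n] C(3)[OF n]])
      fix x assume "x \<in> C n"
      then have "x \<in> {s'..t'}" using C(1)[OF n] by blast
      then show "ball x (\<rho> n) \<subseteq> {s..t}"
        using \<rho>(4)[OF n] mid[of x] by (auto simp: dist_real_def)
    qed auto
    then show ?thesis using st by (simp add: l_def)
  qed
  define E where "E n = (\<Union>x\<in>C n. ball x (r n))" for n
  define A where "A n = {k. k \<in> N' \<and> k < n}" for n
  define U where "U n = (\<Union>k\<in>A n. E k)" for n
  have finA: "finite (A n)" for n by (simp add: A_def)
  have E_lm: "E n \<in> lmeasurable" if "n \<in> N'" for n using C(2)[OF that] by (auto simp: E_def)
  have U_lm: "U n \<in> lmeasurable" for n
    unfolding U_def using finA E_lm by (intro fmeasurable.finite_UN) (auto simp: A_def)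
  have step: "measure lebesgue (U n) + \<kappa> * l / 12 * (r n / \<rho> n) \<le> measure lebesgue (U (Suc n))"
    if n: "n \<in> N'" and small: "measure lebesgue (U n) \<le> \<kappa> * l / 24" for n
  proof -
    define bad where "bad = {x\<in>C n. ball x (r n) \<inter> U n \<noteq> {}}"
    define good where "good = C n - bad"
    have fin: "finite bad" "finite good" using C(2)[OF n] by (auto simp: bad_def good_def)
    \<comment> \<open>If the ball of radius \<open>r n\<close> about a bad centre meets an earlier
      ball of radius \<open>r k\<close>, then the ball of radius \<open>\<rho> n\<close> lies within
      \<open>r k + 2 * \<rho> n\<close> of the earlier centre. The shells thus account for
      everything outside \<open>U n\<close>, and each has measure
      \<open>4 * \<rho> n\<close>.\<close>
    define T where "T = U n \<union> (\<Union>k\<in>A n. \<Union>y\<in>C k. ball y (r k + 2 * \<rho> n) - ball y (r k))"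
    have AN: "k \<in> N'" if "k \<in> A n" for k using that by (simp add: A_def)
    have finC: "finite (C k)" if "k \<in> A n" for k using C(2) AN that by blast
    have T_lm: "(\<Union>k\<in>A n. \<Union>y\<in>C k. ball y (r k + 2 * \<rho> n) - ball y (r k)) \<in> lmeasurable"
      using finA finC by (intro fmeasurable.finite_UN fmeasurable_Diff) auto
    have "real (card bad) * (2 * \<rho> n) \<le> measure lebesgue T"
    proof (rule separated_card_le(1)[OF fin(1) \<rho>(1)[OF n]])
      show "T \<in> lmeasurable" unfolding T_def using U_lm T_lm by (intro fmeasurable.Un)
      fix x assume x: "x \<in> bad"
      then obtain z where z: "z \<in> ball x (r n)" "z \<in> U n" by (auto simp: bad_def)
      then obtain k y where ky: "k \<in> A n" "y \<in> C k" "z \<in> ball y (r k)" by (auto simp: U_def E_def)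
      have "ball x (\<rho> n) \<subseteq> ball y (r k + 2 * \<rho> n)"
        using z(1) ky(3) \<rho>(3)[OF n] by (auto simp: dist_real_def)
      moreover have "ball y (r k) \<subseteq> U n" using ky by (auto simp: U_def E_def)
      ultimately show "ball x (\<rho> n) \<subseteq> T" using ky unfolding T_def by blast
    qed (use C(3)[OF n] in \<open>auto simp: bad_def\<close>)
    also have "\<dots> \<le> measure lebesgue (U n) + measure lebesgue (\<Union>k\<in>A n. \<Union>y\<in>C k. ball y (r k + 2 * \<rho> n) - ball y (r k))"
      unfolding T_def using U_lm T_lm by (intro measure_Un_le) auto
    also have "measure lebesgue (\<Union>k\<in>A n. \<Union>y\<in>C k. ball y (r k + 2 * \<rho> n) - ball y (r k))
        \<le> (\<Sum>k\<in>A n. measure lebesgue (\<Union>y\<in>C k. ball y (r k + 2 * \<rho> n) - ball y (r k)))"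
      using finA finC by (intro measure_UNION_le) (auto intro!: sets.finite_UN)
    also have "\<dots> \<le> (\<Sum>k\<in>A n. 2 * \<rho> n * l * (1 / \<rho> k))"
    proof (rule sum_mono)
      fix k assume k: "k \<in> A n"
      have "measure lebesgue (\<Union>y\<in>C k. ball y (r k + 2 * \<rho> n) - ball y (r k))
          \<le> (\<Sum>y\<in>C k. measure lebesgue (ball y (r k + 2 * \<rho> n) - ball y (r k)))"
        using finC[OF k] by (intro measure_UNION_le) auto
      also have "\<dots> = (\<Sum>y\<in>C k. 4 * \<rho> n)"
      proof (rule sum.cong[OF refl])
        fix y :: real
        have "measure lebesgue (ball y (r k + 2 * \<rho> n) - ball y (r k))
          = measure lebesgue (ball y (r k + 2 * \<rho> n)) - measure lebesgue (ball y (r k))"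
          using \<rho>(1)[OF n] by (intro measurable_measure_Diff) auto
        also have "\<dots> = 4 * \<rho> n"
        proof -
          have a: "0 \<le> r k + 2 * \<rho> n" "0 \<le> r k" using \<rho>(1)[OF n] \<rho>(2)[OF AN[OF k]] by auto
          show ?thesis unfolding measure_ball_real[OF a(1)] measure_ball_real[OF a(2)] by simp
        qed
        finally show "measure lebesgue (ball y (r k + 2 * \<rho> n) - ball y (r k)) = 4 * \<rho> n" .
      qed
      also have "\<dots> = 2 * \<rho> n * (real (card (C k)) * (2 * \<rho> k)) * (1 / \<rho> k)"
        using \<rho>(1)[OF AN[OF k]] by simp
      also have "\<dots> \<le> 2 * \<rho> n * l * (1 / \<rho> k)"
        using \<rho>(1)[OF AN[OF k]] \<rho>(1)[OF n] card_le[OF AN[OF k]]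
        by (intro mult_right_mono mult_left_mono) auto
      finally show "measure lebesgue (\<Union>y\<in>C k. ball y (r k + 2 * \<rho> n) - ball y (r k)) \<le> 2 * \<rho> n * l * (1 / \<rho> k)" .
    qed
    also have "\<dots> = 2 * \<rho> n * l * (\<Sum>k\<in>A n. 1 / \<rho> k)" by (simp add: sum_distrib_left)
    also have "\<dots> \<le> 2 * \<rho> n * l * (\<kappa> / 48 / \<rho> n)"
    proof (rule mult_left_mono)
      have "(\<Sum>k\<in>A n. 1 / \<rho> k) \<le> (\<Sum>k | k \<in> N \<and> k < n. 1 / \<rho> k)"
        using pos by (intro sum_mono2) (auto simp: A_def N'_def intro: less_imp_le less_le_trans)
      also have "\<dots> \<le> \<kappa> / 48 / \<rho> n" using lac N' n by blast
      finally show "(\<Sum>k\<in>A n. 1 / \<rho> k) \<le> \<kappa> / 48 / \<rho> n" .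
    qed (use l \<rho>(1)[OF n] in auto)
    also have "\<dots> = \<kappa> * l / 24" using \<rho>(1)[OF n] by (simp add: field_simps)
    \<comment> \<open>\<open>U n\<close> and the shells contribute at most
      \<open>\<kappa> * l / 24\<close> each; the 48 in the lacunarity condition is chosen for the
      second. So bad centres amount to at most half of the lower bound
      \<open>card_ge\<close>.\<close>
    finally have "real (card bad) * (2 * \<rho> n) \<le> \<kappa> * l / 12" using small by simp
    moreover have "real (card (C n)) = real (card bad) + real (card good)"
    proof -
      have "bad \<subseteq> C n" by (auto simp: bad_def)
      then have "card good = card (C n) - card bad" "card bad \<le> card (C n)"
        using fin C(2)[OF n] by (auto simp: good_def card_Diff_subset card_mono)
      then show ?thesis by simp
    qed
    ultimately have "\<kappa> * l / 24 \<le> real (card good) * \<rho> n"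
      using card_ge[OF n] by (simp add: algebra_simps)
    then have "\<kappa> * l / 24 / \<rho> n \<le> real (card good)" using \<rho>(1)[OF n] by (simp add: field_simps)
    then have "\<kappa> * l / 24 / \<rho> n * (2 * r n) \<le> real (card good) * (2 * r n)"
      using \<rho>(2)[OF n] by (intro mult_right_mono) auto
    then have cg: "\<kappa> * l / 12 * (r n / \<rho> n) \<le> real (card good) * (2 * r n)"
      by (simp add: field_simps)
    define G where "G = (\<Union>x\<in>good. ball x (r n))"
    have "measure lebesgue G = real (card good) * (2 * r n)" unfolding G_def
    proof (rule separated_card_le(2)[OF fin(2) \<rho>(2)[OF n]])
      fix x y assume "x \<in> good" "y \<in> good" "x \<noteq> y"
      then have "2 * \<rho> n \<le> \<bar>x - y\<bar>" using C(3)[OF n] by (auto simp: good_def)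
      then show "2 * r n \<le> \<bar>x - y\<bar>" using \<rho>(3)[OF n] by linarith
    next
      show "(\<Union>x\<in>good. ball x (r n)) \<in> lmeasurable" using fin by auto
    qed auto
    moreover have "measure lebesgue (U n \<union> G) = measure lebesgue (U n) + measure lebesgue G"
    proof -
      have "U n \<inter> G = {}" by (auto simp: G_def good_def bad_def)
      moreover have "G \<in> lmeasurable" using fin by (auto simp: G_def)
      ultimately show ?thesis using U_lm[of n] measure_Un3[of "U n" lebesgue G] by simp
    qed
    moreover have "measure lebesgue (U n \<union> G) \<le> measure lebesgue (U (Suc n))"
    proof (rule measure_mono_fmeasurable)
      show "U n \<union> G \<subseteq> U (Suc n)"
        using n by (auto simp: U_def A_def G_def E_def good_def less_Suc_eq; blast)
      have "G \<in> lmeasurable" using fin by (auto simp: G_def)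
      then show "U n \<union> G \<in> sets lebesgue" using U_lm[of n] by (intro fmeasurableD fmeasurable.Un)
    qed (rule U_lm)
    ultimately show ?thesis using cg by linarith
  qed
  have "\<exists>n. \<kappa> * l / 24 < measure lebesgue (U n)"
  proof (rule ccontr)
    assume "\<not> ?thesis"
    then have small: "measure lebesgue (U n) \<le> \<kappa> * l / 24" for n by (simp add: not_less)
    have "\<kappa> * l / 12 * (\<Sum>k\<in>A n. r k / \<rho> k) \<le> measure lebesgue (U n)" for n
    proof (induction n)
      case (Suc n)
      show ?case
      proof (cases "n \<in> N'")
        case True
        then have "A (Suc n) = insert n (A n)" "n \<notin> A n" by (auto simp: A_def)
        then have "(\<Sum>k\<in>A (Suc n). r k / \<rho> k) = r n / \<rho> n + (\<Sum>k\<in>A n. r k / \<rho> k)" using finA by simp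
        then show ?thesis using step[OF True small] Suc by (simp only: distrib_left)
      next
        case False
        then have "A (Suc n) = A n" by (auto simp: A_def less_Suc_eq)
        then show ?thesis using Suc by (simp add: U_def)
      qed
    qed (simp add: A_def)
    then have bd: "\<kappa> * l / 12 * (\<Sum>k\<in>A n. r k / \<rho> k) \<le> \<kappa> * l / 24" for n using small order_trans by blast
    have bd: "(\<Sum>k\<in>A n. r k / \<rho> k) \<le> 1 / 2" for n
    proof -
      have "(\<kappa> * l / 12) * (\<Sum>k\<in>A n. r k / \<rho> k) \<le> (\<kappa> * l / 12) * (1 / 2)" using bd[of n] by simp
      then show ?thesis using \<kappa> l(1) by (simp add: mult_le_cancel_left_pos)
    qed
    \<comment> \<open>The indices below \<open>m0\<close> were discarded from the construction, but
      they contribute only a fixed finite amount to the divergent sum.\<close>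
    define B where "B = (\<Sum>n | n \<in> N \<and> n < m0. r n / \<rho> n) + 1 / 2"
    obtain K where K: "B < (\<Sum>n | n \<in> N \<and> n < K. r n / \<rho> n)" using div by blast
    have "(\<Sum>n | n \<in> N \<and> n < K. r n / \<rho> n) \<le> (\<Sum>n\<in>{n. n \<in> N \<and> n < m0} \<union> A K. r n / \<rho> n)"
    proof (rule sum_mono2)
      fix n assume "n \<in> {n. n \<in> N \<and> n < m0} \<union> A K - {n. n \<in> N \<and> n < K}"
      then have "n \<in> N" by (auto simp: A_def N'_def)
      then show "0 \<le> r n / \<rho> n" using pos[of n] by auto
    qed (auto simp: A_def N'_def)
    also have "\<dots> = (\<Sum>n | n \<in> N \<and> n < m0. r n / \<rho> n) + (\<Sum>n\<in>A K. r n / \<rho> n)"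
      by (intro sum.union_disjoint) (auto simp: A_def N'_def)
    also have "\<dots> \<le> B" using bd by (simp add: B_def)
    finally show False using K by simp
  qed
  then obtain n where "\<kappa> * l / 24 < measure lebesgue (U n)" by blast
  also have "\<dots> \<le> measure lebesgue ({s..t} \<inter> (\<Union>n\<in>N \<inter> {n0..}. \<Union>\<tau>\<in>R n. ball \<tau> (r n)))"
  proof (rule measure_mono_fmeasurable)
    show "U n \<subseteq> {s..t} \<inter> (\<Union>n\<in>N \<inter> {n0..}. \<Union>\<tau>\<in>R n. ball \<tau> (r n))"
    proof
      fix z assume "z \<in> U n"
      then obtain k y where k: "k \<in> N'" "y \<in> C k" "z \<in> ball y (r k)" by (auto simp: U_def E_def A_def)
      have y: "y \<in> R k" "y \<in> {s'..t'}" using C(1) k by blast+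
      have "z \<in> {s..t}" using k(3) \<rho>(3,4)[OF k(1)] mid[OF y(2), of z] by (simp add: dist_real_def)
      then show "z \<in> {s..t} \<inter> (\<Union>n\<in>N \<inter> {n0..}. \<Union>\<tau>\<in>R n. ball \<tau> (r n))"
        using k y N'[OF k(1)] by blast
    qed
    have "open (\<Union>n\<in>N \<inter> {n0..}. \<Union>\<tau>\<in>R n. ball \<tau> (r n))" by auto
    then show "{s..t} \<inter> (\<Union>n\<in>N \<inter> {n0..}. \<Union>\<tau>\<in>R n. ball \<tau> (r n)) \<in> lmeasurable"
      by (intro fmeasurable_Int_fmeasurable) (auto intro: borel_open)
  qed (use U_lm in auto)
  finally show ?thesis by (simp add: l_def mult.commute)
qed

text \<open>Squeeze the complement between a compact set inside it and an open set slightly larger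
  than that compact set. Finitely many intervals lie between the two, and each holds at most a
  proportion 1 - c of the complement. Up to arbitrarily small errors this gives \<mu> \<le> (1 - c)
  \<mu>, so \<mu> = 0.\<close>

lemma null_of_interval_density:
  fixes A :: "real set"
  assumes A: "A \<in> sets lebesgue" and ab: "a < b" and c: "0 < c"
    and dens: "\<And>s t. s < t \<Longrightarrow> {s..t} \<subseteq> {a..b} \<Longrightarrow> c * (t - s) \<le> measure lebesgue (A \<inter> {s..t})"
  shows "{a..b} - A \<in> null_sets lebesgue"
proof -
  define S where "S = {a..b} - A"
  have Sm: "S \<in> lmeasurable" unfolding S_def using A by (intro fmeasurable_Diff) auto
  define \<mu> where "\<mu> = measure lebesgue S"
  have \<mu>0: "0 \<le> \<mu>" by (simp add: \<mu>_def)
  have c1: "c \<le> 1"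
  proof -
    have "c * (b - a) \<le> measure lebesgue (A \<inter> {a..b})" using dens ab by blast
    also have "\<dots> \<le> measure lebesgue {a..b}" using A by (intro measure_mono_fmeasurable) auto
    finally show ?thesis using ab by simp
  qed
  have piece: "measure lebesgue (S \<inter> {s..t}) \<le> (1 - c) * measure lebesgue {s..t}" if "{s..t} \<subseteq> {a..b}" for s t
  proof (cases "s < t")
    case True
    have "S \<inter> {s..t} = {s..t} - A \<inter> {s..t}" using that by (auto simp: S_def)
    moreover have "measure lebesgue ({s..t} - A \<inter> {s..t}) = measure lebesgue {s..t} - measure lebesgue (A \<inter> {s..t})"
      using A by (intro measurable_measure_Diff) auto
    ultimately show ?thesis using dens[OF True that] True by (simp add: algebra_simps)
  next
    case False
    have "measure lebesgue (S \<inter> {s..t}) \<le> measure lebesgue {s..t}"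
      using Sm by (intro measure_mono_fmeasurable) auto
    then show ?thesis using False c1 by (cases "s = t") auto
  qed
  have le: "\<mu> \<le> (1 - c) * (\<mu> + e) + e" if e: "0 < e" for e
  proof -
    obtain K where K: "closed K" "K \<subseteq> S" "S - K \<in> lmeasurable" "emeasure lebesgue (S - K) < ennreal e"
      using sets_lebesgue_inner_closed[OF fmeasurableD[OF Sm] e] by metis
    have Kc: "compact K"
      using K bounded_subset[of "{a..b}" K] by (auto simp: S_def compact_eq_bounded_closed)
    then have Km: "K \<in> lmeasurable" by (rule lmeasurable_compact)
    obtain W where W: "open W" "K \<subseteq> W" "W - K \<in> lmeasurable" "emeasure lebesgue (W - K) < ennreal e"
      using sets_lebesgue_outer_open[OF fmeasurableD[OF Km] e] by metis
    have WK: "W = K \<union> (W - K)" using W by blast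
    have Wm: "W \<in> lmeasurable" by (subst WK) (intro fmeasurable.Un Km W)
    have "measure lebesgue W \<le> measure lebesgue K + measure lebesgue (W - K)"
      by (subst WK) (intro measure_Un_le fmeasurableD Km W)
    moreover have "measure lebesgue (W - K) < e"
      using W e by (simp add: emeasure_eq_measure2 ennreal_less_iff)
    ultimately have Wle: "measure lebesgue W \<le> measure lebesgue K + e" by simp
    have "measure lebesgue (S - K) < e"
      using K e by (simp add: emeasure_eq_measure2 ennreal_less_iff)
    moreover have "measure lebesgue (S - K) = \<mu> - measure lebesgue K"
      unfolding \<mu>_def using K Km Sm by (intro measurable_measure_Diff) auto
    ultimately have \<mu>K: "\<mu> \<le> measure lebesgue K + e" by simp
    have K\<mu>: "measure lebesgue K \<le> \<mu>"
      unfolding \<mu>_def using K Km Sm by (intro measure_mono_fmeasurable) auto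
    have "\<exists>d>0. cball x d \<subseteq> W" if "x \<in> K" for x
      using W that open_contains_cball by blast
    then obtain d where d: "\<And>x. x \<in> K \<Longrightarrow> 0 < d x" "\<And>x. x \<in> K \<Longrightarrow> cball x (d x) \<subseteq> W" by metis
    have "K \<subseteq> (\<Union>x\<in>K. ball x (d x))" using d by force
    then obtain F where F: "F \<subseteq> K" "finite F" "K \<subseteq> (\<Union>x\<in>F. ball x (d x))"
      using compactE_image[OF Kc, of K "\<lambda>x. ball x (d x)"] by (metis open_ball)
    define f where "f = (\<lambda>x. cbox (max a (x - d x)) (min b (x + d x))) ` F"
    have f_sub: "\<Union>f \<subseteq> W" "\<Union>f \<subseteq> {a..b}"
      using d(2) F(1) by (auto simp: f_def cball_def dist_real_def subset_iff abs_le_iff)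
    have Kf: "K \<subseteq> \<Union>f"
    proof
      fix y assume y: "y \<in> K"
      then obtain x where "x \<in> F" "y \<in> ball x (d x)" using F by blast
      moreover have "y \<in> {a..b}" using y K by (auto simp: S_def)
      ultimately show "y \<in> \<Union>f" by (auto simp: f_def dist_real_def intro!: bexI[of _ x])
    qed
    \<comment> \<open>The finitely many intervals may overlap; a division of their union makes the
      lengths add up to its measure.\<close>
    obtain p where p: "p division_of \<Union>f"
      using elementary_unions_intervals[of f] F(2) by (auto simp: f_def)
    have pint: "\<exists>s t. k = {s..t}" if "k \<in> p" for k using p that by (metis division_ofD(4) box_real(2))
    have Sk: "S \<inter> k \<in> lmeasurable" if "k \<in> p" for k
    proof -
      obtain s t where "k = {s..t}" using pint[OF \<open>k \<in> p\<close>] by blast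
      then show ?thesis using Sm by (simp add: fmeasurable_Int_fmeasurable)
    qed
    have "measure lebesgue K \<le> measure lebesgue (\<Union>k\<in>p. S \<inter> k)"
    proof (rule measure_mono_fmeasurable)
      have "K \<subseteq> \<Union>p" using Kf division_ofD(6)[OF p] by simp
      then show "K \<subseteq> (\<Union>k\<in>p. S \<inter> k)" using K(2) by blast
      show "(\<Union>k\<in>p. S \<inter> k) \<in> lmeasurable"
        using Sk division_ofD(1)[OF p] by (rule_tac fmeasurable.finite_UN)
    qed (use Km in auto)
    also have "\<dots> \<le> (\<Sum>k\<in>p. measure lebesgue (S \<inter> k))"
      by (rule measure_UNION_le[OF division_ofD(1)[OF p] fmeasurableD[OF Sk]])
    also have "\<dots> \<le> (\<Sum>k\<in>p. (1 - c) * measure lebesgue k)"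
    proof (rule sum_mono)
      fix k assume k: "k \<in> p"
      obtain s t where "k = {s..t}" using pint[OF k] by blast
      moreover have "k \<subseteq> {a..b}" using division_ofD(2)[OF p k] f_sub by blast
      ultimately show "measure lebesgue (S \<inter> k) \<le> (1 - c) * measure lebesgue k" using piece by blast
    qed
    also have "\<dots> = (1 - c) * measure lebesgue (\<Union>f)"
      using content_division[OF p] by (simp only: sum_distrib_left[symmetric])
    also have "\<dots> \<le> (1 - c) * measure lebesgue W"
      using f_sub Wm F(2) c1 by (intro mult_left_mono measure_mono_fmeasurable) (auto simp: f_def)
    also have "\<dots> \<le> (1 - c) * (\<mu> + e)" using Wle K\<mu> c1 by (intro mult_left_mono) auto
    finally show ?thesis using \<mu>K by simp
  qed
  have "c * \<mu> \<le> 0"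
  proof (rule field_le_epsilon)
    fix e :: real assume e: "0 < e"
    have "\<mu> \<le> (1 - c) * (\<mu> + e / 2) + e / 2" using le[of "e / 2"] e by simp
    moreover have "(1 - c) * (\<mu> + e / 2) = \<mu> - c * \<mu> + (1 - c) * (e / 2)" by (simp add: algebra_simps)
    moreover have "(1 - c) * (e / 2) \<le> 1 * (e / 2)" using c e by (intro mult_right_mono) auto
    ultimately show "c * \<mu> \<le> 0 + e" by simp
  qed
  then have "\<mu> = 0" using c \<mu>0 by (simp add: mult_le_0_iff)
  then show ?thesis
    using Sm by (auto simp: null_sets_def S_def[symmetric] \<mu>_def emeasure_eq_measure2)
qed

section \<open>Almost every point of a curved arc is approximable\<close>

text \<open>The maximum over indices strictly below \<open>n\<close>, started at 0 because the
  sequences of interest are nonnegative. Thus \<open>run_max f n \<le> f n\<close> says that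
  \<open>n\<close> is a weak record.\<close>

primrec run_max :: "(nat \<Rightarrow> real) \<Rightarrow> nat \<Rightarrow> real" where
  "run_max f 0 = 0"
| "run_max f (Suc n) = max (run_max f n) (f n)"

lemma run_max_ge: "k < n \<Longrightarrow> f k \<le> run_max f n"
  by (induction n) (auto simp: less_Suc_eq le_max_iff_disj)

lemma run_max_nonneg: "0 \<le> run_max f n"
  by (induction n) (auto simp: le_max_iff_disj)

text \<open>Keeping only the record indices of \<open>S ^ n * a n\<close> loses at most half of a sum and produces the
  lacunarity needed for the limsup argument.\<close>

lemma sum_le_sum_records:
  fixes a :: "nat \<Rightarrow> real"
  assumes S: "2 \<le> S" and a: "\<And>n. 0 \<le> a n"
  defines "f \<equiv> \<lambda>n. S ^ n * a n"
  shows "(\<Sum>n<K. a n) + 2 * run_max f K / S ^ K \<le> 2 * (\<Sum>n | run_max f n \<le> f n \<and> n < K. a n)"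
proof (induction K)
  case (Suc K)
  have Sp: "0 < S ^ K" using S by simp
  \<comment> \<open>The extra term \<open>2 * R\<close> on the left is a reserve that drives the
    induction: at a non-record \<open>a K\<close> is at most \<open>R\<close>, while the reserve
    drops by at least \<open>R\<close> because \<open>S \<ge> 2\<close>; at a record
    \<open>a K\<close> refills it.\<close>
  define R where "R = run_max f K / S ^ K"
  have R: "0 \<le> R" using run_max_nonneg[of f K] Sp by (simp add: R_def)
  have inv: "1 / S \<le> 1 / 2" using S by (simp add: divide_simps)
  show ?case
  proof (cases "run_max f K \<le> f K")
    case True
    have "{n. run_max f n \<le> f n \<and> n < Suc K} = insert K {n. run_max f n \<le> f n \<and> n < K}"
      using True by (auto simp: less_Suc_eq)
    then have 1: "(\<Sum>n | run_max f n \<le> f n \<and> n < Suc K. a n) = a K + (\<Sum>n | run_max f n \<le> f n \<and> n < K. a n)"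
      by simp
    have "run_max f (Suc K) / S ^ Suc K = a K * (1 / S)"
      using True Sp S by (simp add: f_def max_def)
    also have "\<dots> \<le> a K * (1 / 2)" using inv a by (intro mult_left_mono) auto
    finally have "2 * run_max f (Suc K) / S ^ Suc K \<le> a K"
      unfolding times_divide_eq_right[symmetric] by linarith
    moreover have "0 \<le> 2 * run_max f K / S ^ K" using R by (simp add: R_def)
    ultimately show ?thesis using Suc unfolding 1 by simp
  next
    case False
    then have "{n. run_max f n \<le> f n \<and> n < Suc K} = {n. run_max f n \<le> f n \<and> n < K}"
      by (auto simp: less_Suc_eq)
    then have 1: "(\<Sum>n | run_max f n \<le> f n \<and> n < Suc K. a n) = (\<Sum>n | run_max f n \<le> f n \<and> n < K. a n)"
      by simp
    have aK: "a K \<le> R" using False Sp by (simp add: R_def f_def pos_le_divide_eq mult.commute)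
    have "run_max f (Suc K) / S ^ Suc K = R * (1 / S)"
      using False Sp S by (simp add: R_def max_def)
    also have "\<dots> \<le> R * (1 / 2)" using inv R by (intro mult_left_mono) auto
    finally have "2 * run_max f (Suc K) / S ^ Suc K \<le> R"
      unfolding times_divide_eq_right[symmetric] by linarith
    moreover have "2 * run_max f K / S ^ K = 2 * R" by (simp add: R_def)
    ultimately show ?thesis using Suc aK unfolding 1 by simp
  qed
qed simp

text \<open>Cauchy condensation in base \<open>T\<close>: on each block of integers between
  consecutive powers, \<psi> is bounded by its value at the left end. Shifting the index of the
  condensed series costs the factor T^2.\<close>

lemma summable_of_condensed:
  fixes \<psi> :: "real \<Rightarrow> real" and T :: nat
  assumes \<psi>: "\<And>x. 0 < x \<Longrightarrow> 0 < \<psi> x" "\<And>x y. 0 < x \<Longrightarrow> x \<le> y \<Longrightarrow> \<psi> y \<le> \<psi> x" and T: "2 \<le> T"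
    and sm: "summable (\<lambda>n. real T ^ n * (\<psi> (real T ^ Suc n))\<^sup>2)"
  shows "summable (\<lambda>h::nat. (\<psi> (real (Suc h)))\<^sup>2)"
proof -
  define b where "b n = real T ^ Suc n * (\<psi> (real T ^ n))\<^sup>2" for n
  have "(\<lambda>n. b (Suc n)) = (\<lambda>n. (real T)\<^sup>2 * (real T ^ n * (\<psi> (real T ^ Suc n))\<^sup>2))"
    by (auto simp: b_def power2_eq_square)
  then have "summable (\<lambda>n. b (Suc n))" using sm by (simp only: summable_mult)
  then have sb: "summable b" by (simp add: summable_Suc_iff)
  have b0: "0 \<le> b n" for n by (simp add: b_def)
  have block: "(\<Sum>h\<in>{1..<T ^ K}. (\<psi> (real h))\<^sup>2) \<le> (\<Sum>n<K. b n)" for K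
  proof (induction K)
    case (Suc K)
    have TK: "1 \<le> T ^ K" "T ^ K \<le> T ^ Suc K" using T by auto
    have "(\<Sum>h\<in>{1..<T ^ Suc K}. (\<psi> (real h))\<^sup>2) = (\<Sum>h\<in>{1..<T ^ K}. (\<psi> (real h))\<^sup>2) + (\<Sum>h\<in>{T ^ K..<T ^ Suc K}. (\<psi> (real h))\<^sup>2)"
      using TK by (intro sum.atLeastLessThan_concat[symmetric])
    moreover have "(\<Sum>h\<in>{T ^ K..<T ^ Suc K}. (\<psi> (real h))\<^sup>2) \<le> (\<Sum>h\<in>{T ^ K..<T ^ Suc K}. (\<psi> (real T ^ K))\<^sup>2)"
    proof (rule sum_mono)
      fix h assume h: "h \<in> {T ^ K..<T ^ Suc K}"
      have "0 < real T ^ K" using T by simp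
      moreover have "real T ^ K \<le> real h" using h by (metis atLeastLessThan_iff of_nat_le_iff of_nat_power)
      ultimately show "(\<psi> (real h))\<^sup>2 \<le> (\<psi> (real T ^ K))\<^sup>2"
        using \<psi>(1)[of "real h"] \<psi>(2)[of "real T ^ K" "real h"] by (intro power_mono) linarith+
    qed
    moreover have "(\<Sum>h\<in>{T ^ K..<T ^ Suc K}. (\<psi> (real T ^ K))\<^sup>2) \<le> b K"
      unfolding b_def sum_constant card_atLeastLessThan
      by (intro mult_right_mono) (use TK of_nat_diff in \<open>auto simp: of_nat_diff\<close>)
    ultimately show ?case using Suc by simp
  qed simp
  show ?thesis
  proof (rule summableI_nonneg_bounded)
    fix n
    have "(\<Sum>h<n. (\<psi> (real (Suc h)))\<^sup>2) = (\<Sum>h\<in>{1..<Suc n}. (\<psi> (real h))\<^sup>2)"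
      by (rule sum.reindex_bij_witness[of _ "\<lambda>h. h - 1" Suc]) auto
    also have "\<dots> \<le> (\<Sum>h\<in>{1..<T ^ n}. (\<psi> (real h))\<^sup>2)"
    proof (rule sum_mono2)
      have "n < T ^ n" using T less_exp[of n] power_mono[of 2 T n] by linarith
      then show "{1..<Suc n} \<subseteq> {1..<T ^ n}" by auto
    qed auto
    also have "\<dots> \<le> (\<Sum>n<n. b n)" by (rule block)
    also have "\<dots> \<le> suminf b" using sb b0 by (intro sum_le_suminf) auto
    finally show "(\<Sum>h<n. (\<psi> (real (Suc h)))\<^sup>2) \<le> suminf b" .
  qed simp
qed

text \<open>If the truncated series converged, its terms would tend to 0, so the truncation would
  eventually be inactive and the condensed series in base S^2 would converge too.\<close>

lemma truncated_condensed_not_summable: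
  fixes \<psi> :: "real \<Rightarrow> real" and S :: nat
  assumes \<psi>: "\<And>x. 0 < x \<Longrightarrow> 0 < \<psi> x" "\<And>x y. 0 < x \<Longrightarrow> x \<le> y \<Longrightarrow> \<psi> y \<le> \<psi> x" and S: "2 \<le> S"
    and ns: "\<not> summable (\<lambda>h::nat. (\<psi> (real (Suc h)))\<^sup>2)"
  shows "\<not> summable (\<lambda>n. (min (real S ^ n * \<psi> (real S ^ (2 * n + 2))) 1)\<^sup>2)"
proof
  let ?y = "\<lambda>n. min (real S ^ n * \<psi> (real S ^ (2 * n + 2))) 1"
  assume sm: "summable (\<lambda>n. (?y n)\<^sup>2)"
  have "(\<lambda>n. (?y n)\<^sup>2) \<longlonglongrightarrow> 0" using summable_LIMSEQ_zero[OF sm] .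
  then have "eventually (\<lambda>n. (?y n)\<^sup>2 < 1) sequentially" by (rule order_tendstoD) simp
  then have "eventually (\<lambda>n. (?y n)\<^sup>2 = real (S\<^sup>2) ^ n * (\<psi> (real (S\<^sup>2) ^ Suc n))\<^sup>2) sequentially"
  proof (rule eventually_mono)
    fix n assume "(?y n)\<^sup>2 < 1"
    then have "?y n \<noteq> 1" by auto
    then have y: "?y n = real S ^ n * \<psi> (real S ^ (2 * n + 2))" unfolding min_def by presburger
    have pw: "real (S\<^sup>2) ^ j = real S ^ (2 * j)" for j by (simp add: power_mult)
    have "real (S\<^sup>2) ^ n = (real S ^ n)\<^sup>2" unfolding pw by (simp add: power_mult[symmetric] mult.commute)
    moreover have "real (S\<^sup>2) ^ Suc n = real S ^ (2 * n + 2)" unfolding pw by simp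
    ultimately show "(?y n)\<^sup>2 = real (S\<^sup>2) ^ n * (\<psi> (real (S\<^sup>2) ^ Suc n))\<^sup>2"
      unfolding y by (simp only: power_mult_distrib)
  qed
  then have "summable (\<lambda>n. real (S\<^sup>2) ^ n * (\<psi> (real (S\<^sup>2) ^ Suc n))\<^sup>2)"
    using sm summable_cong by fast
  moreover have "2 \<le> S\<^sup>2" using S by (metis power2_nat_le_imp_le order_trans self_le_power zero_less_numeral le_trans one_le_numeral)
  ultimately show False using summable_of_condensed[of \<psi> "S\<^sup>2"] \<psi> ns by blast
qed

text \<open>Explicit integer witnesses replace \<open>int_dist\<close>, so that reflecting or
  exchanging the two coordinates visibly leaves the set unchanged.\<close>

abbreviation close_denominators :: "(real \<Rightarrow> real) \<Rightarrow> real \<Rightarrow> real \<Rightarrow> nat set" where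
  "close_denominators \<psi> x y \<equiv> {q::nat. 0 < q \<and> (\<exists>p r::int.
     \<bar>real q * x - real_of_int p\<bar> < \<psi> (real q) \<and> \<bar>real q * y - real_of_int r\<bar> < \<psi> (real q))}"

context planar_curve
begin

lemma null_not_approximable:
  fixes \<psi> :: "real \<Rightarrow> real"
  assumes \<psi>: "\<And>x. 0 < x \<Longrightarrow> 0 < \<psi> x" "\<And>x y. 0 < x \<Longrightarrow> x \<le> y \<Longrightarrow> \<psi> y \<le> \<psi> x"
    and ns: "\<not> summable (\<lambda>h::nat. (\<psi> (real (Suc h)))\<^sup>2)"
  shows "{z\<in>{\<alpha>..\<beta>}. finite (close_denominators \<psi> (X z) (Y z))} \<in> null_sets lebesgue"
proof -
  obtain \<eta> where \<eta>: "0 < \<eta>" "\<eta> \<le> 1/6" and ub: "\<And>s t. s < t \<Longrightarrow> {s..t} \<subseteq> {\<alpha>..\<beta>} \<Longrightarrow>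
     (\<exists>K>0. \<forall>Q \<Phi>. K \<le> Q \<longrightarrow> 0 < \<Phi> \<longrightarrow> \<Phi> \<le> 1 \<longrightarrow> K \<le> Q * \<Phi> \<longrightarrow>
        1/4 * (t - s) \<le> measure lebesgue ({s..t} \<inter>
           (\<Union>\<tau>\<in>resonant \<eta> Q \<Phi> \<inter> {s..t}. ball \<tau> (1 / (c1 * Q\<^sup>2 * \<Phi>)))))"
    using resonant_ubiquitous by blast
  define M where "M = 5 / \<eta>\<^sup>2"
  have M: "1 \<le> M"
  proof -
    have "\<eta>\<^sup>2 \<le> 1" using \<eta> by (simp add: power_le_one)
    then show ?thesis using \<eta> by (simp add: M_def le_divide_eq)
  qed
  have L0: "0 \<le> L" using m_le[of \<alpha>] \<alpha>\<beta> by auto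
  \<comment> \<open>\<open>M \<le> S\<close> puts every resonant denominator below S^2 Q, the point
    at which \<psi> is evaluated. The bound 384 makes the geometric tail at most 2/384 = (1/4)/48,
    the lacunarity required for \<kappa> = 1/4.\<close>
  define S :: nat where "S = max 384 (nat \<lceil>M\<rceil>)"
  have S: "384 \<le> S" "M \<le> real S" unfolding S_def by linarith+
  have [simp]: "S \<noteq> 0" "0 < S" using S by auto
  have S1: "1 \<le> real S" "2 \<le> real S" "0 < real S" using S by auto
  have MS: "M \<le> (real S)\<^sup>2"
  proof -
    have "real S * 1 \<le> real S * real S" using S1 by (intro mult_left_mono) auto
    then show ?thesis using S(2) unfolding power2_eq_square by linarith
  qed
  \<comment> \<open>The cap at 1 gives \<open>\<Phi> n \<le> 1\<close> and, through
    \<open>ratio\<close>, also \<open>r n \<le> \<rho> n\<close>.\<close>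
  define y where "y n = min (real S ^ n * \<psi> (real S ^ (2 * n + 2))) 1" for n
  have y: "0 < y n" "y n \<le> 1" for n using \<psi>(1)[of "real S ^ (2 * n + 2)"] S1 by (auto simp: y_def)
  define Q where "Q n = real S ^ (2 * n)" for n
  define \<Phi> where "\<Phi> n = y n / real S ^ n" for n
  define \<rho> where "\<rho> n = 1 / (c1 * (Q n)\<^sup>2 * \<Phi> n)" for n
  \<comment> \<open>Moving a parameter by less than \<open>r n\<close> changes q X and q Y by at
    most half of \<open>\<Phi> n\<close>, since q is at most \<open>M * Q n\<close> and the speeds
    are at most \<open>c2\<close> and \<open>c2 * L\<close>.\<close>
  define k where "k = 1 / (2 * M * c2 * (L + 1))"
  define r where "r n = k * \<Phi> n / Q n" for n
  define f where "f n = real S ^ n * (y n)\<^sup>2" for n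
  define N where "N = {n. run_max f n \<le> f n}"
  have c2: "0 < c2" using c by simp
  have k: "0 < k" "M * c2 * k \<le> 1/2" "M * c2 * k * L \<le> 1/2"
  proof -
    show "0 < k" using M c2 L0 by (simp add: k_def)
    have eq: "M * c2 * k = 1 / (2 * (L + 1))" using M c2 by (simp add: k_def)
    show "M * c2 * k \<le> 1/2" "M * c2 * k * L \<le> 1/2" unfolding eq using L0 by (simp_all add: field_simps)
  qed
  have Sn: "1 \<le> real S ^ n" for n using S1 by simp
  have Sn0: "0 < real S ^ n" for n using S1 by simp
  have Q: "1 \<le> Q n" "0 < Q n" for n using Sn[of "2 * n"] Sn0[of "2 * n"] by (simp_all add: Q_def)
  have \<Phi>: "0 < \<Phi> n" "\<Phi> n \<le> 1" for n
    using y[of n] Sn[of n] Sn0[of n] by (simp_all add: \<Phi>_def divide_le_eq)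
  have \<Phi>\<psi>: "\<Phi> n \<le> \<psi> (real S ^ (2 * n + 2))" for n
    using Sn0[of n] by (simp add: \<Phi>_def y_def divide_le_eq mult.commute)
  have \<rho>: "0 < \<rho> n" "1 / \<rho> n = c1 * (real S ^ (3 * n) * y n)" for n
  proof -
    show "0 < \<rho> n" using c Q(2)[of n] \<Phi>(1)[of n] by (simp add: \<rho>_def)
    have "real S ^ (4 * n) = real S ^ (3 * n) * real S ^ n" by (simp flip: power_add)
    moreover have "(Q n)\<^sup>2 = real S ^ (4 * n)" by (simp add: Q_def power_mult[symmetric] mult.commute)
    ultimately show "1 / \<rho> n = c1 * (real S ^ (3 * n) * y n)"
      using Sn0[of n] by (simp add: \<rho>_def \<Phi>_def)
  qed
  have ratio: "r n / \<rho> n = k * c1 * (y n)\<^sup>2" for n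
  proof -
    have "real S ^ (2 * n) = real S ^ n * real S ^ n" by (simp add: mult_2 power_add)
    then show ?thesis using Sn0[of n] c
      by (simp add: r_def \<rho>_def \<Phi>_def Q_def power2_eq_square)
  qed
  have r0: "0 < r n" for n using k(1) Q(2)[of n] \<Phi>(1)[of n] by (simp add: r_def)
  have r\<rho>: "r n \<le> \<rho> n" for n
  proof -
    have "c1 * k \<le> (M * c2) * k"
      using M c k(1) mult_mono[of 1 M c1 c2] by (intro mult_right_mono) auto
    then have kc: "k * c1 \<le> 1" using k(2) by (simp only: mult.commute[of k c1])
    have "(y n)\<^sup>2 \<le> 1" using y[of n] by (simp add: power_le_one less_imp_le)
    then have "k * c1 * (y n)\<^sup>2 \<le> 1" using kc k c mult_mono[of "k * c1" 1 "(y n)\<^sup>2" 1] by simp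
    then have "r n / \<rho> n \<le> 1" using ratio by simp
    then show ?thesis using \<rho>(1)[of n] by (simp add: divide_le_eq)
  qed
  \<comment> \<open>Up to \<open>c1\<close> this compares \<open>1 / \<rho> j\<close> with
    \<open>1 / \<rho> n\<close>. The square of S^(3 j) y j is S^(5 j) f j, and f j \<le> f n at a
    record; the remaining powers of S give more than the geometric gain claimed.\<close>
  have rec: "real S ^ (3 * j) * y j \<le> real S ^ (3 * n) * y n * (1 / real S) ^ (n - j)"
    if nj: "n \<in> N" "j < n" for n j
  proof (rule power2_le_imp_le)
    have fj: "f j \<le> f n" using run_max_ge[OF nj(2), of f] nj(1) by (simp add: N_def)
    obtain d where d: "n = j + d" using nj(2) less_imp_add_positive by blast
    have "(real S ^ (3 * j) * y j)\<^sup>2 = real S ^ (5 * j) * f j"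
    proof -
      have "(real S ^ (3 * j))\<^sup>2 = real S ^ (5 * j) * real S ^ j"
        by (simp add: power_mult[symmetric] flip: power_add)
      then show ?thesis by (simp add: f_def power_mult_distrib)
    qed
    also have "\<dots> \<le> real S ^ (5 * j) * f n" using fj by (intro mult_left_mono) auto
    also have "\<dots> \<le> (real S ^ (5 * j) * real S ^ (3 * d)) * f n"
      using Sn[of "3 * d"] by (intro mult_right_mono) (auto simp: f_def)
    also have "\<dots> = (real S ^ (3 * n) * y n * (1 / real S) ^ (n - j))\<^sup>2"
    proof -
      have "real S ^ (5 * j) * real S ^ (3 * d) * real S ^ n * (real S ^ d)\<^sup>2 = (real S ^ (3 * n))\<^sup>2"
        unfolding d by (simp add: power_mult[symmetric] flip: power_add) (simp add: algebra_simps)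
      then have "real S ^ (5 * j) * real S ^ (3 * d) * real S ^ n = (real S ^ (3 * n))\<^sup>2 / (real S ^ d)\<^sup>2"
        using Sn0[of d] by (simp add: eq_divide_eq)
      moreover have "(1 / real S) ^ (n - j) = 1 / real S ^ d" by (simp add: d power_one_over)
      ultimately show ?thesis
        by (simp add: f_def power_mult_distrib power_divide mult.assoc[symmetric])
    qed
    finally show "(real S ^ (3 * j) * y j)\<^sup>2 \<le> (real S ^ (3 * n) * y n * (1 / real S) ^ (n - j))\<^sup>2" .
  qed (use y[of n] Sn0 in auto)
  have lac: "(\<Sum>j | j \<in> N \<and> j < n. 1 / \<rho> j) \<le> (1/4) / 48 / \<rho> n" if n: "n \<in> N" for n
  proof -
    have geo: "(\<Sum>j<n. (1 / real S) ^ (n - j)) \<le> 1 / 192"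
    proof -
      have "(\<Sum>j<n. (1 / real S) ^ (n - j)) = (\<Sum>j<n. (1 / real S) ^ Suc j)"
        by (rule sum.reindex_bij_witness[of _ "\<lambda>j. n - Suc j" "\<lambda>j. n - Suc j"])
           (auto simp del: power_Suc simp: Suc_diff_Suc)
      also have "\<dots> \<le> 1 / 192"
      proof -
        have "(\<Sum>j<n. (1 / real S) ^ j) \<le> 2"
        proof -
          have "(\<Sum>j<n. (1 / real S) ^ j) \<le> (\<Sum>j. (1 / real S) ^ j)"
            using S1 S by (intro sum_le_suminf summable_geometric) auto
          also have "\<dots> = 1 / (1 - 1 / real S)" using S by (intro suminf_geometric) auto
          also have "\<dots> \<le> 2" using S by (simp add: field_simps)
          finally show ?thesis .
        qed
        then have "(1 / real S) * (\<Sum>j<n. (1 / real S) ^ j) \<le> (1 / real S) * 2"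
          by (intro mult_left_mono) auto
        also have "\<dots> \<le> 1 / 192" using S by (simp add: field_simps)
        finally show ?thesis by (simp add: sum_distrib_left)
      qed
      finally show ?thesis .
    qed
    have "(\<Sum>j | j \<in> N \<and> j < n. 1 / \<rho> j) \<le> (\<Sum>j | j \<in> N \<and> j < n. (1 / \<rho> n) * (1 / real S) ^ (n - j))"
    proof (rule sum_mono)
      fix j assume "j \<in> {j. j \<in> N \<and> j < n}"
      then show "1 / \<rho> j \<le> (1 / \<rho> n) * (1 / real S) ^ (n - j)"
        unfolding \<rho>(2) using rec[OF n, of j] c by (simp add: mult.assoc)
    qed
    also have "\<dots> \<le> (\<Sum>j<n. (1 / \<rho> n) * (1 / real S) ^ (n - j))"
      using \<rho>(1)[of n] S1 by (intro sum_mono2) auto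
    also have "\<dots> = (1 / \<rho> n) * (\<Sum>j<n. (1 / real S) ^ (n - j))" by (simp add: sum_distrib_left)
    also have "\<dots> \<le> (1 / \<rho> n) * (1 / 192)"
      using geo \<rho>(1)[of n] by (intro mult_left_mono) auto
    finally show ?thesis by simp
  qed
  have ns': "\<not> summable (\<lambda>n. (y n)\<^sup>2)"
    unfolding y_def using S by (intro truncated_condensed_not_summable \<psi> ns) auto
  have unb: "\<exists>K. B < (\<Sum>n | n \<in> N \<and> n < K. (y n)\<^sup>2)" for B
  proof (rule ccontr)
    assume "\<not> ?thesis"
    then have le: "(\<Sum>n | n \<in> N \<and> n < K. (y n)\<^sup>2) \<le> B" for K by (simp add: not_less)
    have "summable (\<lambda>n. (y n)\<^sup>2)"
    proof (rule summableI_nonneg_bounded)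
      fix K
      have "0 \<le> 2 * run_max f K / real S ^ K" using run_max_nonneg[of f K] Sn0[of K] by simp
      moreover have "(\<Sum>n<K. (y n)\<^sup>2) + 2 * run_max f K / real S ^ K \<le> 2 * (\<Sum>n | n \<in> N \<and> n < K. (y n)\<^sup>2)"
        using sum_le_sum_records[OF S1(2), of "\<lambda>n. (y n)\<^sup>2" K] unfolding f_def[symmetric] N_def mem_Collect_eq by simp
      ultimately show "(\<Sum>n<K. (y n)\<^sup>2) \<le> 2 * B" using le[of K] by simp
    qed simp
    then show False using ns' by blast
  qed
  have div: "\<exists>K. B < (\<Sum>n | n \<in> N \<and> n < K. r n / \<rho> n)" for B
  proof -
    obtain K where "B / (k * c1) < (\<Sum>n | n \<in> N \<and> n < K. (y n)\<^sup>2)" using unb by blast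
    then have "B < k * c1 * (\<Sum>n | n \<in> N \<and> n < K. (y n)\<^sup>2)"
      using k c by (simp add: pos_divide_less_eq mult.commute)
    then show ?thesis by (auto simp: ratio sum_distrib_left intro!: exI[of _ K])
  qed
  obtain j0 where j0: "j0 \<in> N" using unb[of 0] by fastforce
  \<comment> \<open>The square of \<open>Q n * \<Phi> n\<close> is S^n f n, and \<open>f\<close>
    stays above \<open>f j0\<close> at later records. This forces \<open>Q n * \<Phi> n\<close> to
    infinity along \<open>N\<close>, the condition under which nondivergence applies.\<close>
  have QPhi: "real S ^ n * f j0 \<le> (Q n * \<Phi> n)\<^sup>2" if "n \<in> N" "j0 < n" for n
  proof -
    have "f j0 \<le> f n" using run_max_ge[OF that(2), of f] that(1) by (simp add: N_def)
    then have "real S ^ n * f j0 \<le> real S ^ n * f n" by (intro mult_left_mono) auto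
    also have "\<dots> = (Q n * \<Phi> n)\<^sup>2"
    proof -
      have "real S ^ (2 * n) = real S ^ n * real S ^ n" by (simp add: mult_2 power_add)
      then have "Q n * \<Phi> n = real S ^ n * y n" using Sn0[of n] by (simp add: Q_def \<Phi>_def)
      then show ?thesis by (simp add: f_def power2_eq_square mult_ac)
    qed
    finally show ?thesis .
  qed
  have large: "\<exists>n1. \<forall>n\<in>N. n1 \<le> n \<longrightarrow> K \<le> Q n \<and> K \<le> Q n * \<Phi> n" for K
  proof -
    have f0: "0 < f j0" using y[of j0] Sn0[of j0] by (simp add: f_def)
    obtain n1 where "max K (K\<^sup>2 / f j0) < real S ^ n1"
      using real_arch_pow[of "real S" "max K (K\<^sup>2 / f j0)"] S1(2) by auto
    then have n1: "max K (K\<^sup>2 / f j0) \<le> real S ^ n" if "n1 \<le> n" for n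
      using power_increasing[OF that S1(1)] by linarith
    have "K \<le> Q n \<and> K \<le> Q n * \<Phi> n" if n: "n \<in> N" "max n1 (Suc j0) \<le> n" for n
    proof
      have "real S ^ n \<le> Q n" unfolding Q_def using S1 by (intro power_increasing) auto
      then show "K \<le> Q n" using n1[of n] n by simp
      have "K\<^sup>2 / f j0 \<le> real S ^ n" using n1[of n] n by simp
      then have "K\<^sup>2 \<le> real S ^ n * f j0" using f0 by (simp add: pos_divide_le_eq)
      also have "\<dots> \<le> (Q n * \<Phi> n)\<^sup>2" using QPhi n by simp
      finally have "K\<^sup>2 \<le> (Q n * \<Phi> n)\<^sup>2" .
      moreover have "0 \<le> Q n * \<Phi> n" using Q(2)[of n] \<Phi>(1)[of n] by simp
      ultimately show "K \<le> Q n * \<Phi> n" by (rule power2_le_imp_le)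
    qed
    then show ?thesis by blast
  qed
  have lim: "\<exists>n1. \<forall>n\<in>N. n1 \<le> n \<longrightarrow> \<rho> n \<le> e" if e: "0 < e" for e
  proof -
    obtain n1 where n1: "\<And>n. n \<in> N \<Longrightarrow> n1 \<le> n \<Longrightarrow> max 1 (1 / (c1 * e)) \<le> Q n \<and> max 1 (1 / (c1 * e)) \<le> Q n * \<Phi> n"
      using large[of "max 1 (1 / (c1 * e))"] by blast
    have "\<rho> n \<le> e" if "n \<in> N" "n1 \<le> n" for n
    proof -
      have h: "1 / (c1 * e) \<le> Q n" "1 \<le> Q n * \<Phi> n" using n1[OF that] by auto
      have "1 \<le> c1 * e * Q n" using h(1) c e by (simp add: pos_divide_le_eq mult.commute)
      also have "\<dots> \<le> c1 * e * Q n * (Q n * \<Phi> n)"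
        using mult_left_mono[OF h(2), of "c1 * e * Q n"] c e Q[of n] by simp
      finally have "1 \<le> e * (c1 * (Q n)\<^sup>2 * \<Phi> n)" by (simp add: power2_eq_square mult_ac)
      then show ?thesis using c Q[of n] \<Phi>[of n] by (simp add: \<rho>_def pos_divide_le_eq)
    qed
    then show ?thesis by blast
  qed
  define R where "R n = resonant \<eta> (Q n) (\<Phi> n)" for n
  define A where "A n0 = (\<Union>n\<in>N \<inter> {n0..}. \<Union>\<tau>\<in>R n. ball \<tau> (r n))" for n0
  have null: "{\<alpha>..\<beta>} - A n0 \<in> null_sets lebesgue" for n0
  proof (rule null_of_interval_density[OF _ \<alpha>\<beta>])
    have "open (A n0)" by (auto simp: A_def)
    then show "A n0 \<in> sets lebesgue" by (simp add: borel_open)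
    show "0 < (1/4) / 24 * (1::real)" by simp
    fix s t assume st: "s < t" "{s..t} \<subseteq> {\<alpha>..\<beta>}"
    define s' t' where "s' = s + (t - s) / 4" and "t' = t - (t - s) / 4"
    have st': "s' < t'" "{s'..t'} \<subseteq> {s..t}" using st by (auto simp: s'_def t'_def field_simps)
    obtain K where K: "\<And>Q \<Phi>. K \<le> Q \<Longrightarrow> 0 < \<Phi> \<Longrightarrow> \<Phi> \<le> 1 \<Longrightarrow> K \<le> Q * \<Phi> \<Longrightarrow>
        1/4 * (t' - s') \<le> measure lebesgue ({s'..t'} \<inter>
           (\<Union>\<tau>\<in>resonant \<eta> Q \<Phi> \<inter> {s'..t'}. ball \<tau> (1 / (c1 * Q\<^sup>2 * \<Phi>))))"
      using ub[OF st'(1)] st' st by blast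
    obtain n1 where n1: "\<And>n. n \<in> N \<Longrightarrow> n1 \<le> n \<Longrightarrow> K \<le> Q n \<and> K \<le> Q n * \<Phi> n" using large[of K] by blast
    have "\<exists>n1. \<forall>n\<in>N. n1 \<le> n \<longrightarrow>
        1/4 * (t' - s') \<le> measure lebesgue ({s'..t'} \<inter> (\<Union>\<tau>\<in>R n \<inter> {s'..t'}. ball \<tau> (\<rho> n)))"
      unfolding R_def \<rho>_def using K \<Phi> n1 by blast
    from ubiquity_limsup_measure[OF st(1) _ _ this s'_def t'_def lac div lim, where ?n0.0 = n0]
    have "(1/4) / 24 * (t - s) \<le> measure lebesgue ({s..t} \<inter> (\<Union>n\<in>N \<inter> {n0..}. \<Union>\<tau>\<in>R n. ball \<tau> (r n)))"
      using r0 r\<rho> by simp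
    then show "(1/4) / 24 * 1 * (t - s) \<le> measure lebesgue (A n0 \<inter> {s..t})"
      by (simp add: A_def Int_commute)
  qed
  \<comment> \<open>A fixed parameter may lie near the same rational point at several scales; the
    bound \<open>\<eta> * Q n \<le> q\<close> makes the denominators unbounded and so yields
    infinitely many of them.\<close>
  have appr: "\<exists>q>q0. (\<exists>p r::int. \<bar>real q * X z - real_of_int p\<bar> < \<psi> (real q) \<and>
            \<bar>real q * Y z - real_of_int r\<bar> < \<psi> (real q))"
    if z: "z \<in> {\<alpha>..\<beta>}" "\<And>n0. z \<in> A n0" for z and q0 :: nat
  proof -
    obtain n1 where n1: "\<And>n. n \<in> N \<Longrightarrow> n1 \<le> n \<Longrightarrow> (real q0 + 1) / \<eta> \<le> Q n"
      using large[of "(real q0 + 1) / \<eta>"] by blast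
    obtain n \<tau> where n: "n \<in> N" "n1 \<le> n" "\<tau> \<in> R n" "z \<in> ball \<tau> (r n)"
      using z(2)[of n1] by (auto simp: A_def)
    obtain q p l :: int where \<tau>: "\<tau> \<in> {\<alpha>..\<beta>}" and q: "0 < q" "\<eta> * Q n \<le> real_of_int q"
        "real_of_int q \<le> M * Q n" "real_of_int q * X \<tau> = real_of_int p"
        "\<bar>real_of_int q * Y \<tau> - real_of_int l\<bar> < 2 * \<eta> * \<Phi> n"
      using n(3) unfolding R_def resonant_def M_def by blast
    have q': "real (nat q) = real_of_int q" using q(1) by simp
    have "real q0 + 1 \<le> \<eta> * Q n" using n1[OF n(1,2)] \<eta> by (simp add: pos_divide_le_eq mult.commute)
    then have qq0: "q0 < nat q" using q(2) q' by linarith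
    have zt: "\<bar>z - \<tau>\<bar> < r n" using n(4) by (auto simp: dist_real_def abs_minus_commute)
    have \<psi>q: "\<Phi> n \<le> \<psi> (real_of_int q)"
    proof -
      have "M * Q n \<le> (real S)\<^sup>2 * Q n" using MS Q[of n] by (intro mult_right_mono) auto
      also have "\<dots> = real S ^ (2 * n + 2)" by (simp add: Q_def power_add power2_eq_square)
      finally have "\<psi> (real S ^ (2 * n + 2)) \<le> \<psi> (real_of_int q)" using q by (intro \<psi>(2)) auto
      then show ?thesis using \<Phi>\<psi>[of n] by simp
    qed
    have qr: "real_of_int q * (c2 * \<bar>z - \<tau>\<bar>) \<le> M * c2 * k * \<Phi> n"
    proof -
      have "real_of_int q * (c2 * \<bar>z - \<tau>\<bar>) \<le> (M * Q n) * (c2 * r n)"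
        using q zt c2 by (intro mult_mono) auto
      also have "\<dots> = M * c2 * k * \<Phi> n" using Q[of n] by (simp add: r_def)
      finally show ?thesis .
    qed
    have Xz: "\<bar>X z - X \<tau>\<bar> \<le> c2 * \<bar>z - \<tau>\<bar>"
    proof (cases "z \<le> \<tau>")
      case True
      have "0 \<le> c1 * (\<tau> - z)" using c True by simp
      then show ?thesis using X_bilipschitz[OF z(1) \<tau> True] True by simp
    next
      case False
      have "0 \<le> c1 * (z - \<tau>)" using c False by simp
      then show ?thesis using X_bilipschitz[OF \<tau> z(1)] False by simp
    qed
    have Yz: "\<bar>Y z - Y \<tau>\<bar> \<le> c2 * L * \<bar>z - \<tau>\<bar>"
    proof -
      have "norm (Y z - Y \<tau>) \<le> c2 * L * norm (z - \<tau>)"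
      proof (rule field_differentiable_bound[where S = "{\<alpha>..\<beta>}" and f' = "\<lambda>t. dX t * m t"])
        fix x assume x: "x \<in> {\<alpha>..\<beta>}"
        show "(Y has_field_derivative dX x * m x) (at x within {\<alpha>..\<beta>})"
          using derivY[OF x] by (rule has_field_derivative_at_within)
        have "\<bar>dX x\<bar> * \<bar>m x\<bar> \<le> c2 * L" using dX[OF x] m_le[OF x] c by (intro mult_mono) auto
        then show "norm (dX x * m x) \<le> c2 * L" by (simp add: abs_mult)
      qed (use z \<tau> in auto)
      then show ?thesis by simp
    qed
    have "\<bar>real (nat q) * X z - real_of_int p\<bar> = real_of_int q * \<bar>X z - X \<tau>\<bar>"
      unfolding q' q(4)[symmetric] right_diff_distrib[symmetric] abs_mult using q(1) by simp
    also have "\<dots> \<le> real_of_int q * (c2 * \<bar>z - \<tau>\<bar>)" using Xz q(1) by (intro mult_left_mono) auto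
    also have "\<dots> \<le> M * c2 * k * \<Phi> n" by (rule qr)
    also have "\<dots> \<le> 1/2 * \<Phi> n" using k \<Phi>[of n] by (intro mult_right_mono) auto
    also have "\<dots> < \<Phi> n" using \<Phi>[of n] by simp
    also have "\<dots> \<le> \<psi> (real (nat q))" unfolding q' by (rule \<psi>q)
    finally have 1: "\<bar>real (nat q) * X z - real_of_int p\<bar> < \<psi> (real (nat q))" .
    have "real_of_int q * \<bar>Y z - Y \<tau>\<bar> \<le> real_of_int q * (c2 * L * \<bar>z - \<tau>\<bar>)" using Yz q(1) by (intro mult_left_mono) auto
    also have "\<dots> = real_of_int q * (c2 * \<bar>z - \<tau>\<bar>) * L" by simp
    also have "\<dots> \<le> M * c2 * k * \<Phi> n * L" using qr L0 by (intro mult_right_mono)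
    also have "\<dots> = M * c2 * k * L * \<Phi> n" by simp
    also have "\<dots> \<le> 1/2 * \<Phi> n" using k \<Phi>[of n] by (intro mult_right_mono) auto
    finally have Yq: "\<bar>real_of_int q * Y z - real_of_int q * Y \<tau>\<bar> \<le> 1/2 * \<Phi> n"
      unfolding right_diff_distrib[symmetric] abs_mult using q(1) by simp
    \<comment> \<open>The resonant point itself misses the second integer by up to
      \<open>\<Phi> n / 3\<close>; together with the displacement \<open>\<Phi> n / 2\<close> this
      is still below \<open>\<Phi> n\<close>.\<close>
    have "2 * \<eta> * \<Phi> n \<le> 1/3 * \<Phi> n" using \<eta> \<Phi>[of n] by (intro mult_right_mono) auto
    then have "\<bar>real_of_int q * Y z - real_of_int l\<bar> < \<Phi> n" using Yq q(5) \<Phi>[of n] by linarith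
    also have "\<dots> \<le> \<psi> (real (nat q))" unfolding q' by (rule \<psi>q)
    finally have 2: "\<bar>real (nat q) * Y z - real_of_int l\<bar> < \<psi> (real (nat q))" unfolding q' .
    show ?thesis using qq0 1 2 by blast
  qed
  have "{z\<in>{\<alpha>..\<beta>}. finite (close_denominators \<psi> (X z) (Y z))} \<subseteq> (\<Union>n0. {\<alpha>..\<beta>} - A n0)"
  proof (rule subsetI, rule ccontr)
    fix z assume z: "z \<in> {z\<in>{\<alpha>..\<beta>}. finite (close_denominators \<psi> (X z) (Y z))}" "z \<notin> (\<Union>n0. {\<alpha>..\<beta>} - A n0)"
    let ?F = "close_denominators \<psi> (X z) (Y z)"
    have zz: "z \<in> {\<alpha>..\<beta>}" "\<And>n0. z \<in> A n0" using z by auto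
    have "\<exists>q>q0. q \<in> ?F" for q0
    proof -
      obtain q where "q > q0" "\<exists>p r::int. \<bar>real q * X z - real_of_int p\<bar> < \<psi> (real q) \<and>
            \<bar>real q * Y z - real_of_int r\<bar> < \<psi> (real q)" using appr[OF zz] by blast
      then show ?thesis by (intro exI[of _ q]) auto
    qed
    then have "infinite ?F" unfolding infinite_nat_iff_unbounded by blast
    then show False using z by blast
  qed
  moreover have "(\<Union>n0. {\<alpha>..\<beta>} - A n0) \<in> null_sets lebesgue" using null by (rule null_sets_UN)
  ultimately show ?thesis using null_sets_completion_subset by blast
qed

end

section \<open>Images of null sets\<close>

lemma hausdorff1_eq_0I:
  assumes "\<And>\<delta> e. 0 < \<delta> \<Longrightarrow> 0 < e \<Longrightarrow> \<exists>E::nat \<Rightarrow> 'a::metric_space set. A \<subseteq> (\<Union>i. E i) \<and>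
     (\<forall>i. bounded (E i) \<and> diameter (E i) \<le> \<delta>) \<and> (\<Sum>i. ennreal (diameter (E i))) \<le> ennreal e"
  shows "hausdorff1 A = 0"
proof -
  have "(INF E\<in>{E::nat \<Rightarrow> 'a set. A \<subseteq> (\<Union>i. E i) \<and> (\<forall>i. bounded (E i) \<and> diameter (E i) \<le> \<delta>)}.
          (\<Sum>i. ennreal (diameter (E i)))) \<le> 0" (is "?I \<le> 0") if \<delta>: "0 < \<delta>" for \<delta>
  proof (rule ennreal_le_epsilon)
    fix e :: real assume "0 < e"
    from assms[OF \<delta> this] obtain E :: "nat \<Rightarrow> 'a set" where E: "A \<subseteq> (\<Union>i. E i)"
      "\<forall>i. bounded (E i) \<and> diameter (E i) \<le> \<delta>" "(\<Sum>i. ennreal (diameter (E i))) \<le> ennreal e" by blast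
    have "?I \<le> (\<Sum>i. ennreal (diameter (E i)))" using E by (intro INF_lower) auto
    then show "?I \<le> 0 + ennreal e" using E(3) by simp
  qed
  then show ?thesis unfolding hausdorff1_def by (intro antisym SUP_least) auto
qed

text \<open>An open superset of \<open>Z\<close> of small measure splits into countably many
  intervals, its components. The distance of two points in a component is at most its measure, so
  the image pieces have diameters controlled by these measures, whose sum is small.\<close>

lemma lipschitz_image_negligible_cover:
  fixes f :: "real \<Rightarrow> 'a::real_normed_vector"
  assumes neg: "negligible Z" and lip: "\<And>x y. x \<in> Z \<Longrightarrow> y \<in> Z \<Longrightarrow> norm (f x - f y) \<le> B * \<bar>x - y\<bar>"
    and pos: "0 < \<delta>" "0 < e"
  shows "\<exists>E::nat \<Rightarrow> 'a set. f ` Z \<subseteq> (\<Union>i. E i) \<and>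
     (\<forall>i. bounded (E i) \<and> diameter (E i) \<le> \<delta>) \<and> (\<Sum>i. ennreal (diameter (E i))) \<le> ennreal e"
proof -
  define b where "b = max B 1"
  have b: "0 < b" "B \<le> b" by (auto simp: b_def)
  \<comment> \<open>One choice bounds both each single diameter by \<delta> and the sum of all of
    them by \<open>e\<close>; \<open>b\<close> is \<open>B\<close> raised to at least 1 to allow the
    division.\<close>
  define e' where "e' = min \<delta> e / b"
  have e': "0 < e'" using pos b by (simp add: e'_def)
  have be': "b * e' = min \<delta> e" using b by (simp add: e'_def)
  have Zn: "Z \<in> null_sets lebesgue" using neg by (simp add: negligible_iff_null_sets)
  obtain T where T: "open T" "Z \<subseteq> T" "T - Z \<in> lmeasurable" "emeasure lebesgue (T - Z) < ennreal e'"
    using sets_lebesgue_outer_open[OF null_setsD2[OF Zn] e'] by metis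
  have Tm: "T \<in> sets lebesgue" using T(1) by (simp add: borel_open)
  have Te: "emeasure lebesgue T < ennreal e'"
    using emeasure_Diff_null_set[OF Zn Tm] T(4) by simp
  define \<C> where "\<C> = components T"
  have C_open: "open c" if "c \<in> \<C>" for c using that T(1) open_components by (auto simp: \<C>_def)
  have C_disj: "pairwise disjnt \<C>"
    unfolding \<C>_def pairwise_def disjnt_def using components_nonoverlap by blast
  have C_cnt: "countable \<C>" using countable_disjoint_open_subsets[OF C_open C_disj] .
  \<comment> \<open>The components listed by natural numbers; an index that encodes no component
    yields the empty set.\<close>
  define C where "C i = \<Union>{c\<in>\<C>. to_nat_on \<C> c = i}" for i
  have C_cases: "C i = {} \<or> C i \<in> \<C>" for i
  proof (cases "\<exists>c\<in>\<C>. to_nat_on \<C> c = i")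
    case True
    then obtain c where c: "c \<in> \<C>" "to_nat_on \<C> c = i" by blast
    then have "{c\<in>\<C>. to_nat_on \<C> c = i} = {c}"
      using inj_on_to_nat_on[OF C_cnt] by (auto dest: inj_onD)
    then show ?thesis using c by (simp add: C_def)
  next
    case False
    then have "{c\<in>\<C>. to_nat_on \<C> c = i} = {}" by blast
    then have "C i = {}" unfolding C_def by (simp only: Union_empty)
    then show ?thesis by blast
  qed
  have C_UN: "(\<Union>i. C i) = T"
  proof -
    have "(\<Union>i. C i) = \<Union>\<C>" by (auto simp: C_def)
    then show ?thesis by (simp add: \<C>_def Union_components[symmetric])
  qed
  have "disjoint_family C"
    unfolding disjoint_family_on_def
  proof (intro ballI impI)
    fix i j :: nat assume ij: "i \<noteq> j"
    have "disjnt c c'" if "c \<in> \<C>" "to_nat_on \<C> c = i" "c' \<in> \<C>" "to_nat_on \<C> c' = j" for c c'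
      using C_disj that ij by (metis pairwiseD)
    then show "C i \<inter> C j = {}" unfolding C_def disjnt_def by blast
  qed
  moreover have "range C \<subseteq> sets lebesgue"
  proof -
    have "open (C i)" for i using C_cases[of i] C_open by auto
    then show ?thesis by (auto simp: borel_open)
  qed
  ultimately have sumC: "(\<Sum>i. emeasure lebesgue (C i)) = emeasure lebesgue T"
    using suminf_emeasure[of C lebesgue] C_UN by simp
  have dist_le: "ennreal \<bar>x - y\<bar> \<le> emeasure lebesgue (C i)" if xy: "x \<in> C i" "y \<in> C i" for i x y
  proof -
    have "connected (C i)"
      using C_cases[of i] in_components_connected by (auto simp: \<C>_def)
    then have "{min x y..max x y} \<subseteq> C i"
      using xy by (metis connected_contains_Icc max_def min_def)
    moreover have "C i \<in> sets lebesgue" using \<open>range C \<subseteq> sets lebesgue\<close> by auto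
    ultimately have "emeasure lebesgue {min x y..max x y} \<le> emeasure lebesgue (C i)"
      by (intro emeasure_mono)
    moreover have "emeasure lebesgue {min x y..max x y} = ennreal \<bar>x - y\<bar>"
    proof -
      have "max x y - min x y = \<bar>x - y\<bar>" "min x y \<le> max x y" by auto
      then show ?thesis by simp
    qed
    ultimately show ?thesis by simp
  qed
  have fin: "emeasure lebesgue (C i) \<le> emeasure lebesgue T" for i
    using C_UN Tm by (intro emeasure_mono) auto
  define \<mu> where "\<mu> i = measure lebesgue (C i)" for i
  have em: "emeasure lebesgue (C i) = ennreal (\<mu> i)" for i
  proof -
    have "emeasure lebesgue (C i) \<noteq> \<infinity>" using fin[of i] Te
      by (metis ennreal_less_top infinity_ennreal_def leD order_less_trans top_greatest)
    then show ?thesis unfolding \<mu>_def infinity_ennreal_def by (rule emeasure_eq_ennreal_measure)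
  qed
  have \<mu>: "0 \<le> \<mu> i" "\<mu> i \<le> e'" for i
  proof -
    show "0 \<le> \<mu> i" by (simp add: \<mu>_def)
    have "ennreal (\<mu> i) < ennreal e'" using fin[of i] Te em[of i] by simp
    then show "\<mu> i \<le> e'" using e' by (simp add: ennreal_less_iff \<mu>_def)
  qed
  define E where "E i = f ` (Z \<inter> C i)" for i
  have dE: "dist u v \<le> b * \<mu> i" if uv: "u \<in> E i" "v \<in> E i" for u v i
  proof -
    obtain x y where xy: "x \<in> Z" "x \<in> C i" "u = f x" "y \<in> Z" "y \<in> C i" "v = f y"
      using uv by (auto simp: E_def)
    have "\<bar>x - y\<bar> \<le> \<mu> i" using dist_le[OF xy(2,5)] em[of i] \<mu>(1)[of i] by simp
    then have "B * \<bar>x - y\<bar> \<le> b * \<mu> i" using b by (intro mult_mono) auto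
    then show ?thesis using lip[OF xy(1,4)] xy by (simp add: dist_norm)
  qed
  have diamE: "diameter (E i) \<le> b * \<mu> i" for i
    using dE \<mu> b by (intro diameter_le) (auto simp: dist_norm)
  show ?thesis
  proof (intro exI[of _ E] conjI allI)
    show "f ` Z \<subseteq> (\<Union>i. E i)" using T(2) unfolding C_UN[symmetric] E_def by blast
    fix i
    show "bounded (E i)" using dE unfolding bounded_two_points by blast
    have "b * \<mu> i \<le> b * e'" using \<mu> b by (intro mult_left_mono) auto
    then show "diameter (E i) \<le> \<delta>" using diamE[of i] be' by simp
  next
    have "(\<Sum>i. ennreal (diameter (E i))) \<le> (\<Sum>i. ennreal b * emeasure lebesgue (C i))"
    proof (rule suminf_le)
      fix i
      have "ennreal (diameter (E i)) \<le> ennreal (b * \<mu> i)" using diamE by (rule ennreal_leI)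
      also have "\<dots> = ennreal b * emeasure lebesgue (C i)" using b by (simp add: em ennreal_mult')
      finally show "ennreal (diameter (E i)) \<le> ennreal b * emeasure lebesgue (C i)" .
    qed auto
    also have "\<dots> = ennreal b * emeasure lebesgue T" by (simp add: ennreal_suminf_cmult sumC)
    also have "\<dots> \<le> ennreal b * ennreal e'" using Te by (intro mult_left_mono) auto
    also have "\<dots> = ennreal (min \<delta> e)" using b be' by (simp flip: ennreal_mult')
    also have "\<dots> \<le> ennreal e" by (rule ennreal_leI) simp
    finally show "(\<Sum>i. ennreal (diameter (E i))) \<le> ennreal e" .
  qed
qed

text \<open>The Lipschitz constant may vary with the piece, so each piece is covered separately with
  error \<open>e * (1/2) ^ Suc n\<close>, and the double sequence of covering sets is flattened by
  pairing.\<close>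

lemma hausdorff1_countable_lipschitz_image:
  fixes f :: "real \<Rightarrow> 'a::real_normed_vector" and Z :: "nat \<Rightarrow> real set"
  assumes "\<And>n. negligible (Z n)"
    and "\<And>n x y. x \<in> Z n \<Longrightarrow> y \<in> Z n \<Longrightarrow> norm (f x - f y) \<le> B n * \<bar>x - y\<bar>"
  shows "hausdorff1 (f ` (\<Union>n. Z n)) = 0"
proof (rule hausdorff1_eq_0I)
  fix \<delta> e :: real assume pos: "0 < \<delta>" "0 < e"
  have "\<exists>E::nat \<Rightarrow> 'a set. f ` Z n \<subseteq> (\<Union>i. E i) \<and>
     (\<forall>i. bounded (E i) \<and> diameter (E i) \<le> \<delta>) \<and> (\<Sum>i. ennreal (diameter (E i))) \<le> ennreal (e * (1/2) ^ Suc n)" for n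
    using pos by (intro lipschitz_image_negligible_cover[OF assms(1)[of n] assms(2)]) auto
  then obtain E :: "nat \<Rightarrow> nat \<Rightarrow> 'a set" where E: "\<And>n. f ` Z n \<subseteq> (\<Union>i. E n i)"
     "\<And>n i. bounded (E n i) \<and> diameter (E n i) \<le> \<delta>"
     "\<And>n. (\<Sum>i. ennreal (diameter (E n i))) \<le> ennreal (e * (1/2) ^ Suc n)"
    by metis
  define F where "F k = case_prod E (prod_decode k)" for k
  have "(\<Sum>k. ennreal (diameter (F k))) = (\<Sum>n. \<Sum>i. ennreal (diameter (E n i)))"
    unfolding F_def by (intro suminf_ennreal_2dimen[where f = "\<lambda>p. ennreal (diameter (case_prod E p))"]) simp
  also have "\<dots> \<le> (\<Sum>n. ennreal (e * (1/2) ^ Suc n))"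
    using E(3) by (intro suminf_le) auto
  also have "\<dots> = ennreal e * (\<Sum>n. ennreal ((1/2) ^ Suc n))"
    using pos by (simp add: ennreal_mult' ennreal_suminf_cmult del: power_Suc)
  also have "(\<Sum>n. ennreal ((1/2) ^ Suc n)) = ennreal 1"
    by (rule suminf_ennreal_eq[OF _ power_half_series]) simp
  finally have "(\<Sum>k. ennreal (diameter (F k))) \<le> ennreal e" by simp
  moreover have "f ` (\<Union>n. Z n) \<subseteq> (\<Union>k. F k)"
  proof
    fix z assume "z \<in> f ` (\<Union>n. Z n)"
    then obtain n i where "z \<in> E n i" using E(1) by blast
    then have "z \<in> F (prod_encode (n, i))" by (simp add: F_def)
    then show "z \<in> (\<Union>k. F k)" by blast
  qed
  moreover have "bounded (F k) \<and> diameter (F k) \<le> \<delta>" for k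
    using E(2) by (auto simp: F_def split: prod.split)
  ultimately show "\<exists>E::nat \<Rightarrow> 'a set. f ` (\<Union>n. Z n) \<subseteq> (\<Union>i. E i) \<and>
     (\<forall>i. bounded (E i) \<and> diameter (E i) \<le> \<delta>) \<and> (\<Sum>i. ennreal (diameter (E i))) \<le> ennreal e" by blast
qed

section \<open>Nondegenerate inflection points are countable\<close>

text \<open>Balls of half the isolation radius are pairwise disjoint and open.\<close>

lemma countable_isolated_points:
  fixes P :: "real set"
  shows "countable {x\<in>P. \<not> x islimpt P}"
proof -
  let ?I = "{x\<in>P. \<not> x islimpt P}"
  have "\<exists>r>0. \<forall>y\<in>P. y \<noteq> x \<longrightarrow> r \<le> dist y x" if "x \<in> ?I" for x
    using that unfolding islimpt_approachable by (auto simp: not_less)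
  then obtain r where r: "\<And>x. x \<in> ?I \<Longrightarrow> 0 < r x" "\<And>x y. x \<in> ?I \<Longrightarrow> y \<in> P \<Longrightarrow> y \<noteq> x \<Longrightarrow> r x \<le> dist y x"
    by metis
  have disj: "ball x (r x / 2) \<inter> ball y (r y / 2) = {}" if xy: "x \<in> ?I" "y \<in> ?I" "x \<noteq> y" for x y
  proof -
    have "r x \<le> dist x y" "r y \<le> dist x y"
      using r(2)[OF xy(1), of y] r(2)[OF xy(2), of x] xy by (auto simp: dist_commute)
    moreover have "dist x y \<le> dist x z + dist y z" for z by (rule dist_triangle2)
    ultimately show ?thesis by (simp add: disjoint_iff) (smt (verit) field_sum_of_halves)
  qed
  have "countable ((\<lambda>x. ball x (r x / 2)) ` ?I)"
  proof (rule countable_disjoint_open_subsets)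
    show "pairwise disjnt ((\<lambda>x. ball x (r x / 2)) ` ?I)"
      unfolding pairwise_def disjnt_def using disj by blast
  qed auto
  moreover have "inj_on (\<lambda>x. ball x (r x / 2)) ?I"
  proof (rule inj_onI, rule ccontr)
    fix x y assume h: "x \<in> ?I" "y \<in> ?I" "ball x (r x / 2) = ball y (r y / 2)" "x \<noteq> y"
    have "x \<in> ball x (r x / 2)" using r(1)[OF h(1)] by simp
    then show False using disj[OF h(1,2,4)] h(3) by blast
  qed
  ultimately show ?thesis by (rule countable_image_inj_on)
qed

text \<open>Finite stages of the Cantor-Bendixson process relative to \<open>P\<close>: each stage
  keeps only the limit points that belong to the previous one. Every stage removes isolated points
  only, hence countably many.\<close>

primrec derived_part :: "nat \<Rightarrow> real set \<Rightarrow> real set" where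
  "derived_part 0 P = P"
| "derived_part (Suc k) P = {x\<in>derived_part k P. x islimpt derived_part k P}"

lemma countable_diff_derived_part: "countable (P - derived_part k P)"
proof (induction k)
  case (Suc k)
  have "P - derived_part (Suc k) P \<subseteq> (P - derived_part k P) \<union>
      {x\<in>derived_part k P. \<not> x islimpt derived_part k P}" by auto
  then show ?case using Suc countable_isolated_points countable_Un countable_subset by metis
qed simp

lemma derived_part_subset: "derived_part k P \<subseteq> P"
  by (induction k) auto

lemma DERIV_zero_at_limit_point:
  fixes g :: "real \<Rightarrow> real"
  assumes g: "(g has_real_derivative D) (at x)" and x: "x islimpt P" "g x = 0"
    and P: "\<And>y. y \<in> P \<Longrightarrow> g y = 0"
  shows "D = 0"
proof -
  have "(g has_real_derivative D) (at x within P)" using g by (rule has_field_derivative_at_within)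
  then have lim: "((\<lambda>y. (g y - g x) / (y - x)) \<longlongrightarrow> D) (at x within P)"
    by (simp add: has_field_derivative_iff)
  have ev: "eventually (\<lambda>y. (g y - g x) / (y - x) = 0) (at x within P)"
    using P x(2) by (simp add: eventually_at_filter)
  have "((\<lambda>y. 0) \<longlongrightarrow> D) (at x within P)"
    by (rule tendsto_cong[OF ev, THEN iffD1, OF lim])
  moreover have "at x within P \<noteq> bot" using x(1) by (simp add: trivial_limit_within)
  ultimately show ?thesis using tendsto_unique[OF _ _ tendsto_const] by blast
qed

section \<open>Parallel vectors and successive derivatives in the plane\<close>

definition det2 :: "real ^ 2 \<Rightarrow> real ^ 2 \<Rightarrow> real" where
  "det2 u v = u $ 1 * v $ 2 - u $ 2 * v $ 1"

lemma det2_parallel: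
  assumes "a \<noteq> 0" "det2 a b = 0" "det2 a c = 0"
  shows "det2 b c = 0"
proof -
  have e: "a $ 1 * b $ 2 = a $ 2 * b $ 1" "a $ 1 * c $ 2 = a $ 2 * c $ 1"
    using assms by (simp_all add: det2_def)
  have "a $ 1 * det2 b c = b $ 1 * (a $ 1 * c $ 2) - c $ 1 * (a $ 1 * b $ 2)"
    by (simp add: det2_def algebra_simps)
  also have "\<dots> = 0" unfolding e by simp
  finally have 1: "a $ 1 * det2 b c = 0" .
  have "a $ 2 * det2 b c = c $ 2 * (a $ 2 * b $ 1) - b $ 2 * (a $ 2 * c $ 1)"
    by (simp add: det2_def algebra_simps)
  also have "\<dots> = 0" unfolding e[symmetric] by simp
  finally have 2: "a $ 2 * det2 b c = 0" .
  have "a $ 1 \<noteq> 0 \<or> a $ 2 \<noteq> 0" using assms(1) by (auto simp: vec_eq_iff forall_2)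
  then show ?thesis using 1 2 by auto
qed

lemma span_eq_UNIV_det2:
  assumes "span S = UNIV" "\<And>v. v \<in> S \<Longrightarrow> det2 a v = 0"
  shows "a = 0"
proof -
  have "subspace {v. det2 a v = 0}"
    unfolding subspace_def by (auto simp: det2_def algebra_simps)
  then have "span S \<subseteq> {v. det2 a v = 0}" using assms(2) by (intro span_minimal) auto
  then have "det2 a (axis 1 1) = 0" "det2 a (axis 2 1) = 0" using assms(1) by auto
  then show ?thesis by (simp add: det2_def axis_def vec_eq_iff forall_2)
qed

lemma higher_vector_derivative_Suc:
  assumes "higher_vector_derivative j f differentiable (at t)"
  shows "(higher_vector_derivative j f has_vector_derivative higher_vector_derivative (Suc j) f t) (at t)"
  using assms by (simp add: higher_vector_derivative_def vector_derivative_works)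

lemma has_real_derivative_vec_nth:
  fixes g :: "real \<Rightarrow> real ^ 'n"
  assumes "(g has_vector_derivative D) (at t)"
  shows "((\<lambda>t. g t $ i) has_real_derivative D $ i) (at t)"
  using bounded_linear.has_vector_derivative[OF bounded_linear_vec_nth assms]
  by (simp add: has_real_derivative_iff_has_vector_derivative)

text \<open>A function vanishing on a set has zero derivative at the limit points of that set. Iterating this on
  the inflection points shows that at a point surviving \<open>l\<close> derivations the first \<open>l\<close> derivatives
  are all zero, or all parallel to the first one.\<close>

lemma countable_nondegenerate_inflection:
  fixes f :: "real \<Rightarrow> real ^ 2"
  defines "H \<equiv> \<lambda>j. higher_vector_derivative j f"
  assumes D: "\<And>u. u \<in> D \<Longrightarrow> det2 (H 1 u) (H 2 u) = 0" "\<And>u. u \<in> D \<Longrightarrow> nondegenerate_at U f u"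
  shows "countable D"
proof -
  \<comment> \<open>The order \<open>l\<close> may differ from point to point, but there are only
    countably many orders.\<close>
  define Dl where "Dl l = {u\<in>D. (\<exists>r>0. ball u r \<subseteq> U \<and> Ck_on l f (ball u r)) \<and>
          span ((\<lambda>j. H j u) ` {1..l}) = UNIV}" for l
  have "D \<subseteq> (\<Union>l. Dl l)"
  proof
    fix u assume u: "u \<in> D"
    obtain l where "(\<exists>r>0. ball u r \<subseteq> U \<and> Ck_on l f (ball u r)) \<and>
          span ((\<lambda>j. H j u) ` {1..l}) = UNIV"
      using D(2)[OF u] unfolding nondegenerate_at_def H_def by (elim exE)
    then have "u \<in> Dl l" unfolding Dl_def by (intro CollectI conjI[OF u])
    then show "u \<in> (\<Union>l. Dl l)" by blast
  qed
  moreover have "countable (Dl l)" for l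
  proof -
    have der: "((\<lambda>t. H j t $ i) has_real_derivative H (Suc j) u $ i) (at u)" if u: "u \<in> Dl l" "j < l" for u j i
    proof -
      obtain r where "r > 0" "Ck_on l f (ball u r)" using u(1) by (auto simp: Dl_def)
      then have "higher_vector_derivative j f differentiable (at u)"
        using u(2) by (auto simp: Ck_on_def)
      then show ?thesis unfolding H_def
        by (intro has_real_derivative_vec_nth higher_vector_derivative_Suc)
    qed
    have sp: "span ((\<lambda>j. H j u) ` {1..l}) = UNIV" if "u \<in> Dl l" for u using that by (simp add: Dl_def)
    \<comment> \<open>A vanishing first derivative is treated apart, because parallelism with
      \<open>H 1 u\<close> carries information only when that vector is nonzero.\<close>
    define A where "A = {u\<in>Dl l. H 1 u = 0}"
    define B where "B = {u\<in>Dl l. H 1 u \<noteq> 0}"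
    have A_Dl: "u \<in> Dl l" if "u \<in> derived_part k A" for u k
      using that derived_part_subset[of k A] by (auto simp: A_def)
    have B_Dl: "u \<in> Dl l" "H 1 u \<noteq> 0" if "u \<in> derived_part k B" for u k
      using that derived_part_subset[of k B] by (auto simp: B_def)
    have A_zero: "\<forall>j. 1 \<le> j \<and> j \<le> l \<and> j \<le> Suc k \<longrightarrow> H j u = 0" if "u \<in> derived_part k A" for u k
      using that
    proof (induction k arbitrary: u)
      case 0
      then show ?case by (auto simp: A_def le_Suc_eq)
    next
      case (Suc k)
      have u: "u \<in> derived_part k A" "u islimpt derived_part k A" using Suc.prems by auto
      have "H j u = 0" if j: "1 \<le> j" "j \<le> l" "j \<le> Suc (Suc k)" for j
      proof (cases "j \<le> Suc k")
        case True
        then show ?thesis using Suc.IH[OF u(1)] j by blast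
      next
        case False
        then have j': "j = Suc (Suc k)" "Suc k < l" using j by auto
        have zero: "H (Suc k) v = 0" if "v \<in> derived_part k A" for v
          using Suc.IH[OF that] j'(2) by auto
        have "H j u $ i = 0" for i
          unfolding j'(1)
          by (rule DERIV_zero_at_limit_point[OF der[OF A_Dl[OF u(1)] j'(2)] u(2)]) (simp_all add: zero u(1))
        then show ?thesis by (simp add: vec_eq_iff)
      qed
      then show ?case by blast
    qed
    have "derived_part l A = {}"
    proof (rule ccontr)
      assume "derived_part l A \<noteq> {}"
      then obtain u where u: "u \<in> derived_part l A" by blast
      \<comment> \<open>All derivatives up to order \<open>l\<close> vanish here, so any fixed
        nonzero vector shows that they do not span.\<close>
      have "det2 (axis 1 1) v = 0" if "v \<in> (\<lambda>j. H j u) ` {1..l}" for v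
        using that A_zero[OF u] by (auto simp: det2_def)
      then have "(axis 1 1 :: real ^ 2) = 0" using span_eq_UNIV_det2 sp[OF A_Dl[OF u]] by blast
      then show False by (simp add: axis_eq_0_iff)
    qed
    then have cA: "countable A" using countable_diff_derived_part[of A l] by simp
    \<comment> \<open>The bound starts at order 2, since orders 1 and 2 are parallel by the
      inflection condition; each derived stage gains one order.\<close>
    have B_zero: "\<forall>j. 1 \<le> j \<and> j \<le> l \<and> j \<le> Suc (Suc k) \<longrightarrow> det2 (H 1 u) (H j u) = 0" if "u \<in> derived_part k B" for u k
      using that
    proof (induction k arbitrary: u)
      case 0
      then have "u \<in> D" by (auto simp: B_def Dl_def)
      then have 2: "det2 (H 1 u) (H 2 u) = 0" by (rule D(1))
      have 1: "det2 (H 1 u) (H 1 u) = 0" by (simp add: det2_def)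
      show ?case
      proof (intro allI impI)
        fix j assume "1 \<le> j \<and> j \<le> l \<and> j \<le> Suc (Suc 0)"
        then have "j = 1 \<or> j = 2" by auto
        then show "det2 (H 1 u) (H j u) = 0" using 1 2 by metis
      qed
    next
      case (Suc k)
      have u: "u \<in> derived_part k B" "u islimpt derived_part k B" using Suc.prems by auto
      have "det2 (H 1 u) (H j u) = 0" if j: "1 \<le> j" "j \<le> l" "j \<le> Suc (Suc (Suc k))" for j
      proof (cases "j \<le> Suc (Suc k)")
        case True
        then show ?thesis using Suc.IH[OF u(1)] j by blast
      next
        case False
        define i where "i = Suc (Suc k)"
        have j': "j = Suc i" "i < l" "1 < l" "1 \<le> i" using j False by (auto simp: i_def)
        have zero: "det2 (H 1 v) (H i v) = 0" if "v \<in> derived_part k B" for v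
          using Suc.IH[OF that] j' by (auto simp: i_def)
        have two: "det2 (H 1 u) (H (Suc 1) u) = 0"
        proof -
          have "u \<in> D" using B_Dl(1)[OF u(1)] by (simp add: Dl_def)
          then show ?thesis using D(1)[of u] by (simp only: Suc_1 One_nat_def[symmetric])
        qed
        note d = der[OF B_Dl(1)[OF u(1)]]
        \<comment> \<open>Differentiating the determinant produces the wanted one of next order plus
          \<open>det2\<close> of orders 2 and \<open>i\<close>; the latter vanishes, as both vectors
          are parallel to the nonzero \<open>H 1 u\<close>.\<close>
        have "((\<lambda>t. det2 (H 1 t) (H i t)) has_real_derivative
            det2 (H (Suc 1) u) (H i u) + det2 (H 1 u) (H (Suc i) u)) (at u)"
          unfolding det2_def
          by (rule DERIV_cong[OF DERIV_diff[OF DERIV_mult[OF d[OF j'(3), of 1] d[OF j'(2), of 2]]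
                DERIV_mult[OF d[OF j'(3), of 2] d[OF j'(2), of 1]]]])
            (simp add: algebra_simps)
        from DERIV_zero_at_limit_point[OF this u(2) zero[OF u(1)] zero]
        have "det2 (H (Suc 1) u) (H i u) + det2 (H 1 u) (H (Suc i) u) = 0" .
        moreover have "det2 (H (Suc 1) u) (H i u) = 0"
          using det2_parallel[OF B_Dl(2)[OF u(1)] two zero[OF u(1)]] .
        ultimately show ?thesis by (simp add: j'(1))
      qed
      then show ?case by blast
    qed
    have "derived_part l B = {}"
    proof (rule ccontr)
      assume "derived_part l B \<noteq> {}"
      then obtain u where u: "u \<in> derived_part l B" by blast
      have "det2 (H 1 u) v = 0" if "v \<in> (\<lambda>j. H j u) ` {1..l}" for v
        using that B_zero[OF u] by auto
      then have "H 1 u = 0" using span_eq_UNIV_det2 sp[OF B_Dl(1)[OF u]] by blast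
      then show False using B_Dl(2)[OF u] by simp
    qed
    then have cB: "countable B" using countable_diff_derived_part[of B l] by simp
    have "Dl l = A \<union> B" by (auto simp: A_def B_def)
    then show ?thesis using cA cB by simp
  qed
  ultimately show ?thesis by (meson countable_UN countable_subset countableI_type)
qed

section \<open>Nondegenerate curves\<close>

lemma continuous_positive_bounds:
  fixes g :: "real \<Rightarrow> real"
  assumes "continuous_on {a..b} g" "a \<le> b" "\<And>t. t \<in> {a..b} \<Longrightarrow> 0 < g t"
  shows "\<exists>l u. 0 < l \<and> (\<forall>t\<in>{a..b}. l \<le> g t \<and> g t \<le> u)"
proof -
  have ne: "{a..b} \<noteq> {}" using assms(2) by simp
  obtain x where "x \<in> {a..b}" "\<forall>t\<in>{a..b}. g x \<le> g t"
    using continuous_attains_inf[OF compact_Icc ne assms(1)] by blast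
  moreover obtain y where "y \<in> {a..b}" "\<forall>t\<in>{a..b}. g t \<le> g y"
    using continuous_attains_sup[OF compact_Icc ne assms(1)] by blast
  ultimately show ?thesis using assms(3) by blast
qed

lemma ex_int_close_sign:
  fixes s :: real
  assumes "s = 1 \<or> s = - 1"
  shows "(\<exists>p::int. \<bar>q * (s * x) - real_of_int p\<bar> < e) \<longleftrightarrow> (\<exists>p::int. \<bar>q * x - real_of_int p\<bar> < e)"
  using assms
proof
  assume s: "s = - 1"
  have eq: "\<bar>q * (s * x) - real_of_int p\<bar> = \<bar>q * x - real_of_int (- p)\<bar>" for p :: int
    unfolding s by (simp add: abs_minus_commute)
  show ?thesis unfolding eq by (metis minus_minus)
qed simp

text \<open>On a small interval X' and the Wronskian W keep their signs. Reflecting the coordinates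
  by these signs makes X' positive and the slope increasing, and reflections preserve distances to
  the integers.\<close>

lemma null_not_approximable_near:
  fixes X Y dX dY ddX ddY :: "real \<Rightarrow> real" and \<psi> :: "real \<Rightarrow> real"
  assumes \<psi>: "\<And>x. 0 < x \<Longrightarrow> 0 < \<psi> x" "\<And>x y. 0 < x \<Longrightarrow> x \<le> y \<Longrightarrow> \<psi> y \<le> \<psi> x"
    and ns: "\<not> summable (\<lambda>h::nat. (\<psi> (real (Suc h)))\<^sup>2)"
    and U: "open U" "t0 \<in> U"
    and der: "\<And>t. t \<in> U \<Longrightarrow> (X has_real_derivative dX t) (at t)"
      "\<And>t. t \<in> U \<Longrightarrow> (Y has_real_derivative dY t) (at t)"
      "\<And>t. t \<in> U \<Longrightarrow> (dX has_real_derivative ddX t) (at t)"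
      "\<And>t. t \<in> U \<Longrightarrow> (dY has_real_derivative ddY t) (at t)"
    and cont: "continuous_on U ddX" "continuous_on U ddY"
    and ne: "dX t0 \<noteq> 0" "dX t0 * ddY t0 - dY t0 * ddX t0 \<noteq> 0"
  shows "\<exists>d>0. {z\<in>{t0 - d..t0 + d}. finite (close_denominators \<psi> (X z) (Y z))} \<in> null_sets lebesgue"
proof -
  define W where "W t = dX t * ddY t - dY t * ddX t" for t
  define s w where "s = sgn (dX t0)" and "w = sgn (W t0)"
  have s: "s = 1 \<or> s = - 1" "s * s = 1" and w: "w = 1 \<or> w = - 1"
    using ne by (auto simp: s_def w_def W_def sgn_if)
  have ws: "w * s = 1 \<or> w * s = - 1" using s w by auto
  have cd: "continuous_on U dX" "continuous_on U dY"
    by (rule continuous_at_imp_continuous_on, use der(3,4) DERIV_isCont in blast)+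
  have cW: "continuous_on U W" unfolding W_def by (intro continuous_intros cd cont)
  define P where "P = {t\<in>U. 0 < s * dX t} \<inter> {t\<in>U. 0 < w * W t}"
  have op: "open {t\<in>U. 0 < g t}" if "continuous_on U g" for g :: "real \<Rightarrow> real"
    using continuous_open_preimage[OF that U(1), of "{0<..}"] by (simp add: vimage_def Int_def)
  have "open P" unfolding P_def by (intro open_Int op continuous_intros cd cW)
  moreover have "t0 \<in> P"
    using U(2) ne by (auto simp: P_def s_def w_def W_def mult_sgn_abs[symmetric] sgn_if)
  ultimately obtain d where d: "0 < d" "cball t0 d \<subseteq> P" using open_contains_cball by blast
  define \<alpha> \<beta> where "\<alpha> = t0 - d" and "\<beta> = t0 + d"
  have \<alpha>\<beta>: "\<alpha> < \<beta>" using d by (simp add: \<alpha>_def \<beta>_def)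
  have I: "t \<in> U" "0 < s * dX t" "0 < w * W t" if "t \<in> {\<alpha>..\<beta>}" for t
    using that d(2) by (auto simp: \<alpha>_def \<beta>_def P_def cball_def dist_real_def subset_iff)
  have IU: "{\<alpha>..\<beta>} \<subseteq> U" using I(1) by blast
  have dXne: "dX t \<noteq> 0" if "t \<in> {\<alpha>..\<beta>}" for t using I(2)[OF that] by auto
  \<comment> \<open>The slope of the reflected curve: the sign \<open>s\<close> cancels from the
    quotient, and its derivative is \<open>w * W t\<close> over the square of
    \<open>dX t\<close>.\<close>
  define m where "m t = w * (dY t / dX t)" for t
  define dm where "dm t = w * W t / (dX t)\<^sup>2" for t
  have cI: "continuous_on {\<alpha>..\<beta>} dX" "continuous_on {\<alpha>..\<beta>} dY" "continuous_on {\<alpha>..\<beta>} W"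
    using cd cW IU continuous_on_subset by blast+
  have cm: "continuous_on {\<alpha>..\<beta>} m" and cdm: "continuous_on {\<alpha>..\<beta>} dm"
    unfolding m_def dm_def using dXne by (auto intro!: continuous_intros cI)
  obtain l1 u1 where b1: "0 < l1" "\<And>t. t \<in> {\<alpha>..\<beta>} \<Longrightarrow> l1 \<le> s * dX t \<and> s * dX t \<le> u1"
    using continuous_positive_bounds[of \<alpha> \<beta> "\<lambda>t. s * dX t"] I(2) cI \<alpha>\<beta>
    by (metis continuous_on_mult_left less_imp_le)
  have dmp: "0 < dm t" if "t \<in> {\<alpha>..\<beta>}" for t using I(3)[OF that] dXne[OF that] by (simp add: dm_def)
  obtain l2 u2 where b2: "0 < l2" "\<And>t. t \<in> {\<alpha>..\<beta>} \<Longrightarrow> l2 \<le> dm t \<and> dm t \<le> u2"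
    using continuous_positive_bounds[OF cdm _ dmp] \<alpha>\<beta> by (metis less_imp_le)
  have "bounded (m ` {\<alpha>..\<beta>})" using compact_continuous_image[OF cm compact_Icc] by (rule compact_imp_bounded)
  then obtain L where "\<forall>y\<in>m ` {\<alpha>..\<beta>}. norm y \<le> L" unfolding bounded_iff by blast
  then have L: "\<bar>m t\<bar> \<le> L" if "t \<in> {\<alpha>..\<beta>}" for t using that by simp
  have \<alpha>I: "\<alpha> \<in> {\<alpha>..\<beta>}" using \<alpha>\<beta> by simp
  interpret planar_curve \<alpha> \<beta> "min l1 l2" "max u1 u2" L "\<lambda>t. s * X t" "\<lambda>t. w * s * Y t" m "\<lambda>t. s * dX t" dm
  proof
    show "\<alpha> < \<beta>" "0 < min l1 l2" using \<alpha>\<beta> b1 b2 by auto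
    show "min l1 l2 \<le> max u1 u2" using b1(2)[OF \<alpha>I] by linarith
    fix t assume t: "t \<in> {\<alpha>..\<beta>}"
    show "((\<lambda>t. s * X t) has_real_derivative s * dX t) (at t)"
      using DERIV_cmult[OF der(1)[OF I(1)[OF t]]] .
    have eq: "w * s * dY t = s * dX t * m t" using dXne[OF t] by (simp add: m_def)
    show "((\<lambda>t. w * s * Y t) has_real_derivative s * dX t * m t) (at t)"
      by (rule DERIV_cong[OF DERIV_cmult[OF der(2)[OF I(1)[OF t]]] eq])
    show "(m has_real_derivative dm t) (at t)"
      unfolding m_def
    proof (rule DERIV_cong[OF DERIV_cmult[OF DERIV_divide[OF der(4)[OF I(1)[OF t]] der(3)[OF I(1)[OF t]] dXne[OF t]]]])
      show "w * ((ddY t * dX t - dY t * ddX t) / (dX t * dX t)) = dm t"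
        by (simp add: dm_def W_def power2_eq_square mult.commute)
    qed
    show "min l1 l2 \<le> s * dX t \<and> s * dX t \<le> max u1 u2" "min l1 l2 \<le> dm t \<and> dm t \<le> max u1 u2"
      using b1(2)[OF t] b2(2)[OF t] by auto
    show "\<bar>m t\<bar> \<le> L" by (rule L[OF t])
  qed
  have "(\<exists>p r::int. \<bar>q * (s * X z) - real_of_int p\<bar> < e \<and> \<bar>q * (w * s * Y z) - real_of_int r\<bar> < e) \<longleftrightarrow>
      (\<exists>p r::int. \<bar>q * X z - real_of_int p\<bar> < e \<and> \<bar>q * Y z - real_of_int r\<bar> < e)" for q z e
    using ex_int_close_sign[OF s(1), of q "X z" e] ex_int_close_sign[OF ws, of q "Y z" e] by blast
  then show ?thesis
    using null_not_approximable[OF \<psi> ns] d(1) unfolding \<alpha>_def \<beta>_def by auto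
qed

lemma int_dist_le: "int_dist x \<le> \<bar>x - real_of_int p\<bar>"
  unfolding int_dist_def by (rule cINF_lower) (auto intro!: bdd_belowI[of _ 0])

text \<open>The exceptional parameters fall into three null sets: those of nonzero curvature,
  handled locally; the nondegenerate inflection points, which are countable; and the degenerate
  ones, null by assumption. Since \<open>f\<close> is Lipschitz on each compact interval in
  \<open>U\<close>, their image has length zero.\<close>

theorem corollary1:
  fixes C :: "(real ^ 2) set" and U :: "real set" and f :: "real \<Rightarrow> real ^ 2"
  assumes "open U"
    and "C = f ` U"
    and "Ck_on 3 f U"
    and "nondegenerate_on U f"
  shows "khintchine_type_divergence C"
  unfolding khintchine_type_divergence_def almost_every_point_def
proof (intro allI impI)
  fix \<psi> :: "real \<Rightarrow> real"
  assume "approximating_function \<psi>" and ns: "\<not> summable (\<lambda>h::nat. (\<psi> (real (Suc h)))\<^sup>2)"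
  then have \<psi>: "\<And>x. 0 < x \<Longrightarrow> 0 < \<psi> x" "\<And>x y. 0 < x \<Longrightarrow> x \<le> y \<Longrightarrow> \<psi> y \<le> \<psi> x"
    by (auto simp: approximating_function_def)
  define H where "H j = higher_vector_derivative j f" for j
  have der: "(H j has_vector_derivative H (Suc j) t) (at t)" if "t \<in> U" "j < 3" for j t
    using assms(3) that unfolding Ck_on_def H_def by (intro higher_vector_derivative_Suc) auto
  have H0: "H 0 = f" by (simp add: H_def higher_vector_derivative_def)
  have cH: "continuous_on U (H j)" if "j < 3" for j
    using der that by (intro continuous_at_imp_continuous_on) (blast intro: has_vector_derivative_continuous)
  have dF: "((\<lambda>t. f t $ i) has_real_derivative H 1 t $ i) (at t)"
    "((\<lambda>t. H 1 t $ i) has_real_derivative H 2 t $ i) (at t)" if "t \<in> U" for t i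
    using has_real_derivative_vec_nth[OF der[OF that, of 0]] has_real_derivative_vec_nth[OF der[OF that, of 1]]
    by (simp_all add: H0 numeral_2_eq_2)
  have cH2: "continuous_on U (\<lambda>t. H 2 t $ i)" for i
    using cH[of 2] by (intro continuous_intros) auto
  define bad where "bad = {t\<in>U. \<not> simultaneously_approximable \<psi> (f t)}"
  define G where "G = {t\<in>U. det2 (H 1 t) (H 2 t) \<noteq> 0}"
  have bad_finite: "finite (close_denominators \<psi> (f z $ 1) (f z $ 2))" if "z \<in> bad" for z
  proof (rule finite_subset)
    show "finite {q::nat. 0 < q \<and> max (int_dist (real q * f z $ 1)) (int_dist (real q * f z $ 2)) < \<psi> (real q)}"
      using that by (simp add: bad_def simultaneously_approximable_def)
    show "close_denominators \<psi> (f z $ 1) (f z $ 2) \<subseteq>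
       {q::nat. 0 < q \<and> max (int_dist (real q * f z $ 1)) (int_dist (real q * f z $ 2)) < \<psi> (real q)}"
      using int_dist_le by (fastforce intro: le_less_trans)
  qed
  have near: "\<exists>d>0. negligible (bad \<inter> {x - d..x + d})" if x: "x \<in> G" for x
  proof -
    have xU: "x \<in> U" and det: "H 1 x $ 1 * H 2 x $ 2 - H 1 x $ 2 * H 2 x $ 1 \<noteq> 0"
      using x by (auto simp: G_def det2_def)
    have "\<exists>d>0. {z\<in>{x - d..x + d}. finite (close_denominators \<psi> (f z $ 1) (f z $ 2))} \<in> null_sets lebesgue"
    proof (cases "H 1 x $ 1 = 0")
      case False
      show ?thesis
        by (rule null_not_approximable_near[OF \<psi> ns assms(1) xU dF(1) dF(1) dF(2) dF(2) cH2 cH2 False det])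
    next
      \<comment> \<open>If the first coordinate is stationary, the second is not, because the
        determinant is nonzero; the coordinates are exchanged.\<close>
      case True
      then have ne: "H 1 x $ 2 \<noteq> 0" "H 1 x $ 2 * H 2 x $ 1 - H 1 x $ 1 * H 2 x $ 2 \<noteq> 0" using det by auto
      have "\<exists>d>0. {z\<in>{x - d..x + d}. finite (close_denominators \<psi> (f z $ 2) (f z $ 1))} \<in> null_sets lebesgue"
        by (rule null_not_approximable_near[OF \<psi> ns assms(1) xU dF(1) dF(1) dF(2) dF(2) cH2 cH2 ne])
      moreover have "(\<exists>p r::int. \<bar>real q * f z $ 2 - real_of_int p\<bar> < \<psi> (real q) \<and> \<bar>real q * f z $ 1 - real_of_int r\<bar> < \<psi> (real q))
        \<longleftrightarrow> (\<exists>p r::int. \<bar>real q * f z $ 1 - real_of_int p\<bar> < \<psi> (real q) \<and> \<bar>real q * f z $ 2 - real_of_int r\<bar> < \<psi> (real q))"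
        for z and q :: nat by blast
      ultimately show ?thesis by simp
    qed
    then obtain d where d: "0 < d" "negligible {z\<in>{x - d..x + d}. finite (close_denominators \<psi> (f z $ 1) (f z $ 2))}"
      unfolding negligible_iff_null_sets by blast
    have "negligible (bad \<inter> {x - d..x + d})"
      by (rule negligible_subset[OF d(2)]) (use bad_finite in blast)
    then show ?thesis using d(1) by blast
  qed
  have "negligible (bad \<inter> G)"
  proof (rule locally_negligible_alt[THEN iffD2], rule ballI)
    fix x assume x: "x \<in> bad \<inter> G"
    then obtain d where d: "0 < d" "negligible (bad \<inter> {x - d..x + d})" using near by blast
    show "\<exists>V. openin (top_of_set (bad \<inter> G)) V \<and> x \<in> V \<and> negligible V"
    proof (intro exI conjI)
      show "openin (top_of_set (bad \<inter> G)) (bad \<inter> G \<inter> ball x d)" by (simp add: openin_open_Int)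
      show "x \<in> bad \<inter> G \<inter> ball x d" using x d by simp
      show "negligible (bad \<inter> G \<inter> ball x d)"
        by (rule negligible_subset[OF d(2)]) (auto simp: dist_real_def abs_less_iff)
    qed
  qed
  moreover have "negligible {u\<in>U. \<not> nondegenerate_at U f u}"
  proof -
    have "U \<inter> space lebesgue \<in> sets lebesgue" using assms(1) by (simp add: borel_open)
    then have "AE u in lebesgue. u \<in> U \<longrightarrow> nondegenerate_at U f u"
      using assms(4) unfolding nondegenerate_on_def by (simp add: AE_restrict_space_iff)
    then obtain N where "N \<in> null_sets lebesgue" "{u. \<not> (u \<in> U \<longrightarrow> nondegenerate_at U f u)} \<subseteq> N"
      by (auto simp: eventually_ae_filter)
    then show ?thesis unfolding negligible_iff_null_sets[symmetric]
      by (auto intro: negligible_subset)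
  qed
  moreover have "negligible {u\<in>U. det2 (H 1 u) (H 2 u) = 0 \<and> nondegenerate_at U f u}"
    unfolding negligible_iff_null_sets H_def
    by (intro null_sets_completionI countable_imp_null_set_lborel
        countable_nondegenerate_inflection[where f = f and U = U]) auto
  ultimately have "negligible (bad \<inter> G \<union> {u\<in>U. \<not> nondegenerate_at U f u} \<union>
      {u\<in>U. det2 (H 1 u) (H 2 u) = 0 \<and> nondegenerate_at U f u})"
    by (intro negligible_Un)
  then have neg: "negligible bad"
    by (rule negligible_subset) (auto simp: bad_def G_def)
  \<comment> \<open>The closed intervals with rational ends contained in \<open>U\<close> cover it,
    and on each of them the continuous derivative is bounded, so countably many Lipschitz pieces
    suffice.\<close>
  define I where "I n = (case from_nat n :: rat \<times> rat of (a, b) \<Rightarrow> {real_of_rat a..real_of_rat b})" for n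
  define Z where "Z n = (if I n \<subseteq> U then bad \<inter> I n else {})" for n
  have "\<exists>B. \<forall>x\<in>Z n. \<forall>y\<in>Z n. norm (f x - f y) \<le> B * \<bar>x - y\<bar>" for n
  proof (cases "I n \<subseteq> U")
    case True
    have I: "compact (I n)" "convex (I n)" by (auto simp: I_def split: prod.split)
    have "compact (H 1 ` I n)"
      using I(1) continuous_on_subset[OF cH True, of 1] by (intro compact_continuous_image) auto
    then have "bounded (H 1 ` I n)" by (rule compact_imp_bounded)
    then obtain B where "\<forall>y\<in>H 1 ` I n. norm y \<le> B" unfolding bounded_iff by blast
    then have B: "norm (H 1 t) \<le> B" if "t \<in> I n" for t using that by blast
    have "norm (f x - f y) \<le> B * norm (x - y)" if "x \<in> I n" "y \<in> I n" for x y
    proof (rule differentiable_bound[OF I(2)])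
      fix t assume t: "t \<in> I n"
      have "(f has_vector_derivative H 1 t) (at t)" using der[of t 0] t True H0 by auto
      then show "(f has_derivative (\<lambda>h. h *\<^sub>R H 1 t)) (at t within I n)"
        unfolding has_vector_derivative_def by (rule has_derivative_at_withinI)
      show "onorm (\<lambda>h. h *\<^sub>R H 1 t) \<le> B"
      proof (rule onorm_le)
        fix h :: real
        show "norm (h *\<^sub>R H 1 t) \<le> B * norm h"
          using mult_right_mono[OF B[OF t], of "\<bar>h\<bar>"] by (simp add: mult.commute)
      qed
    qed (use that in auto)
    then show ?thesis unfolding Z_def by auto
  qed (simp add: Z_def)
  then obtain B where B: "\<And>n x y. x \<in> Z n \<Longrightarrow> y \<in> Z n \<Longrightarrow> norm (f x - f y) \<le> B n * \<bar>x - y\<bar>" by metis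
  have "negligible (Z n)" for n using negligible_subset[OF neg] by (simp add: Z_def)
  from hausdorff1_countable_lipschitz_image[OF this B] have "hausdorff1 (f ` (\<Union>n. Z n)) = 0" .
  moreover have "(\<Union>n. Z n) = bad"
  proof
    show "bad \<subseteq> (\<Union>n. Z n)"
    proof
      fix t assume t: "t \<in> bad"
      then have "t \<in> U" by (simp add: bad_def)
      then obtain e where e: "0 < e" "ball t e \<subseteq> U" using assms(1) open_contains_ball by blast
      obtain a b where ab: "t - e < real_of_rat a" "real_of_rat a < t" "t < real_of_rat b" "real_of_rat b < t + e"
        using of_rat_dense[of "t - e" t] of_rat_dense[of t "t + e"] e(1) by auto
      have In: "I (to_nat (a, b)) = {real_of_rat a..real_of_rat b}" by (simp add: I_def)
      have "I (to_nat (a, b)) \<subseteq> ball t e" unfolding In using ab by (auto simp: dist_real_def)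
      then have "t \<in> Z (to_nat (a, b))" using e(2) t ab unfolding Z_def In by auto
      then show "t \<in> (\<Union>n. Z n)" by blast
    qed
  qed (auto simp: Z_def split: if_splits)
  moreover have "{y\<in>C. \<not> simultaneously_approximable \<psi> y} = f ` bad"
    by (auto simp: assms(2) bad_def)
  ultimately show "hausdorff1 {y\<in>C. \<not> simultaneously_approximable \<psi> y} = 0" by simp
qed

end
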